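(* Let $k$ be a perfect field of characteristic $p>0$, let $k'$ be an algebraic extension of $k$, and let $A=k'[[X_1,\dots,X_n]]$ be the ring of formal power series in $n$ indeterminates over $k'$. Then the ring $A_{(\infty)}=k(t)_{per}\otimes_k A$ is noetherian.
   Context: $t$ is an indeterminate and $k(t)_{per}=\bigcup_{m\ge 0}k(t^{1/p^m})$ is the perfect closure of $k(t)$. *)

theory Defs
  imports "HOL-Algebra.Algebra" "HOL-Algebra.Algebraic_Closure_Type"
begin

text \<open>
  Fields are types of class \<open>field\<close>, turned into rings in the sense of \<open>HOL-Algebra\<close>
  by \<^const>\<open>ring_of_type_algebra\<close>. A \<open>k\<close>-algebra is a record of type \<open>module\<close> satisfying
  the locale \<open>algebra\<close>.
\<close>

abbreviation field_ring :: "'a::field ring"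
  where "field_ring \<equiv> ring_of_type_algebra"

definition perfect_field :: "'k::field itself \<Rightarrow> bool"
  where "perfect_field _ \<longleftrightarrow> CHAR('k) = 0 \<or> surj (\<lambda>x::'k. x ^ CHAR('k))"

text \<open>A field extension is given by a homomorphism, so \<open>range h\<close> is the copy of \<open>k\<close> inside \<open>k'\<close>.\<close>

definition algebraic_extension :: "('k::field \<Rightarrow> 'l::field) \<Rightarrow> bool"
  where "algebraic_extension h \<longleftrightarrow>
    h \<in> ring_hom field_ring field_ring \<and> (\<forall>y. ring.algebraic field_ring (range h) y)"


section \<open>The perfect closure of \<open>k(t)\<close>\<close>

text \<open>
  The fields \<open>k(t\<^sup>1\<^sup>/\<^sup>q)\<close>, \<open>q = p\<^sup>m\<close>, are formed inside an algebraic closure of \<open>k(t)\<close>.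
  In characteristic \<open>p > 0\<close> there is exactly one \<open>s\<close> with \<open>s\<^sup>q = t\<close>,
  so that \<open>{s. s\<^sup>q = t}\<close> is the singleton of \<open>t\<^sup>1\<^sup>/\<^sup>q\<close>.
\<close>

definition ratfun_const :: "'k::field \<Rightarrow> 'k poly fract alg_closure"
  where "ratfun_const c = to_ac (Fraction_Field.Fract [:c:] 1)"

definition ratfun_t :: "'k::field poly fract alg_closure"
  where "ratfun_t = to_ac (Fraction_Field.Fract [:0, 1:] 1)"

definition ratfun_root :: "nat \<Rightarrow> 'k::field poly fract alg_closure set"
  where "ratfun_root m =
    generate_field field_ring (range ratfun_const \<union> {s. s ^ (CHAR('k) ^ m) = ratfun_t})"

definition ratfun_per :: "('k::field, 'k poly fract alg_closure) module"
  where "ratfun_per =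
    \<lparr>carrier = (\<Union>m. ratfun_root m), monoid.mult = (*), one = 1, ring.zero = 0, add = (+),
     module.smult = (\<lambda>c x. ratfun_const c * x)\<rparr>"


section \<open>Formal power series in \<open>n\<close> indeterminates\<close>

text \<open>
  A power series over \<open>k'\<close> in \<open>X\<^sub>0, \<dots>, X\<^sub>n\<^sub>-\<^sub>1\<close> is its coefficient function,
  defined on finitely supported exponents
  and zero outside those supported in \<open>{..<n}\<close>. The sum in the product is finite.
  The \<open>k\<close>-algebra structure is that obtained from \<open>h : k \<rightarrow> k'\<close>.
\<close>

definition mfps :: "('k \<Rightarrow> 'l::field) \<Rightarrow> nat \<Rightarrow> ('k, (nat \<Rightarrow>\<^sub>0 nat) \<Rightarrow> 'l) module"
  where "mfps h n =
    \<lparr>carrier = {f. \<forall>\<alpha>. f \<alpha> \<noteq> 0 \<longrightarrow> Poly_Mapping.keys \<alpha> \<subseteq> {..<n}},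
     monoid.mult = (\<lambda>f g \<alpha>. \<Sum>(\<beta>, \<gamma>) | \<beta> + \<gamma> = \<alpha>. f \<beta> * g \<gamma>),
     one = (\<lambda>\<alpha>. if \<alpha> = 0 then 1 else 0),
     ring.zero = (\<lambda>\<alpha>. 0),
     add = (\<lambda>f g \<alpha>. f \<alpha> + g \<alpha>),
     module.smult = (\<lambda>c f \<alpha>. h c * f \<alpha>)\<rparr>"


section \<open>Tensor product of algebras\<close>

text \<open>
  The free abelian group on the pairs \<open>(b, a)\<close>, with the product
  \<open>(b, a) \<cdot> (b', a') = (b b', a a')\<close> extended biadditively.
\<close>

definition tensor_free ::
  "('k, 'b) module \<Rightarrow> ('k, 'a) module \<Rightarrow> ('b \<times> 'a \<Rightarrow>\<^sub>0 int) ring"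
  where "tensor_free B A =
    \<lparr>carrier = carrier (free_Abelian_group (carrier B \<times> carrier A)),
     monoid.mult = (\<lambda>x y. frag_extend (\<lambda>(b, a). frag_extend (\<lambda>(b', a').
       frag_of (b \<otimes>\<^bsub>B\<^esub> b', a \<otimes>\<^bsub>A\<^esub> a')) y) x),
     one = frag_of (\<one>\<^bsub>B\<^esub>, \<one>\<^bsub>A\<^esub>),
     ring.zero = 0,
     add = (+)\<rparr>"

definition tensor_relations ::
  "('k, 'r) ring_scheme \<Rightarrow> ('k, 'b) module \<Rightarrow> ('k, 'a) module \<Rightarrow> ('b \<times> 'a \<Rightarrow>\<^sub>0 int) set"
  where "tensor_relations K B A =
    {frag_of (b \<oplus>\<^bsub>B\<^esub> b', a) - frag_of (b, a) - frag_of (b', a) | b b' a.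
      b \<in> carrier B \<and> b' \<in> carrier B \<and> a \<in> carrier A} \<union>
    {frag_of (b, a \<oplus>\<^bsub>A\<^esub> a') - frag_of (b, a) - frag_of (b, a') | b a a'.
      b \<in> carrier B \<and> a \<in> carrier A \<and> a' \<in> carrier A} \<union>
    {frag_of (c \<odot>\<^bsub>B\<^esub> b, a) - frag_of (b, c \<odot>\<^bsub>A\<^esub> a) | c b a.
      c \<in> carrier K \<and> b \<in> carrier B \<and> a \<in> carrier A}"

text \<open>
  Dividing by the subgroup generated by the relations gives the tensor product of the underlying
  modules; that subgroup is an ideal of \<^const>\<open>tensor_free\<close>, so the quotient is a ring.
\<close>

definition tensor_null ::
  "('k, 'r) ring_scheme \<Rightarrow> ('k, 'b) module \<Rightarrow> ('k, 'a) module \<Rightarrow> ('b \<times> 'a \<Rightarrow>\<^sub>0 int) set"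
  where "tensor_null K B A =
    generate (free_Abelian_group (carrier B \<times> carrier A)) (tensor_relations K B A)"

definition tensor_algebra ::
  "('k, 'r) ring_scheme \<Rightarrow> ('k, 'b) module \<Rightarrow> ('k, 'a) module \<Rightarrow> ('b \<times> 'a \<Rightarrow>\<^sub>0 int) set ring"
  where "tensor_algebra K B A = tensor_free B A Quot tensor_null K B A"


section \<open>The constructions yield algebras and rings\<close>

lemma finite_exponent_splittings: "finite {(\<beta>, \<gamma>). \<beta> + \<gamma> = (\<alpha> :: nat \<Rightarrow>\<^sub>0 nat)}"
proof -
  let ?S = "{\<beta> :: nat \<Rightarrow>\<^sub>0 nat. \<exists>\<gamma>. \<beta> + \<gamma> = \<alpha>}"
  let ?F = "PiE (Poly_Mapping.keys \<alpha>) (\<lambda>i. {..Poly_Mapping.lookup \<alpha> i})"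
  have fF: "finite ?F" by (intro finite_PiE) auto
  have inj: "inj_on (\<lambda>\<beta>. restrict (Poly_Mapping.lookup \<beta>) (Poly_Mapping.keys \<alpha>)) ?S"
  proof (rule inj_onI, rule poly_mapping_eqI)
    fix x y i assume x: "x \<in> ?S" and y: "y \<in> ?S"
      and e: "restrict (Poly_Mapping.lookup x) (Poly_Mapping.keys \<alpha>) = restrict (Poly_Mapping.lookup y) (Poly_Mapping.keys \<alpha>)"
    show "Poly_Mapping.lookup x i = Poly_Mapping.lookup y i"
    proof (cases "i \<in> Poly_Mapping.keys \<alpha>")
      case True then show ?thesis using fun_cong[OF e, of i] by simp
    next
      case False
      then have "Poly_Mapping.lookup \<alpha> i = 0" by (simp add: in_keys_iff)
      then show ?thesis using x y by (auto simp: lookup_add dest!: arg_cong[where f="\<lambda>p. Poly_Mapping.lookup p i"])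
    qed
  qed
  have "finite ((\<lambda>\<beta>. restrict (Poly_Mapping.lookup \<beta>) (Poly_Mapping.keys \<alpha>)) ` ?S)"
    by (rule finite_subset[OF _ fF]) (auto simp: lookup_add)
  then have f: "finite ?S" using inj by (rule finite_imageD)
  have "{(\<beta>, \<gamma>). \<beta> + \<gamma> = \<alpha>} \<subseteq> (\<lambda>\<beta>. (\<beta>, \<alpha> - \<beta>)) ` ?S" by (auto simp: image_iff)
  then show ?thesis using f by (meson finite_surj)
qed

lemma mfps_mult_comm:
  fixes f g :: "(nat \<Rightarrow>\<^sub>0 nat) \<Rightarrow> 'l::field"
  shows "(\<Sum>(\<beta>, \<gamma>) | \<beta> + \<gamma> = \<alpha>. f \<beta> * g \<gamma>) = (\<Sum>(\<beta>, \<gamma>) | \<beta> + \<gamma> = \<alpha>. g \<beta> * f \<gamma>)"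
  by (rule sum.reindex_bij_witness[of _ "\<lambda>(a,b). (b,a)" "\<lambda>(a,b). (b,a)"]) (auto simp: ac_simps)

lemma mfps_mult_assoc:
  fixes f g k :: "(nat \<Rightarrow>\<^sub>0 nat) \<Rightarrow> 'l::field"
  shows "(\<Sum>(\<beta>, \<gamma>) | \<beta> + \<gamma> = \<alpha>. (\<Sum>(\<beta>', \<gamma>') | \<beta>' + \<gamma>' = \<beta>. f \<beta>' * g \<gamma>') * k \<gamma>)
     = (\<Sum>(\<beta>, \<gamma>) | \<beta> + \<gamma> = \<alpha>. f \<beta> * (\<Sum>(\<beta>', \<gamma>') | \<beta>' + \<gamma>' = \<gamma>. g \<beta>' * k \<gamma>'))"
  (is "?L = ?R")
proof -
  let ?P = "\<lambda>\<alpha>. {(\<beta>, \<gamma>). \<beta> + \<gamma> = (\<alpha> :: nat \<Rightarrow>\<^sub>0 nat)}"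
  have "?L = (\<Sum>u\<in>?P \<alpha>. \<Sum>v\<in>?P (fst u). f (fst v) * g (snd v) * k (snd u))"
    by (simp add: case_prod_unfold sum_distrib_right)
  also have "\<dots> = (\<Sum>(u,v)\<in>Sigma (?P \<alpha>) (\<lambda>u. ?P (fst u)). f (fst v) * g (snd v) * k (snd u))"
    by (rule sum.Sigma) (auto simp: finite_exponent_splittings)
  also have "\<dots> = (\<Sum>(u,v)\<in>Sigma (?P \<alpha>) (\<lambda>u. ?P (snd u)). f (fst u) * (g (fst v) * k (snd v)))"
    by (rule sum.reindex_bij_witness[of _
       "\<lambda>(u,v). ((fst u + fst v, snd v), (fst u, fst v))"
       "\<lambda>(u,v). ((fst v, snd v + snd u), (snd v, snd u))"]) (auto simp: ac_simps)
  also have "\<dots> = (\<Sum>u\<in>?P \<alpha>. \<Sum>v\<in>?P (snd u). f (fst u) * (g (fst v) * k (snd v)))"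
    by (rule sum.Sigma[symmetric]) (auto simp: finite_exponent_splittings)
  also have "\<dots> = ?R" by (simp add: case_prod_unfold sum_distrib_left)
  finally show ?thesis .
qed

lemma mfps_mult_one: "(\<Sum>(\<beta>, \<gamma>) | \<beta> + \<gamma> = \<alpha>. (if \<beta> = 0 then 1 else 0) * f \<gamma>) = (f (\<alpha> :: nat \<Rightarrow>\<^sub>0 nat) :: 'l::field)"
proof -
  have "(\<Sum>(\<beta>, \<gamma>) | \<beta> + \<gamma> = \<alpha>. (if \<beta> = 0 then 1 else 0) * f \<gamma>)
     = (\<Sum>u\<in>{(0::nat \<Rightarrow>\<^sub>0 nat,\<alpha>)}. case u of (\<beta>, \<gamma>) \<Rightarrow> (if \<beta> = 0 then 1 else 0) * f \<gamma>)"
    by (rule sum.mono_neutral_cong_right[OF finite_exponent_splittings]) (auto split: if_splits)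
  then show ?thesis by simp
qed

lemma mfps_algebra:
  fixes h :: "'k::field \<Rightarrow> 'l::field"
  assumes h: "h \<in> ring_hom field_ring field_ring"
  shows "algebra field_ring (mfps h n)"
proof -
  have h': "h (x * y) = h x * h y" "h (x + y) = h x + h y" "h 1 = 1" for x y
    using h by (auto simp: ring_hom_def ring_of_type_algebra_def)
  have cr: "cring (mfps h n)"
  proof (rule cringI)
    show "abelian_group (mfps h n)"
    proof (rule abelian_groupI)
      fix x assume "x \<in> carrier (mfps h n)"
      then show "\<exists>y\<in>carrier (mfps h n). y \<oplus>\<^bsub>mfps h n\<^esub> x = \<zero>\<^bsub>mfps h n\<^esub>"
        by (intro bexI[of _ "\<lambda>\<alpha>. - x \<alpha>"]) (auto simp: mfps_def)
    next
      fix x y assume "x \<in> carrier (mfps h n)" "y \<in> carrier (mfps h n)"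
      then show "x \<oplus>\<^bsub>mfps h n\<^esub> y \<in> carrier (mfps h n)"
        unfolding mfps_def by simp (metis add_0)
    qed (auto simp: mfps_def ac_simps)
    show "comm_monoid (mfps h n)"
    proof (rule comm_monoidI)
      fix x y assume xy: "x \<in> carrier (mfps h n)" "y \<in> carrier (mfps h n)"
      show "x \<otimes>\<^bsub>mfps h n\<^esub> y \<in> carrier (mfps h n)"
        unfolding mfps_def
      proof (simp, intro allI impI)
        fix \<alpha> assume "(\<Sum>(\<beta>, \<gamma>) | \<beta> + \<gamma> = \<alpha>. x \<beta> * y \<gamma>) \<noteq> 0"
        then obtain u where u: "u \<in> {(\<beta>, \<gamma>). \<beta> + \<gamma> = \<alpha>}" "(case u of (\<beta>, \<gamma>) \<Rightarrow> x \<beta> * y \<gamma>) \<noteq> 0"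
          by (rule sum.not_neutral_contains_not_neutral)
        then show "Poly_Mapping.keys \<alpha> \<subseteq> {..<n}"
          using xy keys_add[of "fst u" "snd u"] by (fastforce simp: mfps_def)
      qed
      show "x \<otimes>\<^bsub>mfps h n\<^esub> y = y \<otimes>\<^bsub>mfps h n\<^esub> x"
        by (auto simp: mfps_def intro!: ext mfps_mult_comm)
    next
      fix x y z
      show "x \<otimes>\<^bsub>mfps h n\<^esub> y \<otimes>\<^bsub>mfps h n\<^esub> z = x \<otimes>\<^bsub>mfps h n\<^esub> (y \<otimes>\<^bsub>mfps h n\<^esub> z)"
        by (auto simp: mfps_def intro!: ext mfps_mult_assoc)
    qed (auto simp: mfps_def mfps_mult_one intro!: ext)
    fix x y z
    show "(x \<oplus>\<^bsub>mfps h n\<^esub> y) \<otimes>\<^bsub>mfps h n\<^esub> z = x \<otimes>\<^bsub>mfps h n\<^esub> z \<oplus>\<^bsub>mfps h n\<^esub> y \<otimes>\<^bsub>mfps h n\<^esub> z"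
      by (auto simp: mfps_def case_prod_unfold distrib_right sum.distrib intro!: ext)
  qed
  show ?thesis
  proof (rule algebraI[OF cring_from_type_algebra cr])
  qed (auto simp: mfps_def ring_of_type_algebra_def h' algebra_simps case_prod_unfold sum_distrib_left intro!: ext)
qed

lemma field_field_ring: "field (field_ring :: 'a::field ring)" by auto

lemma ratfun_const_hom: "ratfun_const (c*d) = ratfun_const c * ratfun_const d"
 "ratfun_const (c+d) = ratfun_const c + ratfun_const d" "ratfun_const 1 = 1"
  by (auto simp: ratfun_const_def Fraction_Field.One_fract_def[symmetric] mult.commute pCons_one simp flip: to_ac_mult to_ac_add)

lemma ratfun_root_mono:
  assumes p: "CHAR('k::field) > 0"
  shows "ratfun_root m \<subseteq> (ratfun_root (Suc m) :: 'k poly fract alg_closure set)"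
proof -
  have sub: "subfield (ratfun_root (Suc m)) (field_ring :: 'k poly fract alg_closure ring)"
    unfolding ratfun_root_def
    by (rule field.generate_field_is_subfield[OF field_field_ring]) (simp add: ring_of_type_algebra_def)
  have mul: "a * b \<in> ratfun_root (Suc m)" if "a \<in> ratfun_root (Suc m)" "b \<in> ratfun_root (Suc m)" for a b :: "'k poly fract alg_closure"
    using subringE(6)[OF subfieldE(1)[OF sub] that] by (simp add: ring_of_type_algebra_def)
  have pw: "a ^ Suc i \<in> ratfun_root (Suc m)" if "a \<in> ratfun_root (Suc m)" for a :: "'k poly fract alg_closure" and i
    using that by (induct i) (auto intro: mul)
  show ?thesis
    unfolding ratfun_root_def[of m]
  proof (rule field.generate_field_min_subfield1[OF field_field_ring _ sub])
    show "range ratfun_const \<union> {s::'k poly fract alg_closure. s ^ CHAR('k) ^ m = ratfun_t} \<subseteq> ratfun_root (Suc m)"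
    proof safe
      fix c show "ratfun_const c \<in> ratfun_root (Suc m)"
        unfolding ratfun_root_def by (rule generate_field.incl) simp
    next
      fix s :: "'k poly fract alg_closure" assume s: "s ^ CHAR('k) ^ m = ratfun_t"
      obtain r where r: "r ^ CHAR('k) = s" using p nth_root_exists[of "CHAR('k)" s] by blast
      have "r ^ (CHAR('k) ^ Suc m) = ratfun_t" using r s by (simp add: power_mult)
      then have "r \<in> ratfun_root (Suc m)"
        unfolding ratfun_root_def by (intro generate_field.incl) simp
      then show "s \<in> ratfun_root (Suc m)" using r pw p by (metis Suc_pred)
    qed
  qed (simp add: ring_of_type_algebra_def)
qed

lemma ratfun_per_algebra:
  assumes p: "CHAR('k::field) > 0"
  shows "algebra (field_ring :: 'k ring) ratfun_per"
proof -
  let ?F = "field_ring :: 'k poly fract alg_closure ring"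
  have sub: "subfield (ratfun_root m) ?F" for m :: nat
    unfolding ratfun_root_def
    by (rule field.generate_field_is_subfield[OF field_field_ring]) (simp add: ring_of_type_algebra_def)
  have mono: "i \<le> j \<Longrightarrow> ratfun_root i \<subseteq> (ratfun_root j :: 'k poly fract alg_closure set)" for i j
    using ratfun_root_mono[OF p] by (rule lift_Suc_mono_le)
  define P where "P = (\<Union>m. ratfun_root m :: 'k poly fract alg_closure set)"
  have two: "\<exists>i. a \<in> ratfun_root i \<and> b \<in> ratfun_root i" if "a \<in> P" "b \<in> P" for a b
    using that mono unfolding P_def by (metis UN_E nat_le_linear subsetD)
  have [simp]: "a * b \<in> P" "a + b \<in> P" if ab: "a \<in> P" "b \<in> P" for a b
    using two[OF ab] subringE(6,7)[OF subfieldE(1)[OF sub]] unfolding P_def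
    by (fastforce simp: ring_of_type_algebra_def)+
  have [simp]: "1 \<in> P" "0 \<in> P"
    using subringE(2,3)[OF subfieldE(1)[OF sub]] unfolding P_def
    by (fastforce simp: ring_of_type_algebra_def)+
  have [simp]: "ratfun_const c \<in> P" for c
    unfolding P_def ratfun_root_def by (auto intro: generate_field.incl)
  have m1: "- 1 \<in> P"
  proof -
    interpret F: field ?F by (rule field_field_ring)
    have "\<ominus>\<^bsub>?F\<^esub> \<one>\<^bsub>?F\<^esub> = (-1)"
      by (rule F.minus_equality) (auto simp: ring_of_type_algebra_def)
    then show ?thesis using subringE(3,5)[OF subfieldE(1)[OF sub]] unfolding P_def by (metis UN_iff UNIV_I)
  qed
  have neg: "- a \<in> P" if "a \<in> P" for a using \<open>\<And>a b. a \<in> P \<Longrightarrow> b \<in> P \<Longrightarrow> a * b \<in> P\<close>[OF m1 that] by simp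
  have cr: "cring (ratfun_per :: ('k,_) module)"
  proof (rule cringI)
    show "abelian_group (ratfun_per :: ('k,_) module)"
    proof (rule abelian_groupI)
      fix x assume "x \<in> carrier (ratfun_per :: ('k,_) module)"
      then show "\<exists>y\<in>carrier (ratfun_per :: ('k,_) module). y \<oplus>\<^bsub>ratfun_per\<^esub> x = \<zero>\<^bsub>(ratfun_per :: ('k,_) module)\<^esub>"
        by (intro bexI[of _ "- x"]) (auto simp: ratfun_per_def neg P_def[symmetric])
    qed (auto simp: ratfun_per_def P_def[symmetric])
    show "comm_monoid (ratfun_per :: ('k,_) module)"
      by (rule comm_monoidI) (auto simp: ratfun_per_def P_def[symmetric])
  qed (auto simp: ratfun_per_def P_def[symmetric] algebra_simps)
  show ?thesis
  proof (rule algebraI[OF cring_from_type_algebra cr])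
  qed (auto simp: ratfun_per_def P_def[symmetric] ring_of_type_algebra_def ratfun_const_hom algebra_simps)
qed

lemma frag_extend_fun_add: "frag_extend (\<lambda>u. f u + g u) x = frag_extend f x + frag_extend g x"
  by (simp add: frag_extend_def frag_cmul_distrib2 sum.distrib)
lemma frag_extend_fun_minus: "frag_extend (\<lambda>u. - f u) x = - frag_extend f x"
  by (simp only: frag_extend_def frag_cmul_minus_one[symmetric] frag_cmul_sum frag_cmul_cmul mult.commute)
lemma frag_extend_fun_diff: "frag_extend (\<lambda>u. f u - g u) x = frag_extend f x - frag_extend g x"
  using frag_extend_fun_add[of f "\<lambda>u. - g u" x] frag_extend_fun_minus[of g x] by simp
lemma frag_extend_fun_0: "frag_extend (\<lambda>u. 0) x = 0"
  by (simp add: frag_extend_def)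

lemma tensor_algebra_cring:
  assumes "algebra K B" "algebra K A"
  defines "S \<equiv> carrier B \<times> carrier A"
  defines "T \<equiv> tensor_free B A"
  shows "cring T" "ideal (tensor_null K B A) T" "cring (tensor_algebra K B A)"
proof -
  interpret cA: cring A by (rule algebra.axioms) fact
  interpret cB: cring B by (rule algebra.axioms) fact
  interpret A: algebra K A by fact
  interpret B: algebra K B by fact
  define m where "m u v = (fst u \<otimes>\<^bsub>B\<^esub> fst v, snd u \<otimes>\<^bsub>A\<^esub> snd v)" for u v
  define M where "M x y = x \<otimes>\<^bsub>T\<^esub> y" for x y
  have Mdef: "M x y = frag_extend (\<lambda>u. frag_extend (\<lambda>v. frag_of (m u v)) y) x" for x y
    unfolding M_def T_def tensor_free_def m_def by (simp add: case_prod_unfold)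
  have car: "x \<in> carrier T \<longleftrightarrow> Poly_Mapping.keys x \<subseteq> S" for x
    by (simp add: T_def tensor_free_def S_def)
  have T0: "\<zero>\<^bsub>T\<^esub> = 0" and T1: "\<one>\<^bsub>T\<^esub> = frag_of (\<one>\<^bsub>B\<^esub>,\<one>\<^bsub>A\<^esub>)" and Ta: "x \<oplus>\<^bsub>T\<^esub> y = x + y" for x y
    by (auto simp: T_def tensor_free_def)
  have msl: "M (x + x') y = M x y + M x' y" "M (x - x') y = M x y - M x' y" "M 0 y = 0" for x x' y
    unfolding Mdef by (simp_all add: frag_extend_add frag_extend_diff)
  have msr: "M x (y + y') = M x y + M x y'" "M x (y - y') = M x y - M x y'" "M x 0 = 0" for x y y'
    unfolding Mdef by (simp_all add: frag_extend_add frag_extend_diff frag_extend_fun_add frag_extend_fun_diff frag_extend_fun_0)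
  have Mof: "M (frag_of u) (frag_of v) = frag_of (m u v)" for u v unfolding Mdef by simp
  have mS: "m u v \<in> S" if "u \<in> S" "v \<in> S" for u v using that by (auto simp: m_def S_def)
  have mc: "m u v = m v u" if "u \<in> S" "v \<in> S" for u v using that by (auto simp: m_def S_def cA.m_comm cB.m_comm)
  have ma: "m (m u v) w = m u (m v w)" if "u \<in> S" "v \<in> S" "w \<in> S" for u v w
    using that by (auto simp: m_def S_def cA.m_assoc cB.m_assoc)
  have Mcl: "Poly_Mapping.keys (M x y) \<subseteq> S" if "Poly_Mapping.keys x \<subseteq> S" and y: "Poly_Mapping.keys y \<subseteq> S" for x y
    using that(1)
  proof (induction x rule: frag_induction)
    case (one u) show ?case using y
    proof (induction y rule: frag_induction)
      case (diff a b) then show ?case using keys_diff[of "M (frag_of u) a" "M (frag_of u) b"] by (simp only: msr) blast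
    qed (use one mS in \<open>auto simp: msr Mof\<close>)
  next
    case (diff a b) then show ?case using keys_diff[of "M a y" "M b y"] by (simp only: msl) blast
  qed (auto simp: msl)
  have Mc: "M x y = M y x" if "Poly_Mapping.keys x \<subseteq> S" and y: "Poly_Mapping.keys y \<subseteq> S" for x y
    using that(1)
  proof (induction x rule: frag_induction)
    case (one u) show ?case using y
      by (induction y rule: frag_induction) (use one mc in \<open>auto simp: msr msl Mof\<close>)
  qed (auto simp: msl msr)
  have Massoc: "M (M x y) z = M x (M y z)" if "Poly_Mapping.keys x \<subseteq> S" and y: "Poly_Mapping.keys y \<subseteq> S" and z: "Poly_Mapping.keys z \<subseteq> S" for x y z
    using that(1)
  proof (induction x rule: frag_induction)
    case (one u) show ?case using y
    proof (induction y rule: frag_induction)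
      case (one v) show ?case using z
        by (induction z rule: frag_induction) (use \<open>u \<in> S\<close> one ma in \<open>auto simp: msr msl Mof\<close>)
    qed (auto simp: msl msr)
  qed (auto simp: msl msr)
  have M1: "M (frag_of (\<one>\<^bsub>B\<^esub>,\<one>\<^bsub>A\<^esub>)) x = x" if "Poly_Mapping.keys x \<subseteq> S" for x
    using that
    by (induction x rule: frag_induction) (auto simp: msr Mof m_def S_def)
  show cT: "cring T"
  proof (rule cringI)
    show "abelian_group T"
    proof (rule abelian_groupI)
      fix x assume "x \<in> carrier T"
      then show "\<exists>y\<in>carrier T. y \<oplus>\<^bsub>T\<^esub> x = \<zero>\<^bsub>T\<^esub>"
        by (intro bexI[of _ "-x"]) (auto simp: car T0 Ta)
    next
      fix x y assume "x \<in> carrier T" "y \<in> carrier T"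
      then show "x \<oplus>\<^bsub>T\<^esub> y \<in> carrier T" unfolding car Ta using keys_add[of x y] by blast
    qed (auto simp: car T0 Ta ac_simps)
    show "comm_monoid T"
    proof (rule comm_monoidI)
      show "\<one>\<^bsub>T\<^esub> \<in> carrier T" by (simp add: car T1 S_def)
    qed (simp_all only: car M_def[symmetric] T1 Massoc M1 Mcl, metis Mc)
  qed (auto simp: M_def[symmetric] Ta msl)
  have nd: "tensor_null K B A = generate (free_Abelian_group S) (tensor_relations K B A)"
    by (simp add: tensor_null_def S_def)
  let ?G = "free_Abelian_group S" and ?R = "tensor_relations K B A"
  have Rc: "?R \<subseteq> carrier ?G"
    unfolding tensor_relations_def using keys_diff
    by (auto simp: S_def dest!: subsetD[OF keys_diff])
  have Rm: "M r (frag_of v) \<in> ?R" if r: "r \<in> ?R" and v: "v \<in> S" for r v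
  proof -
    obtain b1 a1 where v': "v = (b1,a1)" "b1 \<in> carrier B" "a1 \<in> carrier A" using v by (auto simp: S_def)
    from r consider
      (1) b b' a where "r = frag_of (b \<oplus>\<^bsub>B\<^esub> b', a) - frag_of (b, a) - frag_of (b', a)" "b \<in> carrier B" "b' \<in> carrier B" "a \<in> carrier A"
    | (2) b a a' where "r = frag_of (b, a \<oplus>\<^bsub>A\<^esub> a') - frag_of (b, a) - frag_of (b, a')" "b \<in> carrier B" "a \<in> carrier A" "a' \<in> carrier A"
    | (3) c b a where "r = frag_of (c \<odot>\<^bsub>B\<^esub> b, a) - frag_of (b, c \<odot>\<^bsub>A\<^esub> a)" "c \<in> carrier K" "b \<in> carrier B" "a \<in> carrier A"
      unfolding tensor_relations_def by auto
    then show ?thesis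
    proof cases
      case 1
      have "M r (frag_of v) = frag_of (b \<otimes>\<^bsub>B\<^esub> b1 \<oplus>\<^bsub>B\<^esub> b' \<otimes>\<^bsub>B\<^esub> b1, a \<otimes>\<^bsub>A\<^esub> a1) - frag_of (b \<otimes>\<^bsub>B\<^esub> b1, a \<otimes>\<^bsub>A\<^esub> a1) - frag_of (b' \<otimes>\<^bsub>B\<^esub> b1, a \<otimes>\<^bsub>A\<^esub> a1)"
        using 1 v' by (simp add: msl Mof m_def cB.l_distr)
      then show ?thesis using 1 v' unfolding tensor_relations_def by blast
    next
      case 2
      have "M r (frag_of v) = frag_of (b \<otimes>\<^bsub>B\<^esub> b1, a \<otimes>\<^bsub>A\<^esub> a1 \<oplus>\<^bsub>A\<^esub> a' \<otimes>\<^bsub>A\<^esub> a1) - frag_of (b \<otimes>\<^bsub>B\<^esub> b1, a \<otimes>\<^bsub>A\<^esub> a1) - frag_of (b \<otimes>\<^bsub>B\<^esub> b1, a' \<otimes>\<^bsub>A\<^esub> a1)"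
        using 2 v' by (simp add: msl Mof m_def cA.l_distr)
      then show ?thesis using 2 v' unfolding tensor_relations_def by blast
    next
      case 3
      have "M r (frag_of v) = frag_of (c \<odot>\<^bsub>B\<^esub> (b \<otimes>\<^bsub>B\<^esub> b1), a \<otimes>\<^bsub>A\<^esub> a1) - frag_of (b \<otimes>\<^bsub>B\<^esub> b1, c \<odot>\<^bsub>A\<^esub> (a \<otimes>\<^bsub>A\<^esub> a1))"
        using 3 v' by (simp add: msl Mof m_def A.smult_assoc2 B.smult_assoc2)
      then show ?thesis using 3 v' unfolding tensor_relations_def by blast
    qed
  qed
  let ?I = "tensor_null K B A"
  interpret G: group ?G by simp
  have Isub: "subgroup ?I ?G" unfolding nd by (rule G.generate_is_subgroup[OF Rc])
  have Iadd: "x + y \<in> ?I" if "x \<in> ?I" "y \<in> ?I" for x y using subgroup.m_closed[OF Isub that] by simp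
  have Ik: "Poly_Mapping.keys x \<subseteq> S" if "x \<in> ?I" for x using subgroup.mem_carrier[OF Isub that] by simp
  have Ineg: "- x \<in> ?I" if "x \<in> ?I" for x using subgroup.m_inv_closed[OF Isub that] Ik[OF that] by simp
  have I0: "0 \<in> ?I" using subgroup.one_closed[OF Isub] by simp
  have Im1: "M x (frag_of v) \<in> ?I" if x: "x \<in> ?I" and v: "v \<in> S" for x v
    using x unfolding nd
  proof (induction x rule: generate.induct)
    case one show ?case using I0 by (simp add: msl nd[symmetric])
  next
    case (incl r) then show ?case by (rule generate.incl[OF Rm[OF _ v]])
  next
    case (inv r)
    have "M (- r) (frag_of v) = - M r (frag_of v)" using msl(2)[of 0 r] by (simp add: msl)
    moreover have "M r (frag_of v) \<in> ?I" unfolding nd by (rule generate.incl[OF Rm[OF inv v]])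
    moreover have "Poly_Mapping.keys r \<subseteq> S" using subsetD[OF Rc inv] by simp
    ultimately show ?case using Ineg by (simp add: nd)
  next
    case (eng a b) then show ?case using Iadd by (simp add: msl nd)
  qed
  have Im: "M x y \<in> ?I" if x: "x \<in> ?I" and y: "Poly_Mapping.keys y \<subseteq> S" for x y
    using y
  proof (induction y rule: frag_induction)
    case (diff a b) then show ?case using Iadd Ineg by (metis msr(2) diff_conv_add_uminus)
  qed (use I0 Im1[OF x] in \<open>auto simp: msr\<close>)
  interpret T: cring T by fact
  show ideal: "ideal ?I T"
  proof (rule idealI)
    show "ring T" by (rule T.ring_axioms)
    show "subgroup ?I (add_monoid T)"
    proof (rule group.subgroupI)
      show "group (add_monoid T)" by (rule T.a_group)
      fix x assume x: "x \<in> ?I"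
      have "inv\<^bsub>add_monoid T\<^esub> x = \<ominus>\<^bsub>T\<^esub> x" by (simp add: a_inv_def)
      also have "\<dots> = - x" by (rule T.minus_equality) (use Ik[OF x] in \<open>auto simp: Ta T0 car\<close>)
      finally show "inv\<^bsub>add_monoid T\<^esub> x \<in> ?I" using Ineg x by simp
    qed (use I0 Ik Iadd in \<open>auto simp: Ta car\<close>)
    fix a x assume "a \<in> ?I" "x \<in> carrier T"
    then show "a \<otimes>\<^bsub>T\<^esub> x \<in> ?I" "x \<otimes>\<^bsub>T\<^esub> a \<in> ?I"
      using Im Mc[of x a] Ik by (auto simp: car M_def)
  qed
  show "cring (tensor_algebra K B A)"
    unfolding tensor_algebra_def T_def[symmetric]
    by (rule ideal.quotient_is_cring[OF ideal cT])
qed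

end

theory Submission
  imports Defs "HOL-Library.Multiset_Order"
begin

text \<open>
  Let \<open>A\<close> be the power series ring over \<open>k'\<close> and \<open>t\<^sub>m\<close> the root of order \<open>p\<^sup>m\<close> of \<open>t\<close>. The
  ring studied is the tower \<open>T\<close> over \<open>A\<close>: the fractions \<open>g(t\<^sub>m) / s(t\<^sub>m)\<close> with \<open>g\<close> over \<open>A\<close>
  and \<open>s \<noteq> 0\<close> over \<open>k'\<close>. As \<open>k'\<close> is algebraic over \<open>k\<close>, every \<open>s \<noteq> 0\<close> over \<open>k'\<close> divides a
  nonzero polynomial over \<open>k\<close> (\<open>divides_base_poly\<close>), so \<open>s(t\<^sub>m)\<close> is a unit of the tensor
  product, and clearing denominators in pure tensors writes every element of the tensor
  product as \<open>g(t\<^sub>m)\<close> up to such a unit. Finite generation of ideals therefore passes from \<open>T\<close>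
  to the tensor product (\<open>noetherian\<close>), and it remains to see that \<open>T\<close> is noetherian
  (\<open>noeth_series\<close>). This is done by induction on the number of variables; the union of
  infinitely many levels \<open>A[t\<^sub>m]\<close> is what makes it more than the basis theorem.

  An ideal of \<open>T\<close> that contains some \<open>a \<noteq> 0\<close> from \<open>A\<close> is finitely generated: after a change of
  coordinates \<open>a\<close> is regular in one variable, and by Weierstrass division \<open>T\<close> is, modulo \<open>a\<close>,
  a finite module over the tower with one variable less.

  Any other nonzero ideal contains some \<open>f(t\<^sub>m)\<close> with \<open>f \<noteq> 0\<close> over \<open>A\<close>. Let \<open>F\<close> be the field
  of fractions of \<open>A\<close>. The property of \<open>z\<close> that all ideals containing \<open>z\<close>, up to a denominator
  from \<open>A\<close>, are finitely generated is multiplicative (\<open>good_mult\<close>), so \<open>f\<close> may be replaced by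
  a monic irreducible factor over \<open>F\<close>. If \<open>f\<close> has constant coefficients, \<open>f(t\<^sub>m)\<close> is a unit.
  Otherwise some coefficient has no root of order \<open>p\<^sup>e\<close> in \<open>F\<close> for large \<open>e\<close>, because the only
  elements of \<open>F\<close> with roots of all these orders are the constants
  (\<open>infinitely_divisible_constant\<close>). Hence for some \<open>e\<close> the value \<open>f(t\<^sub>m)\<close> is a power of
  \<open>g(t\<^sub>m\<^sub>+\<^sub>e)\<close>, where \<open>g\<close> is irreducible and one of its coefficients is not a \<open>p\<close>-th power
  (\<open>frobenius_root\<close>), and such a \<open>g\<close> remains irreducible at all higher levels
  (\<open>irred_over_psub_power\<close>). Then an ideal \<open>I\<close> with \<open>a g(t\<^sub>m\<^sub>+\<^sub>e) \<in> I\<close> that does not meet \<open>A\<close>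
  outside zero consists of multiples of \<open>g(t\<^sub>m\<^sub>+\<^sub>e)\<close> over \<open>F\<close>. By the basis theorem at the
  single level \<open>m + e\<close> it is squeezed between a finitely generated module \<open>J\<close> and \<open>b J\<close> for
  some \<open>b \<noteq> 0\<close> in \<open>A\<close> (\<open>good_persistent\<close>), and the ideals containing \<open>b\<close> are already known to
  be finitely generated.
\<close>

section \<open>Noetherian subrings of a commutative ring\<close>

text \<open>
  All rings that occur are domains inside one field, or polynomial rings over them. They are
  treated as subsets of an ambient ring, so that a power series ring, its field of fractions
  and all levels of the tower are compared by inclusion.
\<close>

definition sub_ring :: "'a::comm_ring_1 set \<Rightarrow> bool"
  where "sub_ring R \<longleftrightarrow> 0 \<in> R \<and> 1 \<in> R \<and> (\<forall>x\<in>R. \<forall>y\<in>R. x + y \<in> R \<and> x * y \<in> R) \<and> (\<forall>x\<in>R. - x \<in> R)"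

definition sub_mod :: "'a::comm_ring_1 set \<Rightarrow> 'a set \<Rightarrow> bool"
  where "sub_mod R N \<longleftrightarrow> 0 \<in> N \<and> (\<forall>x\<in>N. \<forall>y\<in>N. x + y \<in> N) \<and> (\<forall>r\<in>R. \<forall>x\<in>N. r * x \<in> N)"

definition lin_span :: "'a::comm_ring_1 set \<Rightarrow> 'a set \<Rightarrow> 'a set"
  where "lin_span R G = \<Inter>{N. sub_mod R N \<and> G \<subseteq> N}"

definition fin_gen :: "'a::comm_ring_1 set \<Rightarrow> 'a set \<Rightarrow> bool"
  where "fin_gen R N \<longleftrightarrow> (\<exists>G\<subseteq>N. finite G \<and> N \<subseteq> lin_span R G)"

definition noeth :: "'a::comm_ring_1 set \<Rightarrow> bool"
  where "noeth R \<longleftrightarrow> (\<forall>I\<subseteq>R. sub_mod R I \<longrightarrow> fin_gen R I)"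

lemma sub_ringD:
  assumes "sub_ring R"
  shows "0 \<in> R" "1 \<in> R" "x \<in> R \<Longrightarrow> y \<in> R \<Longrightarrow> x + y \<in> R" "x \<in> R \<Longrightarrow> y \<in> R \<Longrightarrow> x * y \<in> R"
    "x \<in> R \<Longrightarrow> - x \<in> R" "x \<in> R \<Longrightarrow> y \<in> R \<Longrightarrow> x - y \<in> R"
  using assms by (auto simp: sub_ring_def) (metis add_uminus_conv_diff)

lemma sub_ring_power: "sub_ring R \<Longrightarrow> x \<in> R \<Longrightarrow> x ^ n \<in> R"
  by (induction n) (auto dest: sub_ringD)

lemma sub_ring_sum: "sub_ring R \<Longrightarrow> (\<And>i. i \<in> S \<Longrightarrow> f i \<in> R) \<Longrightarrow> sum f S \<in> R"
  by (induction S rule: infinite_finite_induct) (auto dest: sub_ringD)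

lemma sub_modD:
  assumes "sub_mod R N"
  shows "0 \<in> N" "x \<in> N \<Longrightarrow> y \<in> N \<Longrightarrow> x + y \<in> N" "r \<in> R \<Longrightarrow> x \<in> N \<Longrightarrow> r * x \<in> N"
  using assms by (auto simp: sub_mod_def)

lemma sub_mod_diff:
  assumes "sub_ring R" "sub_mod R N" "x \<in> N" "y \<in> N"
  shows "x - y \<in> N"
proof -
  have "- 1 * y \<in> N" using assms sub_ringD(2,5) sub_modD(3) by blast
  then have "x + - 1 * y \<in> N" using assms sub_modD(2) by blast
  then show ?thesis by simp
qed

lemma sub_mod_sum: "sub_mod R N \<Longrightarrow> (\<And>i. i \<in> S \<Longrightarrow> f i \<in> N) \<Longrightarrow> sum f S \<in> N"
  by (induction S rule: infinite_finite_induct) (auto dest: sub_modD)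

lemma sub_mod_Int: "sub_mod R M \<Longrightarrow> sub_mod R N \<Longrightarrow> sub_mod R (M \<inter> N)"
  by (auto simp: sub_mod_def)

lemma sub_mod_mono: "sub_mod R N \<Longrightarrow> R' \<subseteq> R \<Longrightarrow> sub_mod R' N"
  by (auto simp: sub_mod_def)

lemma sub_mod_lin_span: "sub_mod R (lin_span R G)"
  unfolding lin_span_def sub_mod_def by blast

lemma lin_span_incl: "x \<in> G \<Longrightarrow> x \<in> lin_span R G"
  unfolding lin_span_def by blast

lemma lin_span_least: "sub_mod R N \<Longrightarrow> G \<subseteq> N \<Longrightarrow> lin_span R G \<subseteq> N"
  unfolding lin_span_def by blast

lemma lin_span_mono: "G \<subseteq> H \<Longrightarrow> lin_span R G \<subseteq> lin_span R H"
  unfolding lin_span_def by blast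

lemma lin_span_mono_ring: "R \<subseteq> R' \<Longrightarrow> lin_span R G \<subseteq> lin_span R' G"
  by (rule lin_span_least) (auto intro: sub_mod_mono[OF sub_mod_lin_span] lin_span_incl)

lemma fin_genI: "finite G \<Longrightarrow> G \<subseteq> N \<Longrightarrow> N \<subseteq> lin_span R G \<Longrightarrow> fin_gen R N"
  unfolding fin_gen_def by blast

lemma fin_genE:
  assumes "fin_gen R N"
  obtains G where "finite G" "G \<subseteq> N" "N \<subseteq> lin_span R G"
  using assms unfolding fin_gen_def by blast

lemma noethD: "noeth R \<Longrightarrow> sub_mod R I \<Longrightarrow> I \<subseteq> R \<Longrightarrow> fin_gen R I"
  unfolding noeth_def by blast

lemma lin_span_insertE:
  assumes R: "sub_ring R" and x: "x \<in> lin_span R (insert j J)"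
  obtains r y where "r \<in> R" "y \<in> lin_span R J" "x = r * j + y"
proof -
  let ?M = "{r * j + y | r y. r \<in> R \<and> y \<in> lin_span R J}"
  have "sub_mod R ?M"
    unfolding sub_mod_def
  proof (intro conjI ballI)
    show "0 \<in> ?M" using sub_ringD(1)[OF R] sub_modD(1)[OF sub_mod_lin_span] by force
  next
    fix x y assume "x \<in> ?M" "y \<in> ?M"
    then obtain r1 y1 r2 y2 where e: "x = r1 * j + y1" "y = r2 * j + y2"
      "r1 \<in> R" "r2 \<in> R" "y1 \<in> lin_span R J" "y2 \<in> lin_span R J" by auto
    have "x + y = (r1 + r2) * j + (y1 + y2)" using e by (simp add: algebra_simps)
    then show "x + y \<in> ?M" using e sub_ringD(3)[OF R] sub_modD(2)[OF sub_mod_lin_span] by blast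
  next
    fix c x assume c: "c \<in> R" and "x \<in> ?M"
    then obtain r1 y1 where e: "x = r1 * j + y1" "r1 \<in> R" "y1 \<in> lin_span R J" by auto
    have "c * x = (c * r1) * j + c * y1" using e by (simp add: algebra_simps)
    then show "c * x \<in> ?M" using c e sub_ringD(4)[OF R] sub_modD(3)[OF sub_mod_lin_span] by blast
  qed
  moreover have "insert j J \<subseteq> ?M"
  proof safe
    show "\<exists>r y. j = r * j + y \<and> r \<in> R \<and> y \<in> lin_span R J"
      using sub_ringD(2)[OF R] sub_modD(1)[OF sub_mod_lin_span] by (metis add_0_right mult_1)
    fix x assume "x \<in> J"
    then show "\<exists>r y. x = r * j + y \<and> r \<in> R \<and> y \<in> lin_span R J"
      using sub_ringD(1)[OF R] lin_span_incl by (metis add_0 mult_zero_left)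
  qed
  ultimately have "lin_span R (insert j J) \<subseteq> ?M" by (rule lin_span_least)
  then show ?thesis using x that by blast
qed

lemma lin_span_empty: "lin_span R {} = {0}"
proof
  show "lin_span R {} \<subseteq> {0}" by (rule lin_span_least) (auto simp: sub_mod_def)
qed (use sub_modD(1)[OF sub_mod_lin_span] in auto)

lemma lin_span_smult:
  assumes "x \<in> lin_span R G" and "\<And>g. g \<in> G \<Longrightarrow> a * g \<in> N" and "sub_mod R N"
  shows "a * x \<in> N"
proof -
  have "lin_span R G \<subseteq> {x. a * x \<in> N}"
    by (rule lin_span_least)
      (use assms in \<open>auto simp: sub_mod_def distrib_left mult.left_commute\<close>)
  then show ?thesis using assms by blast
qed

text \<open>
  A module version of the ascending chain condition: an ideal of coefficients is split off for
  one generator at a time. Only ideals containing the fixed element \<open>a\<close> occur among the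
  coefficient ideals, because multiplication by \<open>a\<close> maps the generators into \<open>N\<close>; with \<open>a = 0\<close>
  this is the statement that finitely generated modules over a noetherian ring are noetherian.
\<close>

lemma fin_gen_submodule:
  assumes R: "sub_ring R" and a: "a \<in> R"
    and ideals: "\<And>I. sub_mod R I \<Longrightarrow> I \<subseteq> R \<Longrightarrow> a \<in> I \<Longrightarrow> fin_gen R I"
    and J: "finite J" and N: "sub_mod R N" "N \<subseteq> lin_span R J" "\<And>j. j \<in> J \<Longrightarrow> a * j \<in> N"
  shows "fin_gen R N"
  using J N
proof (induction J arbitrary: N rule: finite_induct)
  case empty
  then show ?case
    by (intro fin_genI[of "{}"]) auto
next
  case (insert j J)
  let ?J = "lin_span R J"
  \<comment> \<open>The coefficients of the new generator in elements of the submodule.\<close>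
  define I where "I = {r \<in> R. \<exists>y\<in>?J. r * j + y \<in> N}"
  note sJ = sub_mod_lin_span[of R J]
  have "sub_mod R I"
    unfolding sub_mod_def
  proof (intro conjI ballI)
    show "0 \<in> I" unfolding I_def
      using sub_ringD(1)[OF R] sub_modD(1)[OF sJ] sub_modD(1)[OF insert.prems(1)] by force
  next
    fix r1 r2 assume "r1 \<in> I" "r2 \<in> I"
    then obtain y1 y2 where e: "r1 \<in> R" "r2 \<in> R" "y1 \<in> ?J" "y2 \<in> ?J" "r1 * j + y1 \<in> N" "r2 * j + y2 \<in> N"
      unfolding I_def by blast
    have "(r1 + r2) * j + (y1 + y2) \<in> N"
      using sub_modD(2)[OF insert.prems(1) e(5,6)] by (simp add: algebra_simps)
    then show "r1 + r2 \<in> I" unfolding I_def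
      using e sub_ringD(3)[OF R] sub_modD(2)[OF sJ] by blast
  next
    fix c r assume c: "c \<in> R" and "r \<in> I"
    then obtain y where e: "r \<in> R" "y \<in> ?J" "r * j + y \<in> N" unfolding I_def by blast
    have "(c * r) * j + c * y \<in> N"
      using sub_modD(3)[OF insert.prems(1) c e(3)] by (simp add: algebra_simps)
    then show "c * r \<in> I" unfolding I_def
      using c e sub_ringD(4)[OF R] sub_modD(3)[OF sJ] by blast
  qed
  moreover have "I \<subseteq> R" unfolding I_def by blast
  moreover have "a \<in> I" unfolding I_def
    using a sub_modD(1)[OF sJ] insert.prems(3)[of j] by force
  ultimately obtain C where C: "finite C" "C \<subseteq> I" "I \<subseteq> lin_span R C"
    using ideals fin_genE by metis
  have "\<forall>c\<in>C. \<exists>z\<in>N. z - c * j \<in> ?J"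
    using C(2) unfolding I_def by force
  then obtain z where z: "\<And>c. c \<in> C \<Longrightarrow> z c \<in> N \<and> z c - c * j \<in> ?J" by metis
  \<comment> \<open>The elements of the submodule that do without the new generator.\<close>
  have "fin_gen R (N \<inter> ?J)"
  proof (rule insert.IH)
    show "sub_mod R (N \<inter> ?J)" using insert.prems(1) sJ by (rule sub_mod_Int)
    fix i assume "i \<in> J"
    then show "a * i \<in> N \<inter> ?J"
      using insert.prems(3) sub_modD(3)[OF sJ a] lin_span_incl by blast
  qed blast
  then obtain G where G: "finite G" "G \<subseteq> N \<inter> ?J" "N \<inter> ?J \<subseteq> lin_span R G" by (rule fin_genE)
  let ?H = "G \<union> z ` C"
  note sH = sub_mod_lin_span[of R ?H]
  have lift: "\<exists>w\<in>lin_span R ?H \<inter> N. w - r * j \<in> ?J" if "r \<in> I" for r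
  proof -
    have "lin_span R C \<subseteq> {r. \<exists>w\<in>lin_span R ?H \<inter> N. w - r * j \<in> ?J}"
    proof (rule lin_span_least)
      have *: "sub_mod R (lin_span R ?H \<inter> N)" using sH insert.prems(1) by (rule sub_mod_Int)
      show "sub_mod R {r. \<exists>w\<in>lin_span R ?H \<inter> N. w - r * j \<in> ?J}"
        unfolding sub_mod_def
      proof (intro conjI ballI)
        show "0 \<in> {r. \<exists>w\<in>lin_span R ?H \<inter> N. w - r * j \<in> ?J}"
          using sub_modD(1)[OF *] sub_modD(1)[OF sJ] by force
      next
        fix r1 r2
        assume "r1 \<in> {r. \<exists>w\<in>lin_span R ?H \<inter> N. w - r * j \<in> ?J}" "r2 \<in> {r. \<exists>w\<in>lin_span R ?H \<inter> N. w - r * j \<in> ?J}"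
        then obtain w1 w2 where w: "w1 \<in> lin_span R ?H \<inter> N" "w2 \<in> lin_span R ?H \<inter> N"
          "w1 - r1 * j \<in> ?J" "w2 - r2 * j \<in> ?J" by blast
        have "(w1 + w2) - (r1 + r2) * j \<in> ?J"
          using sub_modD(2)[OF sJ w(3,4)] by (simp add: algebra_simps)
        then show "r1 + r2 \<in> {r. \<exists>w\<in>lin_span R ?H \<inter> N. w - r * j \<in> ?J}"
          using sub_modD(2)[OF * w(1,2)] by blast
      next
        fix c r1 assume c: "c \<in> R" and "r1 \<in> {r. \<exists>w\<in>lin_span R ?H \<inter> N. w - r * j \<in> ?J}"
        then obtain w1 where w: "w1 \<in> lin_span R ?H \<inter> N" "w1 - r1 * j \<in> ?J" by blast
        have "c * w1 - (c * r1) * j \<in> ?J"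
          using sub_modD(3)[OF sJ c w(2)] by (simp add: algebra_simps)
        then show "c * r1 \<in> {r. \<exists>w\<in>lin_span R ?H \<inter> N. w - r * j \<in> ?J}"
          using sub_modD(3)[OF * c w(1)] by blast
      qed
      show "C \<subseteq> {r. \<exists>w\<in>lin_span R ?H \<inter> N. w - r * j \<in> ?J}"
        using z lin_span_incl[of _ ?H R] by blast
    qed
    then show ?thesis using that C(3) by blast
  qed
  show ?case
  proof (rule fin_genI)
    show "finite ?H" using C G by simp
    show "?H \<subseteq> N" using G z by blast
    show "N \<subseteq> lin_span R ?H"
    proof
      fix x assume x: "x \<in> N"
      obtain r y where r: "r \<in> R" "y \<in> ?J" "x = r * j + y"
        using lin_span_insertE[OF R] x insert.prems(2) by blast
      then have "r \<in> I" using x unfolding I_def by blast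
      then obtain w where w: "w \<in> lin_span R ?H" "w \<in> N" "w - r * j \<in> ?J" using lift by blast
      \<comment> \<open>Subtracting a combination of the chosen lifts with the same coefficient leaves an
        element of the smaller span.\<close>
      have "x - w = y - (w - r * j)" using r by simp
      then have "x - w \<in> ?J" using sub_mod_diff[OF R sJ r(2) w(3)] by metis
      moreover have "x - w \<in> N" by (rule sub_mod_diff[OF R insert.prems(1) x w(2)])
      ultimately have "x - w \<in> lin_span R ?H" using G(3) lin_span_mono[of G ?H R] by blast
      then show "x \<in> lin_span R ?H" using sub_modD(2)[OF sH _ w(1)] by force
    qed
  qed
qed

text \<open>
  If \<open>x\<close> runs through the parts in \<open>I\<close> of generators of \<open>I + g R\<close>, then an element of \<open>I\<close> is a
  combination of the \<open>x\<close> plus some \<open>g r\<close>, and \<open>r\<close> lies in \<open>(I : g)\<close>. This takes the place of a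
  reduction to prime ideals: applied to a factor \<open>g\<close> of an element of \<open>I\<close>, it passes to ideals
  that contain one of the factors.
\<close>

lemma fin_gen_via_colon:
  assumes R: "sub_ring R" and I: "sub_mod R I" "I \<subseteq> R" and g: "g \<in> R"
    and add: "fin_gen R {x + g * r | x r. x \<in> I \<and> r \<in> R}"
    and colon: "fin_gen R {r \<in> R. g * r \<in> I}"
  shows "fin_gen R I"
proof -
  obtain G where G: "finite G" "G \<subseteq> {x + g * r | x r. x \<in> I \<and> r \<in> R}"
    "{x + g * r | x r. x \<in> I \<and> r \<in> R} \<subseteq> lin_span R G" using add by (rule fin_genE)
  obtain D where D: "finite D" "D \<subseteq> {r \<in> R. g * r \<in> I}" "{r \<in> R. g * r \<in> I} \<subseteq> lin_span R D"
    using colon by (rule fin_genE)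
  have "\<forall>y\<in>G. \<exists>x\<in>I. \<exists>r\<in>R. y = x + g * r" using G(2) by blast
  then obtain \<xi> where \<xi>: "\<And>y. y \<in> G \<Longrightarrow> \<xi> y \<in> I \<and> (\<exists>r\<in>R. y = \<xi> y + g * r)" by metis
  let ?X = "\<xi> ` G" and ?Y = "(\<lambda>d. g * d) ` D"
  note sX = sub_mod_lin_span[of R ?X]
  have Xi: "lin_span R ?X \<subseteq> I" by (rule lin_span_least[OF I(1)]) (use \<xi> in auto)
  have split: "\<exists>x\<in>lin_span R ?X. \<exists>r\<in>R. y = x + g * r" if "y \<in> lin_span R G" for y
  proof -
    have "G \<subseteq> lin_span R (insert g ?X)"
    proof
      fix y assume y: "y \<in> G"
      then obtain r where "r \<in> R" "y = \<xi> y + g * r" using \<xi> by blast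
      then have *: "r \<in> R" "y = r * g + \<xi> y" by (auto simp: algebra_simps)
      have "g \<in> lin_span R (insert g ?X)" "\<xi> y \<in> lin_span R (insert g ?X)"
        using y by (auto intro!: lin_span_incl)
      then have "r * g + \<xi> y \<in> lin_span R (insert g ?X)"
        using *(1) sub_modD(2,3)[OF sub_mod_lin_span] by metis
      then show "y \<in> lin_span R (insert g ?X)" using *(2) by simp
    qed
    then have "lin_span R G \<subseteq> lin_span R (insert g ?X)"
      by (rule lin_span_least[OF sub_mod_lin_span])
    then show ?thesis using that lin_span_insertE[OF R, of y g ?X]
      by (metis add.commute mult.commute subsetD)
  qed
  show ?thesis
  proof (rule fin_genI)
    show "finite (?X \<union> ?Y)" using G D by simp
    show "?X \<union> ?Y \<subseteq> I" using \<xi> D(2) by auto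
    note sXY = sub_mod_lin_span[of R "?X \<union> ?Y"]
    show "I \<subseteq> lin_span R (?X \<union> ?Y)"
    proof
      fix y assume y: "y \<in> I"
      have "y = y + g * 0" by simp
      then have "y \<in> lin_span R G" using G(3) y sub_ringD(1)[OF R] by blast
      then obtain x r where x: "x \<in> lin_span R ?X" "r \<in> R" "y = x + g * r" using split by blast
      have "y - x \<in> I" using sub_mod_diff[OF R I(1) y] x(1) Xi by blast
      then have "r \<in> lin_span R D" using D(3) x by (auto simp: algebra_simps)
      then have "g * r \<in> lin_span R (?X \<union> ?Y)"
        by (rule lin_span_smult[OF _ _ sXY]) (auto intro!: lin_span_incl)
      moreover have "x \<in> lin_span R (?X \<union> ?Y)" using x(1) lin_span_mono[of ?X "?X \<union> ?Y" R] by blast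
      ultimately show "y \<in> lin_span R (?X \<union> ?Y)" using x(3) sub_modD(2)[OF sXY] by blast
    qed
  qed
qed

text \<open>
  Modulo \<open>a\<close> an element of \<open>I\<close> is a combination of the module generators that lies in \<open>I\<close>, and
  the combinations with this property form a submodule of a finitely generated module over the
  noetherian ring \<open>B\<close>.
\<close>

lemma fin_gen_ideal_finite_mod:
  assumes B: "sub_ring B" "noeth B" "B \<subseteq> R" and R: "sub_ring R" and J: "finite J" "J \<subseteq> R"
    and gen: "\<And>x. x \<in> R \<Longrightarrow> \<exists>y\<in>lin_span B J. \<exists>q\<in>R. x = y + a * q"
    and I: "sub_mod R I" "I \<subseteq> R" "a \<in> I"
  shows "fin_gen R I"
proof -
  have "fin_gen B (I \<inter> lin_span B J)"
  proof (rule fin_gen_submodule[OF B(1), of 0 J])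
    show "sub_mod B (I \<inter> lin_span B J)"
      by (intro sub_mod_Int sub_mod_lin_span sub_mod_mono[OF I(1) B(3)])
    then show "\<And>j. 0 * j \<in> I \<inter> lin_span B J" using sub_modD(1) by fastforce
  qed (use B J noethD sub_ringD(1) in auto)
  then obtain G where G: "finite G" "G \<subseteq> I \<inter> lin_span B J" "I \<inter> lin_span B J \<subseteq> lin_span B G"
    by (rule fin_genE)
  show ?thesis
  proof (rule fin_genI)
    show "finite (insert a G)" "insert a G \<subseteq> I" using G I by auto
    note sG = sub_mod_lin_span[of R "insert a G"]
    show "I \<subseteq> lin_span R (insert a G)"
    proof
      fix x assume x: "x \<in> I"
      then obtain y q where y: "y \<in> lin_span B J" "q \<in> R" "x = y + a * q" using gen I(2) by blast
      then have "y = x - q * a" by simp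
      then have "y \<in> I" using sub_mod_diff[OF R I(1) x] sub_modD(3)[OF I(1) y(2) I(3)] by simp
      then have "y \<in> lin_span B G" using y G(3) by blast
      then have "y \<in> lin_span R (insert a G)"
        using lin_span_mono_ring[OF B(3), of G] lin_span_mono[of G "insert a G" R] by blast
      moreover have "q * a \<in> lin_span R (insert a G)"
        using sub_modD(3)[OF sG y(2)] lin_span_incl[of a "insert a G"] by blast
      ultimately show "x \<in> lin_span R (insert a G)"
        using y(3) sub_modD(2)[OF sG] by (simp add: mult.commute)
    qed
  qed
qed

section \<open>Polynomials with coefficients in a subset\<close>

definition polys :: "'a::comm_ring_1 set \<Rightarrow> 'a poly set"
  where "polys A = {f. \<forall>i. poly.coeff f i \<in> A}"

lemma polysD: "f \<in> polys A \<Longrightarrow> poly.coeff f i \<in> A"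
  by (simp add: polys_def)

lemma polys_mono: "A \<subseteq> B \<Longrightarrow> polys A \<subseteq> polys B"
  by (auto simp: polys_def)

lemma sub_ring_polys: "sub_ring A \<Longrightarrow> sub_ring (polys A)"
  unfolding sub_ring_def[of "polys A"]
  by (auto simp: polys_def coeff_mult coeff_1 sub_ringD intro!: sub_ring_sum)

lemma monom_in_polys: "sub_ring A \<Longrightarrow> a \<in> A \<Longrightarrow> Polynomial.monom a n \<in> polys A"
  by (auto simp: polys_def dest: sub_ringD)

lemma const_in_polys: "sub_ring A \<Longrightarrow> [:a:] \<in> polys A \<longleftrightarrow> a \<in> A"
  by (auto simp: polys_def coeff_pCons dest: sub_ringD split: nat.splits)

lemma smult_in_polys: "sub_ring A \<Longrightarrow> a \<in> A \<Longrightarrow> f \<in> polys A \<Longrightarrow> Polynomial.smult a f \<in> polys A"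
  by (auto simp: polys_def dest: sub_ringD)

subsection \<open>Hilbert's basis theorem\<close>

lemma sub_ring_const_polys: "sub_ring A \<Longrightarrow> sub_ring ((\<lambda>a. [:a:]) ` A)"
  unfolding sub_ring_def by (auto simp: image_iff one_pCons)

lemma noeth_image:
  assumes A: "sub_ring A" "noeth A"
    and \<phi>: "\<phi> 0 = 0" "\<And>x y. x \<in> A \<Longrightarrow> y \<in> A \<Longrightarrow> \<phi> (x + y) = \<phi> x + \<phi> y"
      "\<And>x y. x \<in> A \<Longrightarrow> y \<in> A \<Longrightarrow> \<phi> (x * y) = \<phi> x * \<phi> y"
  shows "noeth (\<phi> ` A)"
  unfolding noeth_def
proof (intro allI impI)
  fix I assume I: "I \<subseteq> \<phi> ` A" "sub_mod (\<phi> ` A) I"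
  define I' where "I' = {a \<in> A. \<phi> a \<in> I}"
  have "sub_mod A I'"
    unfolding sub_mod_def I'_def using sub_modD[OF I(2)] sub_ringD[OF A(1)] \<phi> by auto
  then obtain G where G: "finite G" "G \<subseteq> I'" "I' \<subseteq> lin_span A G"
    using noethD[OF A(2)] fin_genE unfolding I'_def by (metis (no_types, lifting) mem_Collect_eq subsetI)
  show "fin_gen (\<phi> ` A) I"
  proof (rule fin_genI)
    show "finite (\<phi> ` G)" "\<phi> ` G \<subseteq> I" using G unfolding I'_def by auto
    note s = sub_mod_lin_span[of "\<phi> ` A" "\<phi> ` G"]
    have "lin_span A G \<subseteq> {x \<in> A. \<phi> x \<in> lin_span (\<phi> ` A) (\<phi> ` G)}"
    proof (rule lin_span_least)
      show "sub_mod A {x \<in> A. \<phi> x \<in> lin_span (\<phi> ` A) (\<phi> ` G)}"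
        unfolding sub_mod_def using sub_modD[OF s] sub_ringD[OF A(1)] \<phi> by auto
      show "G \<subseteq> {x \<in> A. \<phi> x \<in> lin_span (\<phi> ` A) (\<phi> ` G)}"
        using G(2) unfolding I'_def by (auto intro: lin_span_incl)
    qed
    then show "I \<subseteq> lin_span (\<phi> ` A) (\<phi> ` G)"
      using I(1) G(3) unfolding I'_def by blast
  qed
qed

text \<open>
  The leading coefficients of the elements of degree at most \<open>d\<close> form an ideal that grows with
  \<open>d\<close>. Once it has stopped growing at \<open>d\<^sub>0\<close>, elements of higher degree are reduced by multiples
  of elements of degree at most \<open>d\<^sub>0\<close>, and those lie in a finitely generated module over \<open>A\<close>.
\<close>

theorem noeth_polys:
  fixes A :: "'a::comm_ring_1 set"
  assumes A: "sub_ring A" "noeth A"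
  shows "noeth (polys A)"
  unfolding noeth_def
proof (intro allI impI)
  fix I :: "'a poly set" assume I: "I \<subseteq> polys A" "sub_mod (polys A) I"
  note P = sub_ring_polys[OF A(1)]
  define L where "L d = {poly.coeff g d | g. g \<in> I \<and> Polynomial.degree g \<le> d}" for d
  have LA: "L d \<subseteq> A" for d using I(1) unfolding L_def by (auto dest: polysD)
  have Lsub: "sub_mod A (L d)" for d
    unfolding sub_mod_def
  proof (intro conjI ballI)
    show "0 \<in> L d" unfolding L_def using sub_modD(1)[OF I(2)] by force
  next
    fix x y assume "x \<in> L d" "y \<in> L d"
    then obtain g h where "g \<in> I" "h \<in> I" "Polynomial.degree g \<le> d" "Polynomial.degree h \<le> d"
      "x = poly.coeff g d" "y = poly.coeff h d" unfolding L_def by blast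
    then have "g + h \<in> I" "Polynomial.degree (g + h) \<le> d" "x + y = poly.coeff (g + h) d"
      using sub_modD(2)[OF I(2)] by (auto intro: degree_add_le)
    then show "x + y \<in> L d" unfolding L_def by blast
  next
    fix a x assume a: "a \<in> A" and "x \<in> L d"
    then obtain g where g: "g \<in> I" "Polynomial.degree g \<le> d" "x = poly.coeff g d"
      unfolding L_def by blast
    have "[:a:] * g \<in> I" using sub_modD(3)[OF I(2)] g a const_in_polys[OF A(1)] by blast
    then have "Polynomial.smult a g \<in> I" by simp
    moreover have "Polynomial.degree (Polynomial.smult a g) \<le> d" using g(2) degree_smult_le le_trans by blast
    moreover have "a * x = poly.coeff (Polynomial.smult a g) d" using g by simp
    ultimately show "a * x \<in> L d" unfolding L_def by blast
  qed
  have LSuc: "L d \<subseteq> L (Suc d)" for d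
  proof
    fix x assume "x \<in> L d"
    then obtain g where g: "g \<in> I" "Polynomial.degree g \<le> d" "x = poly.coeff g d"
      unfolding L_def by blast
    have "Polynomial.monom 1 1 * g \<in> I"
      using sub_modD(3)[OF I(2) _ g(1)] monom_in_polys[OF A(1)] sub_ringD(2)[OF A(1)] by blast
    then have "pCons 0 g \<in> I" by (simp add: monom_altdef)
    moreover have "Polynomial.degree (pCons 0 g) \<le> Suc d" using g(2) degree_pCons_le le_trans by blast
    moreover have "x = poly.coeff (pCons 0 g) (Suc d)" using g(3) by simp
    ultimately show "x \<in> L (Suc d)" unfolding L_def by blast
  qed
  have Lmono: "i \<le> j \<Longrightarrow> L i \<subseteq> L j" for i j by (rule lift_Suc_mono_le[of L]) (use LSuc in auto)
  have "sub_mod A (\<Union>d. L d)"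
    unfolding sub_mod_def
  proof (intro conjI ballI)
    show "0 \<in> (\<Union>d. L d)" using sub_modD(1)[OF Lsub] by blast
  next
    fix x y assume "x \<in> (\<Union>d. L d)" "y \<in> (\<Union>d. L d)"
    then obtain i j where "x \<in> L i" "y \<in> L j" by blast
    then have "x \<in> L (max i j)" "y \<in> L (max i j)" using Lmono[of i "max i j"] Lmono[of j "max i j"] by auto
    then show "x + y \<in> (\<Union>d. L d)" using sub_modD(2)[OF Lsub] by blast
  next
    fix a x assume "a \<in> A" "x \<in> (\<Union>d. L d)"
    then show "a * x \<in> (\<Union>d. L d)" using sub_modD(3)[OF Lsub] by blast
  qed
  then obtain C where C: "finite C" "C \<subseteq> (\<Union>d. L d)" "(\<Union>d. L d) \<subseteq> lin_span A C"
    using noethD[OF A(2)] LA fin_genE by (metis UN_least)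
  have "\<exists>d0. C \<subseteq> L d0" using C(1,2)
  proof (induction C rule: finite_induct)
    case (insert x C)
    then obtain i j where "C \<subseteq> L i" "x \<in> L j" by auto
    then have "insert x C \<subseteq> L (max i j)" using Lmono[of i "max i j"] Lmono[of j "max i j"] by auto
    then show ?case by blast
  qed auto
  then obtain d0 where d0: "C \<subseteq> L d0" by blast
  \<comment> \<open>The generators of the union lie in one member of the chain.\<close>
  have Lstab: "L d \<subseteq> L d0" for d
    using C(3) lin_span_least[OF Lsub d0] by blast
  define c where "c = (\<lambda>a::'a. [:a:])"
  have cA: "sub_ring (c ` A)"
    unfolding c_def by (rule sub_ring_const_polys[OF A(1)])
  have nc: "noeth (c ` A)"
    by (rule noeth_image[OF A]) (auto simp: c_def)
  have cP: "c ` A \<subseteq> polys A" using const_in_polys[OF A(1)] unfolding c_def by auto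
  \<comment> \<open>The part of bounded degree is a module over the coefficients, generated inside the span
    of finitely many powers of the variable.\<close>
  define I0 where "I0 = {g \<in> I. Polynomial.degree g \<le> d0}"
  have "fin_gen (c ` A) I0"
  proof (rule fin_gen_submodule[OF cA, of 0 "(\<lambda>i. Polynomial.monom 1 i) ` {..d0}"])
    show "sub_mod (c ` A) I0"
      unfolding sub_mod_def I0_def
      using sub_modD[OF I(2)] cP by (auto simp: c_def degree_add_le intro: le_trans[OF degree_smult_le])
        (metis (no_types, lifting) c_def image_eqI mult_pCons_left mult_zero_left pCons_0_0 add_0_right subsetD)
    then show "0 * j \<in> I0" for j using sub_modD(1) by fastforce
    show "I0 \<subseteq> lin_span (c ` A) ((\<lambda>i. Polynomial.monom 1 i) ` {..d0})"
    proof
      fix g assume g: "g \<in> I0"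
      have "g = (\<Sum>i\<le>d0. Polynomial.monom (poly.coeff g i) i)"
        using g unfolding I0_def by (simp add: poly_as_sum_of_monoms')
      also have "\<dots> = (\<Sum>i\<le>d0. c (poly.coeff g i) * Polynomial.monom 1 i)"
        by (simp add: c_def smult_monom)
      also have "\<dots> \<in> lin_span (c ` A) ((\<lambda>i. Polynomial.monom 1 i) ` {..d0})"
      proof (intro sub_mod_sum[OF sub_mod_lin_span] sub_modD(3)[OF sub_mod_lin_span])
        show "c (poly.coeff g i) \<in> c ` A" for i using g I(1) unfolding I0_def by (auto dest: polysD)
      qed (auto intro: lin_span_incl)
      finally show "g \<in> lin_span (c ` A) ((\<lambda>i. Polynomial.monom 1 i) ` {..d0})" .
    qed
  qed (use sub_ringD(1)[OF cA] noethD[OF nc] in auto)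
  then obtain G where G: "finite G" "G \<subseteq> I0" "I0 \<subseteq> lin_span (c ` A) G" by (rule fin_genE)
  note sG = sub_mod_lin_span[of "polys A" G]
  have I0G: "I0 \<subseteq> lin_span (polys A) G" using G(3) lin_span_mono_ring[OF cP] by blast
  have "g \<in> lin_span (polys A) G" if "g \<in> I" for g
    using that
  proof (induction "Polynomial.degree g" arbitrary: g rule: less_induct)
    case less
    show ?case
    proof (cases "Polynomial.degree g \<le> d0")
      case True
      then show ?thesis using less.prems I0G unfolding I0_def by blast
    next
      case False
      let ?d = "Polynomial.degree g"
      have "poly.coeff g ?d \<in> L d0" using Lstab[of ?d] less.prems unfolding L_def by blast
      then obtain h where h: "h \<in> I" "Polynomial.degree h \<le> d0" "poly.coeff g ?d = poly.coeff h d0"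
        unfolding L_def by blast
      let ?m = "Polynomial.monom (1::'a) (?d - d0)"
      have m: "?m \<in> polys A" using monom_in_polys[OF A(1)] sub_ringD(2)[OF A(1)] by blast
      have mI: "?m * h \<in> I" using sub_modD(3)[OF I(2) m h(1)] .
      have hG: "?m * h \<in> lin_span (polys A) G"
        using sub_modD(3)[OF sG m] h I0G unfolding I0_def by blast
      have dI: "g - ?m * h \<in> I" by (rule sub_mod_diff[OF P I(2) less.prems mI])
      have "Polynomial.degree (g - ?m * h) < ?d"
      proof (rule degree_lessI)
        show "g - ?m * h \<noteq> 0 \<or> 0 < ?d" using False by auto
        show "\<forall>k\<ge>?d. poly.coeff (g - ?m * h) k = 0"
        proof (intro allI impI)
          fix k assume "?d \<le> k"
          then show "poly.coeff (g - ?m * h) k = 0"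
            using False h by (cases "k = ?d") (auto simp: coeff_monom_mult coeff_eq_0)
        qed
      qed
      then have "g - ?m * h \<in> lin_span (polys A) G" using less.hyps dI by blast
      then show ?thesis using sub_modD(2)[OF sG _ hG] by force
    qed
  qed
  then show "fin_gen (polys A) I"
    using G by (intro fin_genI[of G]) (auto simp: I0_def)
qed

subsection \<open>The substitution \<open>x \<mapsto> x\<^sup>q\<close>\<close>

definition psub :: "nat \<Rightarrow> 'a::comm_ring_1 poly \<Rightarrow> 'a poly"
  where "psub q f = f \<circ>\<^sub>p Polynomial.monom 1 q"

lemma coeff_psub: "q > 0 \<Longrightarrow> poly.coeff (psub q f) n = (if q dvd n then poly.coeff f (n div q) else 0)"
proof (induction f arbitrary: n)
  case (pCons a f)
  have e: "poly.coeff (psub q (pCons a f)) n =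
      (if n = 0 then a else 0) + (if n < q then 0 else poly.coeff (psub q f) (n - q))"
    by (auto simp: psub_def pcompose_pCons coeff_monom_mult coeff_pCons split: nat.splits)
  show ?case
  proof (cases "n < q")
    case True
    then have "q dvd n \<longleftrightarrow> n = 0" by (auto dest: dvd_imp_le)
    then show ?thesis using True e by auto
  next
    case False
    then obtain k where k: "n = k + q" by (metis add.commute le_Suc_ex not_less)
    then show ?thesis using e pCons.IH[OF pCons.prems, of k] pCons.prems by (auto simp: coeff_pCons)
  qed
qed (simp add: psub_def)

lemma pcompose_power: "(f ^ n) \<circ>\<^sub>p g = (f \<circ>\<^sub>p g) ^ n" for f g :: "'a::comm_ring_1 poly"
  by (induction n) (auto simp: pcompose_mult pcompose_1)

lemma psub_simps [simp]:
  "psub q 0 = 0" "psub q 1 = 1" "psub q [:c:] = [:c:]"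
  "psub q (f + g) = psub q f + psub q g" "psub q (f - g) = psub q f - psub q g"
  "psub q (f * g) = psub q f * psub q g" "psub q (f ^ n) = psub q f ^ n"
  "psub q (Polynomial.smult c f) = Polynomial.smult c (psub q f)"
  by (simp_all add: psub_def pcompose_add pcompose_diff pcompose_mult pcompose_smult pcompose_1 pcompose_power)

lemma psub_eq_iff: "q > 0 \<Longrightarrow> psub q f = psub q g \<longleftrightarrow> f = g"
proof (rule iffI)
  assume q: "q > 0" and e: "psub q f = psub q g"
  show "f = g"
  proof (rule poly_eqI)
    fix n show "poly.coeff f n = poly.coeff g n"
      using arg_cong[OF e, of "\<lambda>f. poly.coeff f (n * q)"] q by (simp add: coeff_psub)
  qed
qed simp

lemma psub_eq_0_iff: "q > 0 \<Longrightarrow> psub q f = 0 \<longleftrightarrow> f = 0"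
  using psub_eq_iff[of q f 0] by simp

lemma psub_in_polys: "sub_ring A \<Longrightarrow> q > 0 \<Longrightarrow> f \<in> polys A \<Longrightarrow> psub q f \<in> polys A"
  by (auto simp: polys_def coeff_psub dest: sub_ringD)

lemma poly_psub: "poly (psub q f) x = poly f (x ^ q)"
  by (simp add: psub_def poly_pcompose poly_monom)

lemma psub_psub:
  assumes "q > 0" "r > 0"
  shows "psub q (psub r f) = psub (q * r) f"
proof (rule poly_eqI)
  fix n
  have "q * r dvd n \<longleftrightarrow> q dvd n \<and> r dvd n div q"
    using assms by (metis dvd_mult_left dvd_mult_div_cancel nat_mult_dvd_cancel1)
  then show "poly.coeff (psub q (psub r f)) n = poly.coeff (psub (q * r) f) n"
    using assms by (auto simp: coeff_psub div_mult2_eq)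
qed

section \<open>Irreducible polynomials over a subfield\<close>

definition sub_field :: "'a::field set \<Rightarrow> bool"
  where "sub_field F \<longleftrightarrow> sub_ring F \<and> (\<forall>x\<in>F. inverse x \<in> F)"

lemma sub_fieldD:
  assumes "sub_field F"
  shows "sub_ring F" "x \<in> F \<Longrightarrow> inverse x \<in> F" "x \<in> F \<Longrightarrow> y \<in> F \<Longrightarrow> x / y \<in> F"
  using assms by (auto simp: sub_field_def divide_inverse dest: sub_ringD)

definition irred_over :: "'a::field set \<Rightarrow> 'a poly \<Rightarrow> bool"
  where "irred_over F f \<longleftrightarrow> f \<in> polys F \<and> Polynomial.degree f > 0 \<and>
    (\<forall>g\<in>polys F. \<forall>h\<in>polys F. f = g * h \<longrightarrow> Polynomial.degree g = 0 \<or> Polynomial.degree h = 0)"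

lemma irred_overD:
  assumes "irred_over F f"
  shows "f \<in> polys F" "Polynomial.degree f > 0"
    "g \<in> polys F \<Longrightarrow> h \<in> polys F \<Longrightarrow> f = g * h \<Longrightarrow> Polynomial.degree g = 0 \<or> Polynomial.degree h = 0"
  using assms unfolding irred_over_def by auto

lemma polys_division:
  assumes F: "sub_field F" and g: "g \<in> polys F" "g \<noteq> 0" and f: "f \<in> polys F"
  shows "\<exists>q\<in>polys F. \<exists>r\<in>polys F. f = g * q + r \<and> (r = 0 \<or> Polynomial.degree r < Polynomial.degree g)"
  using f
proof (induction "Polynomial.degree f" arbitrary: f rule: less_induct)
  case less
  note R = sub_fieldD(1)[OF F]
  note P = sub_ring_polys[OF R]
  show ?case
  proof (cases "f = 0 \<or> Polynomial.degree f < Polynomial.degree g")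
    case True
    then show ?thesis using less.prems sub_ringD(1)[OF P] by (intro bexI[of _ 0] bexI[of _ f]) auto
  next
    case False
    let ?k = "Polynomial.degree f - Polynomial.degree g"
    let ?m = "Polynomial.monom (lead_coeff f / lead_coeff g) ?k"
    have m: "?m \<in> polys F"
      by (intro monom_in_polys[OF R] sub_fieldD(3)[OF F] polysD[OF g(1)] polysD[OF less.prems])
    have fm: "f - g * ?m \<in> polys F" using sub_ringD(4,6)[OF P] m g less.prems by blast
    have "\<exists>q\<in>polys F. \<exists>r\<in>polys F. f - g * ?m = g * q + r \<and> (r = 0 \<or> Polynomial.degree r < Polynomial.degree g)"
    proof (cases "f - g * ?m = 0")
      case True
      then show ?thesis using sub_ringD(1)[OF P] by (intro bexI[of _ 0]) auto
    next
      case nz: False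
      have "poly.coeff (f - g * ?m) i = 0" if "i \<ge> Polynomial.degree f" for i
      proof (cases "i = Polynomial.degree f")
        case True
        then show ?thesis using False g(2) by (simp add: mult.commute[of g] coeff_monom_mult)
      next
        case ne: False
        then show ?thesis using False that
          by (simp add: mult.commute[of g] coeff_monom_mult coeff_eq_0)
      qed
      then have "Polynomial.degree (f - g * ?m) < Polynomial.degree f"
        using nz by (metis leading_coeff_0_iff not_less)
      then show ?thesis using less.hyps fm by blast
    qed
    then obtain q r where q: "q \<in> polys F" "r \<in> polys F" "f - g * ?m = g * q + r"
      "r = 0 \<or> Polynomial.degree r < Polynomial.degree g" by blast
    then have "f = g * (?m + q) + r" by (simp add: algebra_simps)
    then show ?thesis using q sub_ringD(3)[OF P m q(1)] by blast
  qed
qed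

lemma irred_over_bezout:
  assumes F: "sub_field F" and f: "irred_over F f" and g: "g \<in> polys F"
    and nd: "\<nexists>h. h \<in> polys F \<and> g = f * h"
  shows "\<exists>u\<in>polys F. \<exists>v\<in>polys F. u * f + v * g = 1"
proof -
  note R = sub_fieldD(1)[OF F]
  note P = sub_ring_polys[OF R]
  have f': "f \<in> polys F" "Polynomial.degree f > 0" using f unfolding irred_over_def by auto
  define S where "S = {u * f + v * g | u v. u \<in> polys F \<and> v \<in> polys F}"
  have sub: "sub_mod (polys F) S"
    unfolding sub_mod_def
  proof (intro conjI ballI)
    show "0 \<in> S" unfolding S_def using sub_ringD(1)[OF P] by force
  next
    fix x y assume "x \<in> S" "y \<in> S"
    then obtain u1 v1 u2 v2 where "u1 \<in> polys F" "v1 \<in> polys F" "u2 \<in> polys F" "v2 \<in> polys F"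
      "x = u1 * f + v1 * g" "y = u2 * f + v2 * g" unfolding S_def by blast
    moreover from this have "x + y = (u1 + u2) * f + (v1 + v2) * g" by (simp add: algebra_simps)
    ultimately show "x + y \<in> S" unfolding S_def using sub_ringD(3)[OF P] by blast
  next
    fix c x assume "c \<in> polys F" "x \<in> S"
    then obtain u1 v1 where "u1 \<in> polys F" "v1 \<in> polys F" "c \<in> polys F"
      "x = u1 * f + v1 * g" unfolding S_def by blast
    moreover from this have "c * x = (c * u1) * f + (c * v1) * g" by (simp add: algebra_simps)
    ultimately show "c * x \<in> S" unfolding S_def using sub_ringD(4)[OF P] by blast
  qed
  have SP: "S \<subseteq> polys F" unfolding S_def using f' g sub_ringD(3,4)[OF P] by blast
  have "f = 1 * f + 0 * g" "g = 0 * f + 1 * g" by simp_all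
  then have fS: "f \<in> S" and gS: "g \<in> S"
    unfolding S_def using sub_ringD(1,2)[OF P] by blast+
  have "f \<noteq> 0" using f' by auto
  obtain d where d: "d \<in> S" "d \<noteq> 0" "\<And>e. e \<in> S \<Longrightarrow> e \<noteq> 0 \<Longrightarrow> Polynomial.degree d \<le> Polynomial.degree e"
    using ex_has_least_nat[of "\<lambda>d. d \<in> S \<and> d \<noteq> 0" f Polynomial.degree] fS \<open>f \<noteq> 0\<close> by blast
  have div: "\<exists>q\<in>polys F. x = d * q" if x: "x \<in> S" for x
  proof -
    obtain q r where q: "q \<in> polys F" "x = d * q + r" "r = 0 \<or> Polynomial.degree r < Polynomial.degree d"
      using polys_division[OF F, of d x] d x SP by blast
    have "r = x - q * d" using q(2) by (simp add: mult.commute)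
    then have "r \<in> S" using sub_mod_diff[OF P sub x sub_modD(3)[OF sub q(1) d(1)]] by simp
    then have "r = 0" using d(3) q(3) by force
    then show ?thesis using q by auto
  qed
  obtain q where q: "q \<in> polys F" "f = d * q" using div[OF fS] by blast
  have "Polynomial.degree d = 0 \<or> Polynomial.degree q = 0"
    by (rule irred_overD(3)[OF f _ q]) (use d(1) SP in blast)
  moreover have "Polynomial.degree q \<noteq> 0"
  proof
    assume "Polynomial.degree q = 0"
    then obtain c where c: "q = [:c:]" by (rule degree_eq_zeroE)
    have c0: "c \<noteq> 0" using q(2) c \<open>f \<noteq> 0\<close> by auto
    have "c \<in> F" using q(1) c const_in_polys[OF R] by blast
    obtain w where w: "w \<in> polys F" "g = d * w" using div[OF gS] by blast
    have "g = f * ([:inverse c:] * w)" using q(2) c w c0 by (simp add: mult.assoc)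
    moreover have "[:inverse c:] * w \<in> polys F"
      using sub_ringD(4)[OF P _ w(1)] const_in_polys[OF R] sub_fieldD(2)[OF F \<open>c \<in> F\<close>] by blast
    ultimately show False using nd by blast
  qed
  ultimately obtain c where c: "d = [:c:]" using degree_eq_zeroE by blast
  then have c0: "c \<noteq> 0" "c \<in> F" using d(1,2) SP const_in_polys[OF R] by auto
  obtain u v where uv: "u \<in> polys F" "v \<in> polys F" "d = u * f + v * g" using d(1) unfolding S_def by blast
  have "(Polynomial.smult (inverse c) u) * f + (Polynomial.smult (inverse c) v) * g = Polynomial.smult (inverse c) d"
    by (simp add: uv(3) smult_add_right)
  also have "\<dots> = 1" using c c0 by (simp add: one_pCons)
  finally show ?thesis
    using smult_in_polys[OF R sub_fieldD(2)[OF F c0(2)]] uv(1,2) by blast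
qed

lemma irred_over_smult:
  assumes F: "sub_field F" and c: "c \<in> F" "c \<noteq> 0" and f: "irred_over F f"
  shows "irred_over F (Polynomial.smult c f)"
  unfolding irred_over_def
proof (intro conjI ballI impI)
  note R = sub_fieldD(1)[OF F]
  show "Polynomial.smult c f \<in> polys F" "0 < Polynomial.degree (Polynomial.smult c f)"
    using f c smult_in_polys[OF R] unfolding irred_over_def by auto
  fix g h assume g: "g \<in> polys F" "h \<in> polys F" "Polynomial.smult c f = g * h"
  have "f = Polynomial.smult (inverse c) (g * h)" using c by (simp add: g(3)[symmetric])
  then have "f = Polynomial.smult (inverse c) g * h" by simp
  then show "Polynomial.degree g = 0 \<or> Polynomial.degree h = 0"
    using f g smult_in_polys[OF R sub_fieldD(2)[OF F c(1)] g(1)] c unfolding irred_over_def by fastforce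
qed

lemma ex_irred_factor:
  assumes F: "sub_field F" and f: "f \<in> polys F" "Polynomial.degree f > 0"
  shows "\<exists>h w. irred_over F h \<and> lead_coeff h = 1 \<and> w \<in> polys F \<and> f = h * w"
proof -
  note R = sub_fieldD(1)[OF F]
  let ?Q = "\<lambda>h. h \<in> polys F \<and> Polynomial.degree h > 0 \<and> (\<exists>w\<in>polys F. f = h * w)"
  have "?Q f" using f sub_ringD(2)[OF sub_ring_polys[OF R]] by (metis mult_1_right)
  then obtain h where h: "?Q h" "\<And>h'. ?Q h' \<Longrightarrow> Polynomial.degree h \<le> Polynomial.degree h'"
    using ex_has_least_nat[of ?Q f Polynomial.degree] by blast
  obtain w where w: "w \<in> polys F" "f = h * w" using h by blast
  have f0: "f \<noteq> 0" using f by auto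
  have "irred_over F h"
    unfolding irred_over_def
  proof (intro conjI ballI impI)
    show "h \<in> polys F" "0 < Polynomial.degree h" using h(1) by blast+
    fix a b assume ab: "a \<in> polys F" "b \<in> polys F" "h = a * b"
    have "a \<noteq> 0" "b \<noteq> 0" using ab f0 w by auto
    then have deg: "Polynomial.degree h = Polynomial.degree a + Polynomial.degree b"
      using ab by (simp add: degree_mult_eq)
    have "f = a * (b * w)" "b * w \<in> polys F"
      using ab w sub_ringD(4)[OF sub_ring_polys[OF R]] by (auto simp: mult.assoc)
    then have "?Q a" if "Polynomial.degree a \<noteq> 0" using that ab(1) by auto
    then have "Polynomial.degree a = 0 \<or> Polynomial.degree h \<le> Polynomial.degree a"
      using h(2)[of a] by blast
    then show "Polynomial.degree a = 0 \<or> Polynomial.degree b = 0" using deg by linarith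
  qed
  let ?c = "lead_coeff h"
  have c: "?c \<noteq> 0" "?c \<in> F" using h f0 w by (auto dest: polysD)
  have "f = Polynomial.smult (inverse ?c) h * Polynomial.smult ?c w" using w c by simp
  moreover have "irred_over F (Polynomial.smult (inverse ?c) h)"
    using irred_over_smult[OF F _ _ \<open>irred_over F h\<close>] c sub_fieldD(2)[OF F] by auto
  moreover have "lead_coeff (Polynomial.smult (inverse ?c) h) = 1" using c by simp
  moreover have "Polynomial.smult ?c w \<in> polys F" using smult_in_polys[OF R c(2) w(1)] .
  ultimately show ?thesis by blast
qed

text \<open>
  A polynomial \<open>g\<close> not divisible by \<open>h\<close> is coprime to \<open>h\<close>, so that \<open>h\<close> divides the cofactor
  \<open>k\<close> and can be cancelled.
\<close>

lemma monic_dvd_irred_power: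
  assumes F: "sub_field F" and h: "irred_over F h" "lead_coeff h = 1"
    and "g \<in> polys F" "lead_coeff g = 1" "k \<in> polys F" "g * k = h ^ n"
  shows "\<exists>e\<le>n. g = h ^ e"
  using assms(4-)
proof (induction n arbitrary: g k)
  case 0
  then have "Polynomial.degree (g * k) = 0" "g \<noteq> 0" "k \<noteq> 0" by auto
  then have "Polynomial.degree g = 0" by (simp add: degree_mult_eq)
  then have "g = 1" using 0(2) by (metis degree_eq_zeroE lead_coeff_pCons(2) one_pCons)
  then show ?case by auto
next
  case (Suc n)
  note R = sub_fieldD(1)[OF F]
  note P = sub_ring_polys[OF R]
  have h': "h \<in> polys F" "h \<noteq> 0" using h unfolding irred_over_def by auto
  show ?case
  proof (cases "\<exists>g'. g' \<in> polys F \<and> g = h * g'")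
    case True
    then obtain g' where g': "g' \<in> polys F" "g = h * g'" by blast
    have "g' * k = h ^ n" using Suc.prems(4) h' g' by (simp add: mult.assoc)
    moreover have "lead_coeff g' = 1" using Suc.prems(2) h g' by (simp add: lead_coeff_mult)
    ultimately obtain e where "e \<le> n" "g' = h ^ e" using Suc.IH[OF g'(1) _ Suc.prems(3)] by blast
    then show ?thesis using g' by (intro exI[of _ "Suc e"]) auto
  next
    case False
    then obtain u v where uv: "u \<in> polys F" "v \<in> polys F" "u * h + v * g = 1"
      using irred_over_bezout[OF F h(1) Suc.prems(1)] by blast
    define k' where "k' = u * k + v * h ^ n"
    have "k = (u * h + v * g) * k" using uv by simp
    also have "\<dots> = h * (u * k) + v * (g * k)" by (simp add: algebra_simps)
    also have "\<dots> = h * k'" unfolding Suc.prems(4) k'_def by (simp add: algebra_simps)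
    finally have k: "k = h * k'" .
    then have "g * k' = h ^ n" using Suc.prems(4) h' by (simp add: mult.left_commute)
    moreover have "k' \<in> polys F" unfolding k'_def
      using uv(1,2) Suc.prems(3) h'(1) by (intro sub_ringD(3,4)[OF P] sub_ring_power[OF P])
    ultimately obtain e where "e \<le> n" "g = h ^ e" using Suc.IH[OF Suc.prems(1,2)] by metis
    then show ?thesis by (intro exI[of _ e]) auto
  qed
qed

subsection \<open>Frobenius on polynomials\<close>

abbreviation frob_poly :: "nat \<Rightarrow> 'a::comm_ring_1 poly \<Rightarrow> 'a poly"
  where "frob_poly q \<equiv> map_poly (\<lambda>c. c ^ q)"

context
  fixes p q e :: nat and ty :: "'a::field itself"
  assumes p: "p = CHAR('a)" "p > 0" and q: "q = p ^ e"
begin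

lemma q_pos: "q > 0" using p q by simp

lemma prime_char: "Factorial_Ring.prime CHAR('a)"
  using p prime_CHAR_semidom by simp

lemma frob_add: "(x + y :: 'a) ^ q = x ^ q + y ^ q"
  by (rule freshmans_dream'[OF prime_char]) (simp add: p q)

lemma frob_eq_iff: "(x :: 'a) ^ q = y ^ q \<longleftrightarrow> x = y"
proof
  assume "x ^ q = y ^ q"
  then have "(x - y) ^ q = 0" using frob_add[of "x - y" y] by simp
  then show "x = y" using q_pos by simp
qed simp

lemma coeff_frob_poly: "poly.coeff (frob_poly q f) i = (poly.coeff (f :: 'a poly) i) ^ q"
  using q_pos by (simp add: coeff_map_poly)

lemma psub_frob_poly: "psub q (frob_poly q f) = (f :: 'a poly) ^ q"
proof -
  have ch: "CHAR('a poly) = CHAR('a)" by simp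
  have pr: "Factorial_Ring.prime CHAR('a poly)" using prime_char ch by metis
  have fd: "(f + g) ^ q = f ^ q + g ^ q" for f g :: "'a poly"
    by (rule freshmans_dream'[OF pr]) (simp add: p q)
  show ?thesis
  proof (induction f)
    case 0
    then show ?case using q_pos by simp
  next
    case (pCons a f)
    have e: "pCons a f = [:a:] + Polynomial.monom 1 1 * f" by (simp add: monom_altdef)
    have m: "frob_poly q (pCons a f) = pCons (a ^ q) (frob_poly q f)"
      using q_pos by (simp add: map_poly_pCons)
    have "psub q (frob_poly q (pCons a f)) = [:a ^ q:] + Polynomial.monom 1 q * psub q (frob_poly q f)"
      unfolding m by (simp add: psub_def pcompose_pCons)
    also have "\<dots> = [:a:] ^ q + (Polynomial.monom 1 1) ^ q * f ^ q"
      unfolding pCons.IH by (simp add: poly_const_pow monom_power)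
    also have "\<dots> = (pCons a f) ^ q" unfolding e fd by (simp add: power_mult_distrib)
    finally show ?case .
  qed
qed

lemma frob_poly_mult: "frob_poly q (f * g) = frob_poly q f * frob_poly q (g :: 'a poly)"
proof -
  have "psub q (frob_poly q (f * g)) = psub q (frob_poly q f * frob_poly q g)"
    by (simp add: psub_frob_poly power_mult_distrib)
  then show ?thesis using psub_eq_iff[OF q_pos] by blast
qed

lemma degree_frob_poly: "Polynomial.degree (frob_poly q f) = Polynomial.degree (f :: 'a poly)"
  by (rule degree_map_poly) (use q_pos in auto)

end

lemma degree_psub: "Polynomial.degree (psub q g) = Polynomial.degree g * q" for g :: "'a::field poly"
  by (simp add: psub_def degree_pcompose degree_monom_eq)

text \<open>
  Let \<open>h\<close> be a monic irreducible factor of \<open>f(x\<^sup>p)\<close>, and \<open>H\<close> obtained from \<open>h\<close> by raising the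
  coefficients to the \<open>p\<close>-th power, so that \<open>H(x\<^sup>p) = h\<^sup>p\<close>. Then \<open>f\<close> divides \<open>H\<close>, hence
  \<open>f(x\<^sup>p)\<close> divides \<open>h\<^sup>p\<close> and equals some \<open>h\<^sup>e\<close>. For \<open>e = p\<close> the coefficients of \<open>f\<close> are \<open>p\<close>-th
  powers. For \<open>e < p\<close> differentiating shows that \<open>h\<close> is a polynomial in \<open>x\<^sup>p\<close>, which makes \<open>f\<close>
  an \<open>e\<close>-th power, so \<open>e = 1\<close>.
\<close>

lemma irred_over_psub:
  fixes f :: "'a::field poly"
  assumes p: "p = CHAR('a)" "p > 0" and F: "sub_field F"
    and f: "irred_over F f" "lead_coeff f = 1"
    and np: "poly.coeff f i \<notin> {y ^ p | y. y \<in> F}"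
  shows "irred_over F (psub p f)"
proof -
  note R = sub_fieldD(1)[OF F]
  note P = sub_ring_polys[OF R]
  note pp = p(1) p(2) power_one_right[symmetric]
  have f': "f \<in> polys F" "Polynomial.degree f > 0" using f unfolding irred_over_def by auto
  have deg: "Polynomial.degree (psub p g) = Polynomial.degree g * p" for g :: "'a poly"
    by (rule degree_psub)
  have lc: "lead_coeff (psub p g) = lead_coeff g" for g :: "'a poly"
    unfolding deg using p by (simp add: coeff_psub)
  have fP: "psub p f \<in> polys F" by (rule psub_in_polys[OF R p(2) f'(1)])
  obtain h w where h: "irred_over F h" "lead_coeff h = 1" "w \<in> polys F" "psub p f = h * w"
    using ex_irred_factor[OF F fP] deg f'(2) p(2) by auto
  have h': "h \<in> polys F" "Polynomial.degree h > 0" "h \<noteq> 0" using h unfolding irred_over_def by auto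
  define H where "H = frob_poly p h"
  have HP: "H \<in> polys F" unfolding H_def polys_def using coeff_frob_poly[OF pp] polysD[OF h'(1)] sub_ring_power[OF R] by auto
  have Hh: "psub p H = h ^ p" unfolding H_def by (rule psub_frob_poly[OF pp])
  have "\<exists>k. k \<in> polys F \<and> H = f * k"
  proof (rule ccontr)
    assume "\<nexists>k. k \<in> polys F \<and> H = f * k"
    then obtain u v where "u * f + v * H = 1" using irred_over_bezout[OF F f(1) HP] by blast
    then have "psub p (u * f + v * H) = 1" by simp
    then have "psub p u * (h * w) + psub p v * h ^ p = 1" by (simp add: h(4) Hh)
    moreover have "h ^ p = h * h ^ (p - 1)" using p(2) by (simp add: power_eq_if)
    ultimately have "h * (psub p u * w + psub p v * h ^ (p - 1)) = 1" by (simp add: algebra_simps)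
    then have "h dvd 1" by (metis dvdI)
    then show False using h'(2) is_unit_iff_degree[OF h'(3)] by simp
  qed
  then obtain k where k: "k \<in> polys F" "H = f * k" by blast
  have "psub p f * psub p k = h ^ p" using Hh k by simp
  moreover have "lead_coeff (psub p f) = 1" using lc f(2) by simp
  ultimately obtain e where e: "e \<le> p" "psub p f = h ^ e"
    using monic_dvd_irred_power[OF F h(1,2) fP _ psub_in_polys[OF R p(2) k(1)]] by blast
  have "e \<noteq> 0" using e(2) deg[of f] f'(2) p(2) by (intro notI) simp
  moreover have "e \<noteq> p"
  proof
    assume "e = p"
    then have "f = H" using e(2) Hh p(2) by (metis psub_eq_iff)
    then show False using np coeff_frob_poly[OF pp, of h i] polysD[OF h'(1)] unfolding H_def by auto
  qed
  ultimately have e': "0 < e" "e < p" using e by auto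
  have "of_nat p = (0 :: 'a)" using p(1) by simp
  have dvd0: "of_nat n = (0 :: 'a) \<longleftrightarrow> p dvd n" for n unfolding p(1) by (rule of_nat_eq_0_iff_char_dvd)
  have "pderiv (psub p f) = 0"
  proof (rule poly_eqI)
    fix n show "poly.coeff (pderiv (psub p f)) n = poly.coeff 0 n"
      using p(2) dvd0[of "Suc n"] by (auto simp: coeff_pderiv coeff_psub simp del: of_nat_Suc)
  qed
  then have "pderiv h = 0"
    using e' h'(3) dvd0[of e] unfolding e(2) pderiv_power by (auto dest: dvd_imp_le)
  then have hn: "poly.coeff h n = 0" if "\<not> p dvd n" for n
  proof -
    obtain m where m: "n = Suc m" using \<open>\<not> p dvd n\<close> by (cases n) auto
    have "of_nat (Suc m) * poly.coeff h (Suc m) = 0"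
      using arg_cong[OF \<open>pderiv h = 0\<close>, of "\<lambda>f. poly.coeff f m"] by (simp only: coeff_pderiv coeff_0)
    then show ?thesis using that m dvd0[of "Suc m"] by (auto simp del: of_nat_Suc)
  qed
  define v where "v = Abs_poly (\<lambda>n. poly.coeff h (n * p))"
  have cv: "poly.coeff v n = poly.coeff h (n * p)" for n
    unfolding v_def
  proof (subst coeff_Abs_poly[of "Polynomial.degree h"])
    fix i assume "Polynomial.degree h < i"
    then have "Polynomial.degree h < i * p" using p(2)
      by (metis One_nat_def Suc_leI less_le_trans mult.right_neutral mult_le_mono2)
    then show "poly.coeff h (i * p) = 0" by (rule coeff_eq_0)
  qed simp
  have hv: "h = psub p v"
    by (rule poly_eqI) (use hn p(2) in \<open>auto simp: coeff_psub cv\<close>)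
  have vP: "v \<in> polys F" using polysD[OF h'(1)] by (auto simp: polys_def cv)
  have "psub p f = psub p (v ^ e)" using e(2) hv by simp
  then have "f = v ^ e" using psub_eq_iff[OF p(2)] by blast
  also have "\<dots> = v * v ^ (e - 1)" using e' by (cases e) auto
  finally have fv: "f = v * v ^ (e - 1)" .
  have vd: "Polynomial.degree v > 0" using h'(2) hv deg[of v] by (cases "Polynomial.degree v") auto
  have "v ^ (e - 1) \<in> polys F" using sub_ring_power[OF P vP] .
  then have "Polynomial.degree (v ^ (e - 1)) = 0"
    using irred_overD(3)[OF f(1) vP _ fv] vd by auto
  then have "(e - 1) * Polynomial.degree v = 0" using vd by (subst (asm) degree_power_eq) auto
  then have "e = 1" using vd e' by simp
  then show ?thesis using e(2) h(1) by simp
qed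

text \<open>
  The coefficient that is not a \<open>p\<close>-th power survives the substitution, at another index.
\<close>

lemma irred_over_psub_power:
  fixes f :: "'a::field poly"
  assumes p: "p = CHAR('a)" "p > 0" and F: "sub_field F"
    and f: "irred_over F f" "lead_coeff f = 1"
    and np: "poly.coeff f i \<notin> {y ^ p | y. y \<in> F}"
  shows "irred_over F (psub (p ^ j) f)"
proof -
  have "irred_over F (psub (p ^ j) f) \<and> lead_coeff (psub (p ^ j) f) = 1 \<and> poly.coeff (psub (p ^ j) f) (p ^ j * i) \<notin> {y ^ p | y. y \<in> F}"
  proof (induction j)
    case 0
    have "psub (p ^ 0) f = f" by (rule poly_eqI) (simp add: coeff_psub)
    then show ?case using f np by simp
  next
    case (Suc j)
    let ?g = "psub (p ^ j) f"
    have e: "psub (p ^ Suc j) f = psub p ?g" using p by (simp add: psub_psub)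
    have "Polynomial.degree (psub p ?g) = Polynomial.degree ?g * p"
      by (rule degree_psub)
    then have "lead_coeff (psub p ?g) = lead_coeff ?g" using p by (simp add: coeff_psub)
    moreover have "poly.coeff (psub p ?g) (p ^ Suc j * i) = poly.coeff ?g (p ^ j * i)"
      using p by (simp add: coeff_psub)
    ultimately show ?case unfolding e using Suc.IH irred_over_psub[OF p F, of ?g "p ^ j * i"] by simp
  qed
  then show ?thesis by blast
qed

text \<open>
  Roots of order \<open>p\<close> of the coefficients are extracted as often as possible. This ends because
  some coefficient lies outside \<open>C\<close>, whereas only elements of \<open>C\<close> have roots of all orders
  \<open>p\<^sup>e\<close>. The result is irreducible since the Frobenius map turns a factorization of it into
  one of \<open>f\<close>.
\<close>

lemma frobenius_root:
  fixes f :: "'a::field poly"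
  assumes p: "p = CHAR('a)" "p > 0" and F: "sub_field F"
    and C: "\<And>x. (\<And>e. \<exists>y\<in>F. x = y ^ (p ^ e)) \<Longrightarrow> x \<in> C"
    and f: "irred_over F f" "lead_coeff f = 1" and i: "poly.coeff f i \<notin> C"
  obtains e g k where "irred_over F g" "lead_coeff g = 1" "Polynomial.degree g = Polynomial.degree f"
    "psub (p ^ e) f = g ^ (p ^ e)" "poly.coeff g k \<notin> {y ^ p | y. y \<in> F}"
proof -
  note R = sub_fieldD(1)[OF F]
  define E where "E = {e. \<forall>k. \<exists>y\<in>F. poly.coeff f k = y ^ (p ^ e)}"
  obtain m where m: "\<nexists>y. y \<in> F \<and> poly.coeff f i = y ^ (p ^ m)" using C i by blast
  have "e < m" if eE: "e \<in> E" for e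
  proof (rule ccontr)
    assume "\<not> e < m"
    then obtain d where d: "e = d + m" by (metis add.commute le_Suc_ex not_less)
    obtain y where "y \<in> F" "poly.coeff f i = y ^ (p ^ e)" using eE unfolding E_def by blast
    then have "y ^ (p ^ d) \<in> F" "poly.coeff f i = (y ^ (p ^ d)) ^ (p ^ m)"
      using sub_ring_power[OF R] by (auto simp: d power_add power_mult)
    then show False using m by blast
  qed
  then have fin: "finite E" using finite_nat_set_iff_bounded by blast
  have "0 \<in> E" unfolding E_def using f polysD unfolding irred_over_def by auto
  define e where "e = Max E"
  have e: "e \<in> E" "Suc e \<notin> E"
    using Max_in[OF fin] Max_ge[OF fin, of "Suc e"] \<open>0 \<in> E\<close> unfolding e_def by auto
  \<comment> \<open>The case distinction makes the choice of roots preserve zero, so that it acts on the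
    coefficients of a polynomial.\<close>
  define r where "r x = (if x = 0 then 0 else SOME y. y \<in> F \<and> y ^ (p ^ e) = x)" for x
  define g where "g = map_poly r f"
  have rr: "r (poly.coeff f k) \<in> F \<and> r (poly.coeff f k) ^ (p ^ e) = poly.coeff f k" for k
  proof (cases "poly.coeff f k = 0")
    case True
    then show ?thesis using p sub_ringD(1)[OF R] by (simp add: r_def)
  next
    case False
    have "\<exists>y\<in>F. poly.coeff f k = y ^ (p ^ e)" using e(1) unfolding E_def by blast
    then have "\<exists>y. y \<in> F \<and> y ^ (p ^ e) = poly.coeff f k" by auto
    from someI_ex[OF this] False show ?thesis by (simp add: r_def)
  qed
  have cg: "poly.coeff g k = r (poly.coeff f k)" for k
    unfolding g_def by (rule coeff_map_poly) (simp add: r_def)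
  note pp = p(1) p(2) refl[of "p ^ e"]
  have gP: "g \<in> polys F" using rr by (simp add: polys_def cg)
  have fg: "frob_poly (p ^ e) g = f"
    by (rule poly_eqI) (use rr in \<open>simp add: coeff_frob_poly[OF pp] cg\<close>)
  have deg: "Polynomial.degree g = Polynomial.degree f"
    using degree_frob_poly[OF pp, of g] fg by simp
  have lead: "lead_coeff g = 1"
  proof -
    have "lead_coeff g ^ (p ^ e) = 1 ^ (p ^ e)"
      using f(2) deg rr[of "Polynomial.degree f"] by (simp add: cg)
    then show ?thesis by (simp only: frob_eq_iff[OF pp])
  qed
  have irr: "irred_over F g"
    unfolding irred_over_def
  proof (intro conjI ballI impI)
    show "g \<in> polys F" "0 < Polynomial.degree g" using gP deg f unfolding irred_over_def by auto
    fix a b assume ab: "a \<in> polys F" "b \<in> polys F" "g = a * b"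
    have "f = frob_poly (p ^ e) a * frob_poly (p ^ e) b" using fg ab frob_poly_mult[OF pp] by simp
    moreover have "frob_poly (p ^ e) a \<in> polys F" "frob_poly (p ^ e) b \<in> polys F"
      using ab(1,2) sub_ring_power[OF R] by (auto simp: polys_def coeff_frob_poly[OF pp])
    ultimately have "Polynomial.degree (frob_poly (p ^ e) a) = 0 \<or> Polynomial.degree (frob_poly (p ^ e) b) = 0"
      by (intro irred_overD(3)[OF f(1)])
    then show "Polynomial.degree a = 0 \<or> Polynomial.degree b = 0"
      unfolding degree_frob_poly[OF pp] .
  qed
  have "\<exists>k. poly.coeff g k \<notin> {y ^ p | y. y \<in> F}"
  proof (rule ccontr)
    assume "\<not> ?thesis"
    then have "\<forall>k. \<exists>y\<in>F. poly.coeff g k = y ^ p" by blast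
    then obtain y where y: "\<And>k. y k \<in> F \<and> poly.coeff g k = y k ^ p" by metis
    have "poly.coeff f k = y k ^ (p ^ Suc e)" for k
      using rr[of k] y[of k] unfolding cg by (simp add: power_mult)
    then have "\<forall>k. \<exists>y\<in>F. poly.coeff f k = y ^ (p ^ Suc e)" using y by blast
    then show False using e(2) unfolding E_def by blast
  qed
  moreover have "psub (p ^ e) f = g ^ (p ^ e)" using psub_frob_poly[OF pp, of g] fg by simp
  ultimately show ?thesis using that irr lead deg by blast
qed

section \<open>Fractions\<close>

definition fracs :: "'a::field set \<Rightarrow> 'a set"
  where "fracs A = {a / b | a b. a \<in> A \<and> b \<in> A \<and> b \<noteq> 0}"

lemma fracsE:
  assumes "x \<in> fracs A"
  obtains a b where "a \<in> A" "b \<in> A" "b \<noteq> 0" "x = a / b"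
  using assms unfolding fracs_def by blast

lemma fracsI: "a \<in> A \<Longrightarrow> b \<in> A \<Longrightarrow> b \<noteq> 0 \<Longrightarrow> a / b \<in> fracs A"
  unfolding fracs_def by blast

lemma subset_fracs: "sub_ring A \<Longrightarrow> A \<subseteq> fracs A"
  using fracsI[of _ A 1] sub_ringD(2) by fastforce

lemma sub_field_fracs:
  fixes A :: "'a::field set"
  assumes A: "sub_ring A"
  shows "sub_field (fracs A)"
  unfolding sub_field_def sub_ring_def
proof (intro conjI ballI)
  note D = sub_ringD[OF A]
  show "0 \<in> fracs A" "1 \<in> fracs A" using subset_fracs[OF A] D(1,2) by auto
  fix x assume x: "x \<in> fracs A"
  then obtain a b where ab: "a \<in> A" "b \<in> A" "b \<noteq> 0" "x = a / b" by (rule fracsE)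
  show "- x \<in> fracs A" using fracsI[of "- a" A b] ab D(5) by simp
  show "inverse x \<in> fracs A"
  proof (cases "a = 0")
    case True
    then show ?thesis using x ab by simp
  next
    case False
    then show ?thesis using fracsI[of b A a] ab by (simp add: inverse_eq_divide)
  qed
  fix y assume "y \<in> fracs A"
  then obtain c d where cd: "c \<in> A" "d \<in> A" "d \<noteq> 0" "y = c / d" by (rule fracsE)
  have "x + y = (a * d + c * b) / (b * d)" using ab cd by (simp add: add_frac_eq)
  then show "x + y \<in> fracs A" using fracsI[of "a * d + c * b" A "b * d"] ab cd D by simp
  have "x * y = (a * c) / (b * d)" using ab cd by simp
  then show "x * y \<in> fracs A" using fracsI[of "a * c" A "b * d"] ab cd D by simp
qed

lemma common_denominator:
  fixes A :: "'a::field set"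
  assumes A: "sub_ring A" and S: "finite S" "S \<subseteq> fracs A"
  shows "\<exists>b\<in>A. b \<noteq> 0 \<and> (\<forall>x\<in>S. b * x \<in> A)"
  using S
proof (induction S rule: finite_induct)
  case empty
  then show ?case using sub_ringD(2)[OF A] by (intro bexI[of _ 1]) auto
next
  case (insert x S)
  then obtain b where b: "b \<in> A" "b \<noteq> 0" "\<And>x. x \<in> S \<Longrightarrow> b * x \<in> A" by auto
  obtain c d where cd: "c \<in> A" "d \<in> A" "d \<noteq> 0" "x = c / d" using insert.prems fracsE by blast
  have "d * b \<in> A" "d * b \<noteq> 0" "(d * b) * x = b * c" using sub_ringD(4)[OF A] b cd by auto
  moreover have "(d * b) * y \<in> A" if "y \<in> S" for y
    using sub_ringD(4)[OF A cd(2) b(3)[OF that]] by (simp add: mult.assoc)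
  moreover have "(d * b) * x \<in> A" using sub_ringD(4)[OF A b(1) cd(1)] cd(3,4) by simp
  ultimately have "d * b \<in> A \<and> d * b \<noteq> 0 \<and> (\<forall>y\<in>insert x S. (d * b) * y \<in> A)" by blast
  then show ?case by blast
qed

lemma polys_common_denominator:
  fixes A :: "'a::field set"
  assumes A: "sub_ring A" and f: "f \<in> polys (fracs A)"
  shows "\<exists>b\<in>A. b \<noteq> 0 \<and> Polynomial.smult b f \<in> polys A"
proof -
  obtain b where b: "b \<in> A" "b \<noteq> 0" "\<And>x. x \<in> poly.coeff f ` {..Polynomial.degree f} \<Longrightarrow> b * x \<in> A"
    using common_denominator[OF A, of "poly.coeff f ` {..Polynomial.degree f}"] f polysD by blast
  have "b * poly.coeff f i \<in> A" for i
    using b(3)[of "poly.coeff f i"] coeff_eq_0[of f i] sub_ringD(1)[OF A]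
    by (cases "i \<le> Polynomial.degree f") auto
  then show ?thesis using b by (auto simp: polys_def)
qed


section \<open>Adjoining all \<open>p\<close>-power roots of an indeterminate\<close>

text \<open>
  The coefficients of \<open>f\<close> at the exponents congruent to \<open>j\<close> modulo \<open>q\<close>. They describe the
  value of \<open>f\<close> at a \<open>q\<close>-th root of an element as a combination of \<open>q\<close> powers of this root.
\<close>

definition psect :: "nat \<Rightarrow> nat \<Rightarrow> 'a::comm_ring_1 poly \<Rightarrow> 'a poly"
  where "psect q j f = Abs_poly (\<lambda>n. poly.coeff f (n * q + j))"

lemma coeff_psect: "q > 0 \<Longrightarrow> poly.coeff (psect q j f) n = poly.coeff f (n * q + j)"
proof -
  assume q: "q > 0"
  have "poly.coeff f (n * q + j) = 0" if "Polynomial.degree f < n" for n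
  proof (rule coeff_eq_0)
    have "n \<le> n * q" using q by simp
    then show "Polynomial.degree f < n * q + j" using that by linarith
  qed
  then show ?thesis unfolding psect_def by (subst coeff_Abs_poly[of "Polynomial.degree f"]) auto
qed

lemma coeff_psub_sum:
  assumes "j < q"
  shows "poly.coeff (\<Sum>i<q. Polynomial.monom 1 i * psub q (w i)) (n * q + j) = poly.coeff (w j) n"
proof -
  have "poly.coeff (Polynomial.monom 1 i * psub q (w i)) (n * q + j) = (if i = j then poly.coeff (w j) n else 0)"
    if i: "i < q" for i
  proof (cases "i = j")
    case True
    then show ?thesis using assms by (simp add: coeff_monom_mult coeff_psub)
  next
    case False
    have "\<not> q dvd n * q + j - i" if "i \<le> n * q + j"
    proof
      assume "q dvd n * q + j - i"
      then have "(n * q + j) mod q = i mod q" using mod_eq_dvd_iff_nat[OF that] by blast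
      then show False using i assms False by simp
    qed
    then have "poly.coeff (Polynomial.monom 1 i * psub q (w i)) (n * q + j) = 0"
      using assms by (cases "i \<le> n * q + j") (simp_all add: coeff_monom_mult coeff_psub)
    then show ?thesis using False by simp
  qed
  then show ?thesis using assms by (simp add: coeff_sum)
qed

lemma poly_eq_psect_sum:
  assumes q: "q > 0"
  shows "f = (\<Sum>i<q. Polynomial.monom 1 i * psub q (psect q i f))"
proof (rule poly_eqI)
  fix n
  have "n = n div q * q + n mod q" by simp
  then show "poly.coeff f n = poly.coeff (\<Sum>i<q. Polynomial.monom 1 i * psub q (psect q i f)) n"
    using coeff_psub_sum[of "n mod q" q "\<lambda>i. psect q i f" "n div q"] q by (simp add: coeff_psect)
qed

text \<open>
  Here \<open>t m\<close> is a root of order \<open>p\<^sup>m\<close> of \<open>t 0\<close>, and \<open>tower A\<close> is the localization of the ring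
  generated over \<open>A\<close> by all \<open>t m\<close> in which the nonzero polynomials over the field of constants
  \<open>C\<close> become units. Its elements are written at one level \<open>m\<close>, and \<open>psub\<close> rewrites them at any
  higher level.
\<close>

locale perfect_tower =
  fixes p :: nat and t :: "nat \<Rightarrow> 'u::field" and C :: "'u set"
  assumes p: "p = CHAR('u)" "p > 0" and t_Suc: "t (Suc m) ^ p = t m" and C: "sub_field C"
    and transcendental: "s \<in> polys C \<Longrightarrow> s \<noteq> 0 \<Longrightarrow> poly s (t m) \<noteq> 0"
begin

definition tower :: "'u set \<Rightarrow> 'u set"
  where "tower A = {poly g (t m) / poly s (t m) | m g s. g \<in> polys A \<and> s \<in> polys C \<and> s \<noteq> 0}"

lemma t_add: "t (m + j) ^ (p ^ j) = t m"
  by (induction j) (auto simp: t_Suc power_mult)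

lemma poly_level: "poly g (t m) = poly (psub (p ^ j) g) (t (m + j))"
  by (simp add: poly_psub t_add)

lemma towerI: "g \<in> polys A \<Longrightarrow> s \<in> polys C \<Longrightarrow> s \<noteq> 0 \<Longrightarrow> poly g (t m) / poly s (t m) \<in> tower A"
  unfolding tower_def by blast

lemma towerE_above:
  assumes A: "sub_ring A" and x: "x \<in> tower A"
  obtains m where "\<And>m'. m' \<ge> m \<Longrightarrow>
    \<exists>g s. g \<in> polys A \<and> s \<in> polys C \<and> s \<noteq> 0 \<and> x = poly g (t m') / poly s (t m')"
proof -
  obtain m g s where g: "g \<in> polys A" "s \<in> polys C" "s \<noteq> 0" "x = poly g (t m) / poly s (t m)"
    using x unfolding tower_def by blast
  have "\<exists>g s. g \<in> polys A \<and> s \<in> polys C \<and> s \<noteq> 0 \<and> x = poly g (t m') / poly s (t m')" if "m' \<ge> m" for m'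
  proof -
    let ?q = "p ^ (m' - m)"
    have q: "?q > 0" using p by simp
    have e: "poly f (t m) = poly (psub ?q f) (t m')" for f using poly_level[of f m "m' - m"] that by simp
    show ?thesis
      using psub_in_polys[OF A q g(1)] psub_in_polys[OF sub_fieldD(1)[OF C] q g(2)] g(3,4) psub_eq_0_iff[OF q]
      unfolding e by blast
  qed
  then show ?thesis using that by blast
qed

lemma towerE2:
  assumes A: "sub_ring A" and "x \<in> tower A" "y \<in> tower A"
  obtains m f r g s where "f \<in> polys A" "r \<in> polys C" "r \<noteq> 0" "g \<in> polys A" "s \<in> polys C" "s \<noteq> 0"
    "x = poly f (t m) / poly r (t m)" "y = poly g (t m) / poly s (t m)"
proof -
  obtain i where i: "\<And>m'. m' \<ge> i \<Longrightarrow>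
    \<exists>g s. g \<in> polys A \<and> s \<in> polys C \<and> s \<noteq> 0 \<and> x = poly g (t m') / poly s (t m')"
    using towerE_above[OF A assms(2)] by blast
  obtain j where j: "\<And>m'. m' \<ge> j \<Longrightarrow>
    \<exists>g s. g \<in> polys A \<and> s \<in> polys C \<and> s \<noteq> 0 \<and> y = poly g (t m') / poly s (t m')"
    using towerE_above[OF A assms(3)] by blast
  show ?thesis using i[of "max i j"] j[of "max i j"] that by (metis max.cobounded1 max.cobounded2)
qed

lemma poly_in_tower: "g \<in> polys A \<Longrightarrow> poly g (t m) \<in> tower A"
  using towerI[of g A 1 m] sub_ringD(2)[OF sub_ring_polys[OF sub_fieldD(1)[OF C]]] by simp

lemma subset_tower: "sub_ring A \<Longrightarrow> A \<subseteq> tower A"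
  using poly_in_tower[of "[:_:]" A 0] const_in_polys by fastforce

lemma tower_mono: "A \<subseteq> B \<Longrightarrow> tower A \<subseteq> tower B"
  unfolding tower_def using polys_mono by blast

lemma inverse_in_tower:
  assumes "sub_ring A" "s \<in> polys C" "s \<noteq> 0"
  shows "inverse (poly s (t m)) \<in> tower A"
  using towerI[of 1 A s m] assms sub_ringD(2)[OF sub_ring_polys[OF assms(1)]] by (simp add: inverse_eq_divide)

lemma t_in_tower:
  assumes A: "sub_ring A" shows "t m \<in> tower A"
  using poly_in_tower[OF monom_in_polys[OF A sub_ringD(2)[OF A]], of 1 m] by (simp add: poly_monom)

lemma sub_ring_tower:
  assumes A: "sub_ring A" and CA: "C \<subseteq> A"
  shows "sub_ring (tower A)"
  unfolding sub_ring_def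
proof (intro conjI ballI)
  note P = sub_ring_polys[OF A] and PC = sub_ring_polys[OF sub_fieldD(1)[OF C]]
  have CP: "f \<in> polys C \<Longrightarrow> f \<in> polys A" for f using polys_mono[OF CA] by blast
  show "0 \<in> tower A" "1 \<in> tower A" using subset_tower[OF A] sub_ringD(1,2)[OF A] by auto
  fix x assume x: "x \<in> tower A"
  fix y assume y: "y \<in> tower A"
  obtain m f r g s where e: "f \<in> polys A" "r \<in> polys C" "r \<noteq> 0" "g \<in> polys A" "s \<in> polys C" "s \<noteq> 0"
    "x = poly f (t m) / poly r (t m)" "y = poly g (t m) / poly s (t m)"
    using towerE2[OF A x y] .
  have rs: "r * s \<in> polys C" "r * s \<noteq> 0" using e sub_ringD(4)[OF PC] by auto
  note nz = transcendental[OF e(2,3), of m] transcendental[OF e(5,6), of m]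
  have "x + y = poly (f * s + g * r) (t m) / poly (r * s) (t m)"
    using e nz by (simp add: add_frac_eq)
  moreover have "f * s + g * r \<in> polys A" using sub_ringD(3,4)[OF P] e CP by blast
  ultimately show "x + y \<in> tower A" using towerI rs by metis
  have "x * y = poly (f * g) (t m) / poly (r * s) (t m)" using e by simp
  moreover have "f * g \<in> polys A" using sub_ringD(4)[OF P] e by blast
  ultimately show "x * y \<in> tower A" using towerI rs by metis
next
  fix x assume "x \<in> tower A"
  then obtain m g s where g: "g \<in> polys A" "s \<in> polys C" "s \<noteq> 0" "x = poly g (t m) / poly s (t m)"
    unfolding tower_def by blast
  then have "- x = poly (- g) (t m) / poly s (t m)" by simp
  then show "- x \<in> tower A" using towerI sub_ringD(5)[OF sub_ring_polys[OF A] g(1)] g(2,3) by metis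
qed

end

text \<open>
  The situation of the induction step: ideals that meet \<open>A\<close> outside zero are under control,
  and the task is to treat the others.
\<close>

locale perfect_tower_domain = perfect_tower p t C for p and t :: "nat \<Rightarrow> 'u::field" and C +
  fixes A :: "'u set"
  assumes A: "sub_ring A" and CA: "C \<subseteq> A" and noeth_A: "noeth A"
    and infinitely_divisible: "(\<And>e. \<exists>y\<in>fracs A. x = y ^ (p ^ e)) \<Longrightarrow> x \<in> C"
    and fin_gen_above: "sub_mod (tower A) I \<Longrightarrow> I \<subseteq> tower A \<Longrightarrow> a \<in> A \<Longrightarrow> a \<noteq> 0 \<Longrightarrow> a \<in> I \<Longrightarrow>
      fin_gen (tower A) I"
begin

abbreviation "T \<equiv> tower A"
abbreviation "F \<equiv> fracs A"

lemmas T_ring = sub_ring_tower[OF A CA]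
lemmas F_field = sub_field_fracs[OF A]
lemmas F_ring = sub_fieldD(1)[OF F_field]

text \<open>
  The factor \<open>a\<close> lets \<open>z\<close> be the value of a polynomial over the field of fractions, as the
  irreducible factors of a polynomial over \<open>A\<close> are.
\<close>

definition good :: "'u \<Rightarrow> bool"
  where "good z \<longleftrightarrow> (\<forall>I. sub_mod T I \<longrightarrow> I \<subseteq> T \<longrightarrow> (\<exists>a\<in>A. a \<noteq> 0 \<and> a * z \<in> I) \<longrightarrow> fin_gen T I)"

lemma goodD: "good z \<Longrightarrow> sub_mod T I \<Longrightarrow> I \<subseteq> T \<Longrightarrow> a \<in> A \<Longrightarrow> a \<noteq> 0 \<Longrightarrow> a * z \<in> I \<Longrightarrow> fin_gen T I"
  unfolding good_def by blast

text \<open>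
  Let \<open>g\<close> be \<open>z1\<close> freed from its denominator. The ideal \<open>I + g T\<close> contains \<open>z1\<close> and \<open>(I : g)\<close>
  contains \<open>z2\<close>, each up to a factor from \<open>A\<close>.
\<close>

lemma good_mult:
  assumes z: "good z1" "good z2" and d: "\<exists>a\<in>A. a \<noteq> 0 \<and> a * z1 \<in> T" "\<exists>a\<in>A. a \<noteq> 0 \<and> a * z2 \<in> T"
  shows "good (z1 * z2)"
  unfolding good_def
proof (intro allI impI)
  fix I assume I: "sub_mod T I" "I \<subseteq> T" and "\<exists>a\<in>A. a \<noteq> 0 \<and> a * (z1 * z2) \<in> I"
  then obtain a where a: "a \<in> A" "a \<noteq> 0" "a * (z1 * z2) \<in> I" by blast
  obtain a1 a2 where a12: "a1 \<in> A" "a1 \<noteq> 0" "a1 * z1 \<in> T" "a2 \<in> A" "a2 \<noteq> 0" "a2 * z2 \<in> T" using d by blast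
  have AT: "x \<in> A \<Longrightarrow> x \<in> T" for x using subset_tower[OF A] by blast
  define g where "g = a1 * z1"
  have gT: "g \<in> T" using a12 g_def by simp
  let ?S = "{x + g * r | x r. x \<in> I \<and> r \<in> T}" and ?Q = "{r \<in> T. g * r \<in> I}"
  note DT = sub_ringD[OF T_ring] and DI = sub_modD[OF I(1)]
  show "fin_gen T I"
  proof (rule fin_gen_via_colon[OF T_ring I gT])
    have sS: "sub_mod T ?S"
      unfolding sub_mod_def
    proof (intro conjI ballI)
      show "0 \<in> ?S" using DI(1) DT(1) by force
    next
      fix x y assume "x \<in> ?S" "y \<in> ?S"
      then obtain x1 r1 x2 r2 where "x = x1 + g * r1" "y = x2 + g * r2" "x1 \<in> I" "x2 \<in> I" "r1 \<in> T" "r2 \<in> T"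
        by blast
      moreover from this have "x + y = (x1 + x2) + g * (r1 + r2)" by (simp add: algebra_simps)
      ultimately show "x + y \<in> ?S" using DI(2) DT(3) by blast
    next
      fix c x assume "c \<in> T" "x \<in> ?S"
      then obtain x1 r1 where "x = x1 + g * r1" "x1 \<in> I" "r1 \<in> T" "c \<in> T" by blast
      moreover from this have "c * x = c * x1 + g * (c * r1)" by (simp add: algebra_simps)
      ultimately show "c * x \<in> ?S" using DI(3) DT(4) by blast
    qed
    have "?S \<subseteq> T" using I(2) gT DT(3,4) by blast
    moreover have "g = 0 + g * 1" by simp
    then have "a1 * z1 \<in> ?S" using DI(1) DT(2) unfolding g_def by blast
    ultimately show "fin_gen T ?S" using goodD[OF z(1) sS] a12 by blast
    have sQ: "sub_mod T ?Q"
      unfolding sub_mod_def using DI DT by (auto simp: distrib_left mult.left_commute)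
    have "(a * a2) * z2 \<in> T" using DT(4)[OF AT[OF a(1)] a12(6)] by (simp add: mult.assoc)
    moreover have "(a1 * a2) * (a * (z1 * z2)) \<in> I"
      using DI(3)[OF DT(4)[OF AT AT] a(3)] a12 by blast
    then have "g * ((a * a2) * z2) \<in> I" unfolding g_def by (simp add: mult.assoc mult.left_commute)
    ultimately have "(a * a2) * z2 \<in> ?Q" by blast
    moreover have "?Q \<subseteq> T" by blast
    ultimately show "fin_gen T ?Q" using goodD[OF z(2) sQ] a a12 sub_ringD(4)[OF A] by (metis no_zero_divisors)
  qed
qed

lemma good_const:
  assumes "c \<in> F" "c \<noteq> 0" shows "good c"
  unfolding good_def
proof (intro allI impI)
  fix I assume I: "sub_mod T I" "I \<subseteq> T" and "\<exists>a\<in>A. a \<noteq> 0 \<and> a * c \<in> I"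
  then obtain a where a: "a \<in> A" "a \<noteq> 0" "a * c \<in> I" by blast
  obtain x b where x: "x \<in> A" "b \<in> A" "b \<noteq> 0" "c = x / b" using assms fracsE by blast
  have "b * (a * c) \<in> I" using sub_modD(3)[OF I(1) _ a(3)] subset_tower[OF A] x(2) by blast
  then have "a * x \<in> I" using x by simp
  then show "fin_gen T I"
    using fin_gen_above[OF I, of "a * x"] sub_ringD(4)[OF A a(1) x(1)] a(2) x(4) assms(2) by auto
qed

lemma denominator:
  assumes "f \<in> polys F" shows "\<exists>a\<in>A. a \<noteq> 0 \<and> a * poly f (t m) \<in> T"
  using polys_common_denominator[OF A assms] poly_in_tower[of "Polynomial.smult _ f" A m] by auto

lemma good_power:
  assumes "good (poly g (t m))" "g \<in> polys F" shows "good (poly g (t m) ^ n)"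
proof (induction n)
  case 0
  then show ?case using good_const[of 1] sub_ringD(2)[OF F_ring] by simp
next
  case (Suc n)
  have "g ^ n \<in> polys F" by (rule sub_ring_power[OF sub_ring_polys[OF F_ring] assms(2)])
  then show ?case
    using good_mult[OF assms(1) Suc denominator[OF assms(2)]] denominator[of "g ^ n" m] by (simp add: poly_power)
qed

text \<open>
  If an ideal containing \<open>g(t\<^sub>m)\<close> up to a denominator has an element that is not a multiple of
  \<open>g\<close> over the field of fractions, then by Bezout it meets \<open>A\<close> outside zero; it is here that
  \<open>g\<close> has to be irreducible at the level of that element, which can be arbitrarily high.
  Otherwise the ideal lies between a multiple of \<open>J\<close> and \<open>J\<close>, where \<open>J\<close> is generated by the
  values at \<open>t\<^sub>m\<close> of the multiples of \<open>g\<close> with coefficients in \<open>A\<close>; by the basis theorem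
  finitely many of them suffice.
\<close>

lemma good_persistent:
  assumes g: "irred_over F g" and irr: "\<And>j. irred_over F (psub (p ^ j) g)"
  shows "good (poly g (t m))"
  unfolding good_def
proof (intro allI impI)
  fix I assume I: "sub_mod T I" "I \<subseteq> T" and "\<exists>a\<in>A. a \<noteq> 0 \<and> a * poly g (t m) \<in> I"
  then obtain a where a: "a \<in> A" "a \<noteq> 0" "a * poly g (t m) \<in> I" by blast
  note PF = sub_ring_polys[OF F_ring] and PA = sub_ring_polys[OF A]
  note gF = irred_overD(1)[OF g]
  have AT: "x \<in> A \<Longrightarrow> x \<in> T" for x using subset_tower[OF A] by blast
  have AF: "x \<in> polys A \<Longrightarrow> x \<in> polys F" for x using polys_mono[OF subset_fracs[OF A]] by blast
  show "fin_gen T I"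
  proof (cases "\<exists>c\<in>A. c \<noteq> 0 \<and> c \<in> I")
    case True
    then show ?thesis using fin_gen_above[OF I] by blast
  next
    case False
    \<comment> \<open>The multiples of the given polynomial over the field of fractions that have
      coefficients in the ring, all at the level of that polynomial.\<close>
    define Jp where "Jp = {u \<in> polys A. \<exists>w\<in>polys F. u = g * w}"
    have "sub_mod (polys A) Jp"
      unfolding sub_mod_def
    proof (intro conjI ballI)
      show "0 \<in> Jp" unfolding Jp_def using sub_ringD(1)[OF PA] sub_ringD(1)[OF PF] by force
    next
      fix x y assume "x \<in> Jp" "y \<in> Jp"
      then obtain v w where "x \<in> polys A" "y \<in> polys A" "v \<in> polys F" "w \<in> polys F" "x = g * v" "y = g * w"
        unfolding Jp_def by blast
      moreover from this have "x + y = g * (v + w)" by (simp add: algebra_simps)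
      ultimately show "x + y \<in> Jp"
        unfolding Jp_def using sub_ringD(3)[OF PA] sub_ringD(3)[OF PF] by blast
    next
      fix c x assume c: "c \<in> polys A" "x \<in> Jp"
      then obtain v where "x \<in> polys A" "v \<in> polys F" "x = g * v" unfolding Jp_def by blast
      moreover from this have "c * x = g * (c * v)" by (simp add: algebra_simps)
      ultimately show "c * x \<in> Jp"
        unfolding Jp_def using c(1) AF sub_ringD(4)[OF PA] sub_ringD(4)[OF PF] by blast
    qed
    then obtain G where G: "finite G" "G \<subseteq> Jp" "Jp \<subseteq> lin_span (polys A) G"
      using noethD[OF noeth_polys[OF A noeth_A]] fin_genE unfolding Jp_def
      by (metis (no_types, lifting) mem_Collect_eq subsetI)
    define J where "J = (\<lambda>u. poly u (t m)) ` G"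
    note sJ = sub_mod_lin_span[of T J]
    have "lin_span (polys A) G \<subseteq> {u. poly u (t m) \<in> lin_span T J}"
    proof (rule lin_span_least)
      show "sub_mod (polys A) {u. poly u (t m) \<in> lin_span T J}"
        unfolding sub_mod_def using sub_modD[OF sJ] poly_in_tower[of _ A m] by auto
      show "G \<subseteq> {u. poly u (t m) \<in> lin_span T J}" unfolding J_def by (auto intro: lin_span_incl)
    qed
    then have Jspan: "poly u (t m) \<in> lin_span T J" if "u \<in> Jp" for u using that G(3) by blast
    have IJ: "I \<subseteq> lin_span T J"
    proof
      fix y assume y: "y \<in> I"
      obtain i where i: "\<And>m'. m' \<ge> i \<Longrightarrow>
          \<exists>g s. g \<in> polys A \<and> s \<in> polys C \<and> s \<noteq> 0 \<and> y = poly g (t m') / poly s (t m')"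
        using towerE_above[OF A, of y] y I(2) by blast
      \<comment> \<open>A level at which both the element and the given polynomial can be expressed.\<close>
      define j where "j = max i m - m"
      define q where "q = p ^ j"
      have q: "q > 0" unfolding q_def using p by simp
      have "m + j \<ge> i" unfolding j_def by linarith
      then obtain u s where u: "u \<in> polys A" "s \<in> polys C" "s \<noteq> 0" "y = poly u (t (m + j)) / poly s (t (m + j))"
        using i by blast
      have nz: "poly s (t (m + j)) \<noteq> 0" by (rule transcendental[OF u(2,3)])
      have sT: "poly s (t (m + j)) \<in> T" using poly_in_tower polys_mono[OF CA] u(2) by blast
      have "poly u (t (m + j)) = poly s (t (m + j)) * y" using u nz by simp
      then have uI: "poly u (t (m + j)) \<in> I" using sub_modD(3)[OF I(1) sT y] by simp
      have "\<exists>h. h \<in> polys F \<and> u = psub q g * h"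
      proof (rule ccontr)
        assume "\<nexists>h. h \<in> polys F \<and> u = psub q g * h"
        then obtain v w where vw: "v \<in> polys F" "w \<in> polys F" "v * psub q g + w * u = 1"
          using irred_over_bezout[OF F_field irr[of j] AF[OF u(1)]] unfolding q_def by blast
        obtain b1 where b1: "b1 \<in> A" "b1 \<noteq> 0" "Polynomial.smult b1 v \<in> polys A"
          using polys_common_denominator[OF A vw(1)] by blast
        obtain b2 where b2: "b2 \<in> A" "b2 \<noteq> 0" "Polynomial.smult b2 w \<in> polys A"
          using polys_common_denominator[OF A vw(2)] by blast
        have "poly v (t (m + j)) * poly g (t m) + poly w (t (m + j)) * poly u (t (m + j)) = 1"
          using arg_cong[OF vw(3), of "\<lambda>f. poly f (t (m + j))"] poly_level[of g m j] unfolding q_def by simp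
        then have "a * b1 * b2 * 1 = a * b1 * b2 * (poly v (t (m + j)) * poly g (t m) + poly w (t (m + j)) * poly u (t (m + j)))"
          by simp
        also have "\<dots> = (b2 * poly (Polynomial.smult b1 v) (t (m + j))) * (a * poly g (t m)) +
            (a * b1 * poly (Polynomial.smult b2 w) (t (m + j))) * poly u (t (m + j))"
          by (simp add: algebra_simps)
        also have "\<dots> \<in> I"
          by (intro sub_modD(2)[OF I(1)] sub_modD(3)[OF I(1)] sub_ringD(4)[OF T_ring] AT a b1(1) b2(1) uI poly_in_tower b1(3) b2(3))
        finally have "a * b1 * b2 \<in> I" by simp
        moreover have "a * b1 * b2 \<in> A" "a * b1 * b2 \<noteq> 0" using a b1 b2 sub_ringD(4)[OF A] by auto
        ultimately show False using False by blast
      qed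
      then obtain h where h: "h \<in> polys F" "u = psub q g * h" by blast
      \<comment> \<open>Split by residue classes of exponents, a multiple at the higher level becomes a
        combination of multiples at the original level, each with coefficients in the ring.\<close>
      have us: "u = (\<Sum>i<q. Polynomial.monom 1 i * psub q (g * psect q i h))"
      proof -
        have "u = psub q g * (\<Sum>i<q. Polynomial.monom 1 i * psub q (psect q i h))"
          using h(2) poly_eq_psect_sum[OF q, of h] by simp
        also have "\<dots> = (\<Sum>i<q. Polynomial.monom 1 i * psub q (g * psect q i h))"
          by (simp add: sum_distrib_left mult.left_commute)
        finally show ?thesis .
      qed
      have Jpi: "g * psect q i h \<in> Jp" if "i < q" for i
      proof -
        have "poly.coeff (g * psect q i h) n = poly.coeff u (n * q + i)" for n
          by (subst us) (simp only: coeff_psub_sum[OF that])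
        then have "g * psect q i h \<in> polys A" using polysD[OF u(1)] by (simp add: polys_def)
        moreover have "psect q i h \<in> polys F" using polysD[OF h(1)] by (simp add: polys_def coeff_psect[OF q])
        ultimately show ?thesis unfolding Jp_def by blast
      qed
      have tq: "t (m + j) ^ q = t m" unfolding q_def by (rule t_add)
      have "poly u (t (m + j)) = (\<Sum>i<q. t (m + j) ^ i * poly (g * psect q i h) (t m))"
        by (subst us) (simp add: poly_sum poly_monom poly_psub tq)
      also have "\<dots> \<in> lin_span T J"
        using Jspan[OF Jpi] by (intro sub_mod_sum[OF sJ] sub_modD(3)[OF sJ] sub_ring_power[OF T_ring] t_in_tower[OF A]) auto
      finally have "inverse (poly s (t (m + j))) * poly u (t (m + j)) \<in> lin_span T J"
        using sub_modD(3)[OF sJ inverse_in_tower[OF A u(2,3)]] by blast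
      then show "y \<in> lin_span T J" using u(4) by (simp add: divide_inverse mult.commute)
    qed
    \<comment> \<open>A common denominator of the finitely many cofactors.\<close>
    have "\<exists>b\<in>A. b \<noteq> 0 \<and> (\<forall>u\<in>G. \<exists>w\<in>polys F. u = g * w \<and> Polynomial.smult b w \<in> polys A)"
      using G(1,2)
    proof (induction G rule: finite_induct)
      case empty
      then show ?case using sub_ringD(2)[OF A] by (intro bexI[of _ 1]) auto
    next
      case (insert u G)
      then obtain b where b: "b \<in> A" "b \<noteq> 0"
        "\<And>u. u \<in> G \<Longrightarrow> \<exists>w\<in>polys F. u = g * w \<and> Polynomial.smult b w \<in> polys A" by auto
      obtain w where w: "w \<in> polys F" "u = g * w" using insert.prems unfolding Jp_def by blast
      obtain c where c: "c \<in> A" "c \<noteq> 0" "Polynomial.smult c w \<in> polys A"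
        using polys_common_denominator[OF A w(1)] by blast
      have "\<exists>w\<in>polys F. u' = g * w \<and> Polynomial.smult (b * c) w \<in> polys A" if u': "u' \<in> insert u G" for u'
      proof (cases "u' = u")
        case True
        have "Polynomial.smult (b * c) w = Polynomial.smult b (Polynomial.smult c w)" by simp
        then show ?thesis using True w smult_in_polys[OF A b(1) c(3)] by (intro bexI[of _ w]) auto
      next
        case False
        then obtain v where v: "v \<in> polys F" "u' = g * v" "Polynomial.smult b v \<in> polys A" using b(3) u' by blast
        have "Polynomial.smult (b * c) v = Polynomial.smult c (Polynomial.smult b v)" by (simp add: mult.commute)
        then show ?thesis using v smult_in_polys[OF A c(1) v(3)] by (intro bexI[of _ v]) auto
      qed
      then show ?case using b c sub_ringD(4)[OF A] by (intro bexI[of _ "b * c"]) auto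
    qed
    then obtain b where b: "b \<in> A" "b \<noteq> 0"
      "\<And>u. u \<in> G \<Longrightarrow> \<exists>w\<in>polys F. u = g * w \<and> Polynomial.smult b w \<in> polys A" by blast
    have ab: "a * b \<in> A" "a * b \<noteq> 0" using a b sub_ringD(4)[OF A] by auto
    \<comment> \<open>All coefficient ideals in this application contain a nonzero element of the base ring.\<close>
    show ?thesis
    proof (rule fin_gen_submodule[OF T_ring AT[OF ab(1)] _ _ I(1) IJ])
      show "fin_gen T I'" if "sub_mod T I'" "I' \<subseteq> T" "a * b \<in> I'" for I'
        using fin_gen_above that ab by blast
      show "finite J" using G(1) unfolding J_def by simp
      fix j assume "j \<in> J"
      then obtain u where u: "u \<in> G" "j = poly u (t m)" unfolding J_def by blast
      then obtain w where w: "u = g * w" "Polynomial.smult b w \<in> polys A" using b(3) by blast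
      have e: "a * b * j = poly (Polynomial.smult b w) (t m) * (a * poly g (t m))"
        unfolding u(2) w(1) by (simp add: algebra_simps)
      show "a * b * j \<in> I" unfolding e by (rule sub_modD(3)[OF I(1) poly_in_tower[OF w(2)] a(3)])
    qed
  qed
qed

text \<open>
  Such a value is a unit of the tower.
\<close>

lemma good_constants:
  assumes s: "s \<in> polys C" "s \<noteq> 0" shows "good (poly s (t m))"
  unfolding good_def
proof (intro allI impI)
  fix I assume I: "sub_mod T I" "I \<subseteq> T" and "\<exists>a\<in>A. a \<noteq> 0 \<and> a * poly s (t m) \<in> I"
  then obtain a where a: "a \<in> A" "a \<noteq> 0" "a * poly s (t m) \<in> I" by blast
  have "inverse (poly s (t m)) * (a * poly s (t m)) \<in> I"
    by (rule sub_modD(3)[OF I(1) inverse_in_tower[OF A s] a(3)])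
  moreover have "inverse (poly s (t m)) * (a * poly s (t m)) = a" using transcendental[OF s, of m] by simp
  ultimately have "a \<in> I" by simp
  then show "fin_gen T I" using fin_gen_above[OF I a(1,2)] by blast
qed

text \<open>
  After extracting roots, \<open>f(t\<^sub>m)\<close> is a power of a value, at a higher level, of a polynomial
  that stays irreducible from there on.
\<close>

lemma good_irreducible:
  assumes f: "irred_over F f" "lead_coeff f = 1"
  shows "good (poly f (t m))"
proof (cases "f \<in> polys C")
  case True
  then show ?thesis using good_constants f by force
next
  case False
  then obtain i where i: "poly.coeff f i \<notin> C" by (auto simp: polys_def)
  have "x \<in> C" if "\<And>e. \<exists>y\<in>F. x = y ^ (p ^ e)" for x using infinitely_divisible that by blast
  then obtain e g k where g: "irred_over F g" "lead_coeff g = 1" "Polynomial.degree g = Polynomial.degree f"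
    "psub (p ^ e) f = g ^ (p ^ e)" "poly.coeff g k \<notin> {y ^ p | y. y \<in> F}"
    by (rule frobenius_root[OF p F_field _ f i])
  have "good (poly g (t (m + e)))"
    using good_persistent[OF g(1) irred_over_psub_power[OF p F_field g(1,2,5)]] .
  then have "good (poly g (t (m + e)) ^ (p ^ e))" using good_power irred_overD(1)[OF g(1)] by blast
  moreover have "poly f (t m) = poly g (t (m + e)) ^ (p ^ e)"
    using poly_level[of f m e] g(4) by (simp add: poly_power)
  ultimately show ?thesis by simp
qed

lemma good_poly:
  assumes "f \<in> polys F" "f \<noteq> 0" shows "good (poly f (t m))"
  using assms
proof (induction "Polynomial.degree f" arbitrary: f rule: less_induct)
  case less
  show ?case
  proof (cases "Polynomial.degree f = 0")
    case True
    then obtain c where "f = [:c:]" by (rule degree_eq_zeroE)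
    then show ?thesis using less.prems good_const const_in_polys[OF F_ring] by auto
  next
    case False
    then obtain h w where h: "irred_over F h" "lead_coeff h = 1" "w \<in> polys F" "f = h * w"
      using ex_irred_factor[OF F_field less.prems(1)] by auto
    have nz: "h \<noteq> 0" "w \<noteq> 0" using h less.prems by auto
    then have "Polynomial.degree f = Polynomial.degree h + Polynomial.degree w" using h(4) by (simp add: degree_mult_eq)
    then have "good (poly w (t m))" using less.hyps[of w] h(3) nz irred_overD(2)[OF h(1)] by simp
    then show ?thesis
      using good_mult[OF good_irreducible[OF h(1,2)] _ denominator[OF irred_overD(1)[OF h(1)]] denominator[OF h(3)]] h(4)
      by simp
  qed
qed

theorem noeth_tower: "noeth T"
  unfolding noeth_def
proof (intro allI impI)
  fix I assume I: "I \<subseteq> T" "sub_mod T I"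
  show "fin_gen T I"
  proof (cases "I \<subseteq> {0}")
    case True
    then show ?thesis using fin_genI[of "{}" I T] lin_span_empty[of T] by auto
  next
    case False
    then obtain y where y: "y \<in> I" "y \<noteq> 0" by blast
    then obtain m g s where g: "g \<in> polys A" "s \<in> polys C" "s \<noteq> 0" "y = poly g (t m) / poly s (t m)"
      using I(1) unfolding tower_def by blast
    have sT: "poly s (t m) \<in> T" using poly_in_tower polys_mono[OF CA] g(2) by blast
    have "poly g (t m) = poly s (t m) * y" using g transcendental[OF g(2,3), of m] by simp
    then have "1 * poly g (t m) \<in> I" using sub_modD(3)[OF I(2) sT y(1)] by simp
    moreover have "g \<in> polys F" using polys_mono[OF subset_fracs[OF A]] g(1) by blast
    moreover have "g \<noteq> 0" using y(2) g(4) by auto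
    ultimately show ?thesis using goodD[OF good_poly I(2,1) sub_ringD(2)[OF A] one_neq_zero] by blast
  qed
qed

end

section \<open>Power series in countably many indeterminates\<close>

text \<open>
  Exponents are multisets of indices, so that the well-order of multisets of natural numbers serves
  as a monomial order for which every nonzero series has a least monomial.
\<close>

typedef 'a mps = "UNIV :: (nat multiset \<Rightarrow> 'a) set" morphisms mnth Abs_mps ..

setup_lifting type_definition_mps

lemma mps_eqI: "(\<And>M. mnth f M = mnth g M) \<Longrightarrow> f = g"
  by (simp add: mnth_inject[symmetric] fun_eq_iff)

definition splits :: "nat multiset \<Rightarrow> (nat multiset \<times> nat multiset) set"
  where "splits M = {(P, Q). P + Q = M}"

lemma mem_splits [simp]: "(P, Q) \<in> splits M \<longleftrightarrow> P + Q = M"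
  by (simp add: splits_def)

lemma finite_bounded_multisets: "finite V \<Longrightarrow> finite {M. set_mset M \<subseteq> V \<and> size M \<le> k}"
proof -
  assume "finite V"
  then have "finite (mset ` {xs. set xs \<subseteq> V \<and> length xs \<le> k})"
    by (intro finite_imageI finite_lists_length_le)
  moreover have "{M. set_mset M \<subseteq> V \<and> size M \<le> k} \<subseteq> mset ` {xs. set xs \<subseteq> V \<and> length xs \<le> k}"
  proof
    fix M assume M: "M \<in> {M. set_mset M \<subseteq> V \<and> size M \<le> k}"
    obtain xs where "mset xs = M" using ex_mset by blast
    then show "M \<in> mset ` {xs. set xs \<subseteq> V \<and> length xs \<le> k}"
      using M by (intro image_eqI[of _ _ xs]) auto
  qed
  ultimately show ?thesis by (rule rev_finite_subset)
qed

lemma finite_splits [simp]: "finite (splits M)"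
proof (rule finite_subset)
  let ?B = "{P. set_mset P \<subseteq> set_mset M \<and> size P \<le> size M}"
  show "splits M \<subseteq> ?B \<times> ?B" by (auto simp: splits_def)
  show "finite (?B \<times> ?B)" using finite_bounded_multisets[of "set_mset M"] by simp
qed

instantiation mps :: (comm_ring_1) comm_ring_1
begin

lift_definition zero_mps :: "'a mps" is "\<lambda>M. 0" .
lift_definition one_mps :: "'a mps" is "\<lambda>M. if M = {#} then 1 else 0" .
lift_definition plus_mps :: "'a mps \<Rightarrow> 'a mps \<Rightarrow> 'a mps" is "\<lambda>f g M. f M + g M" .
lift_definition minus_mps :: "'a mps \<Rightarrow> 'a mps \<Rightarrow> 'a mps" is "\<lambda>f g M. f M - g M" .
lift_definition uminus_mps :: "'a mps \<Rightarrow> 'a mps" is "\<lambda>f M. - f M" .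
lift_definition times_mps :: "'a mps \<Rightarrow> 'a mps \<Rightarrow> 'a mps"
  is "\<lambda>f g M. \<Sum>u\<in>splits M. f (fst u) * g (snd u)" .

instance
proof
  fix f g h :: "'a mps"
  show "f * g * h = f * (g * h)"
  proof (rule mps_eqI)
    fix M
    have "mnth (f * g * h) M = (\<Sum>u\<in>splits M. \<Sum>v\<in>splits (fst u). mnth f (fst v) * mnth g (snd v) * mnth h (snd u))"
      by (simp add: times_mps.rep_eq sum_distrib_right)
    also have "\<dots> = (\<Sum>(u,v)\<in>Sigma (splits M) (\<lambda>u. splits (fst u)). mnth f (fst v) * mnth g (snd v) * mnth h (snd u))"
      by (rule sum.Sigma) auto
    also have "\<dots> = (\<Sum>(u,v)\<in>Sigma (splits M) (\<lambda>u. splits (snd u)). mnth f (fst u) * (mnth g (fst v) * mnth h (snd v)))"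
      by (rule sum.reindex_bij_witness[of _
         "\<lambda>(u,v). ((fst u + fst v, snd v), (fst u, fst v))"
         "\<lambda>(u,v). ((fst v, snd v + snd u), (snd v, snd u))"]) (auto simp: ac_simps)
    also have "\<dots> = (\<Sum>u\<in>splits M. \<Sum>v\<in>splits (snd u). mnth f (fst u) * (mnth g (fst v) * mnth h (snd v)))"
      by (rule sum.Sigma[symmetric]) auto
    also have "\<dots> = mnth (f * (g * h)) M" by (simp add: times_mps.rep_eq sum_distrib_left)
    finally show "mnth (f * g * h) M = mnth (f * (g * h)) M" .
  qed
  show "f * g = g * f"
  proof (rule mps_eqI)
    fix M show "mnth (f * g) M = mnth (g * f) M"
      unfolding times_mps.rep_eq
      by (rule sum.reindex_bij_witness[of _ "\<lambda>(a,b). (b,a)" "\<lambda>(a,b). (b,a)"]) (auto simp: ac_simps)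
  qed
  show "1 * f = f"
  proof (rule mps_eqI)
    fix M
    have "mnth (1 * f) M = (\<Sum>u\<in>{({#} :: nat multiset, M)}. (if fst u = {#} then 1 else 0) * mnth f (snd u))"
      unfolding times_mps.rep_eq one_mps.rep_eq by (rule sum.mono_neutral_right) auto
    then show "mnth (1 * f) M = mnth f M" by simp
  qed
  show "(f + g) * h = f * h + g * h"
    by (rule mps_eqI) (simp add: times_mps.rep_eq plus_mps.rep_eq distrib_right sum.distrib)
  have "mnth 0 {#} \<noteq> mnth (1 :: 'a mps) {#}" by (simp add: zero_mps.rep_eq one_mps.rep_eq)
  then show "(0 :: 'a mps) \<noteq> 1" by metis
qed (rule mps_eqI, simp add: plus_mps.rep_eq minus_mps.rep_eq uminus_mps.rep_eq zero_mps.rep_eq algebra_simps)+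

end

lemma mnth_simps [simp]:
  "mnth 0 M = 0" "mnth 1 M = (if M = {#} then 1 else 0)" "mnth (f + g) M = mnth f M + mnth g M"
  "mnth (f - g) M = mnth f M - mnth g M" "mnth (- f) M = - mnth f M"
  by (simp_all add: zero_mps.rep_eq one_mps.rep_eq plus_mps.rep_eq minus_mps.rep_eq uminus_mps.rep_eq)

lemma mnth_mult: "mnth (f * g) M = (\<Sum>u\<in>splits M. mnth f (fst u) * mnth g (snd u))"
  by (simp add: times_mps.rep_eq)

lemma mnth_sum: "mnth (sum f S) M = (\<Sum>i\<in>S. mnth (f i) M)"
  by (induction S rule: infinite_finite_induct) auto

definition mmon :: "nat multiset \<Rightarrow> 'a::comm_ring_1 mps"
  where "mmon M = Abs_mps (\<lambda>N. if N = M then 1 else 0)"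

definition mconst :: "'a::comm_ring_1 \<Rightarrow> 'a mps"
  where "mconst c = Abs_mps (\<lambda>N. if N = {#} then c else 0)"

lemma mnth_mmon: "mnth (mmon M) N = (if N = M then 1 else 0)"
  by (simp add: mmon_def Abs_mps_inverse)

lemma mnth_mconst: "mnth (mconst c) N = (if N = {#} then c else 0)"
  by (simp add: mconst_def Abs_mps_inverse)

lemma mnth_mmon_mult: "mnth (mmon M * f) N = (if M \<subseteq># N then mnth f (N - M) else 0)"
proof (cases "M \<subseteq># N")
  case True
  have "mnth (mmon M * f) N = (\<Sum>u\<in>{(M, N - M)}. mnth (mmon M) (fst u) * mnth f (snd u))"
    unfolding mnth_mult by (rule sum.mono_neutral_right) (use True in \<open>auto simp: mnth_mmon\<close>)
  then show ?thesis using True by (simp add: mnth_mmon)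
next
  case False
  then show ?thesis unfolding mnth_mult by (auto intro!: sum.neutral simp: mnth_mmon)
qed

lemma mnth_mconst_mult [simp]: "mnth (mconst c * f) N = c * mnth f N"
proof -
  have "mnth (mconst c * f) N = (\<Sum>u\<in>{({#} :: nat multiset, N)}. mnth (mconst c) (fst u) * mnth f (snd u))"
    unfolding mnth_mult by (rule sum.mono_neutral_right) (auto simp: mnth_mconst)
  then show ?thesis by (simp add: mnth_mconst)
qed

lemma mmon_add: "mmon (M + N) = mmon M * mmon N"
proof (rule mps_eqI)
  fix L
  have "L = M + N \<longleftrightarrow> M \<subseteq># L \<and> L - M = N" by (auto simp: subset_mset.le_iff_add)
  then show "mnth (mmon (M + N)) L = mnth (mmon M * mmon N) L"
    by (simp add: mnth_mmon_mult mnth_mmon)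
qed

lemma mmon_empty [simp]: "mmon {#} = 1"
  by (rule mps_eqI) (simp add: mnth_mmon)

lemma mconst_hom: "mconst (c + d) = mconst c + mconst d" "mconst (c * d) = mconst c * mconst d"
  "mconst 0 = 0" "mconst 1 = 1"
  by (rule mps_eqI; simp add: mnth_mconst)+

definition mvars :: "nat set \<Rightarrow> 'a::comm_ring_1 mps set"
  where "mvars V = {f. \<forall>M. mnth f M \<noteq> 0 \<longrightarrow> set_mset M \<subseteq> V}"

lemma mvarsD: "f \<in> mvars V \<Longrightarrow> \<not> set_mset M \<subseteq> V \<Longrightarrow> mnth f M = 0"
  unfolding mvars_def by blast

lemma mvarsI: "(\<And>M. \<not> set_mset M \<subseteq> V \<Longrightarrow> mnth f M = 0) \<Longrightarrow> f \<in> mvars V"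
  unfolding mvars_def by blast

lemma mvars_mono: "V \<subseteq> W \<Longrightarrow> mvars V \<subseteq> mvars W"
  unfolding mvars_def by blast

lemma sub_ring_mvars: "sub_ring (mvars V)"
  unfolding sub_ring_def
proof (intro conjI ballI)
  show "0 \<in> mvars V" "1 \<in> mvars V" by (auto simp: mvars_def)
  fix f :: "'a mps" assume f: "f \<in> mvars V"
  show "- f \<in> mvars V" using f by (auto simp: mvars_def)
  fix g :: "'a mps" assume g: "g \<in> mvars V"
  show "f + g \<in> mvars V" by (rule mvarsI) (simp add: mvarsD[OF f] mvarsD[OF g])
  show "f * g \<in> mvars V"
  proof (rule mvarsI)
    fix M assume M: "\<not> set_mset M \<subseteq> V"
    have "mnth f (fst u) * mnth g (snd u) = 0" if "u \<in> splits M" for u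
    proof -
      have "\<not> set_mset (fst u) \<subseteq> V \<or> \<not> set_mset (snd u) \<subseteq> V" using M that by (cases u) auto
      then show ?thesis using mvarsD[OF f, of "fst u"] mvarsD[OF g, of "snd u"] by (metis mult_zero_left mult_zero_right)
    qed
    then show "mnth (f * g) M = 0" unfolding mnth_mult by (intro sum.neutral) auto
  qed
qed

lemma mmon_in_mvars: "set_mset M \<subseteq> V \<Longrightarrow> mmon M \<in> mvars V"
  by (auto simp: mvars_def mnth_mmon)

lemma mconst_in_mvars: "mconst c \<in> mvars V"
  by (auto simp: mvars_def mnth_mconst)

lemma mvars_empty: "mvars {} = (range mconst :: 'a::comm_ring_1 mps set)"
proof
  show "mvars {} \<subseteq> (range mconst :: 'a mps set)"
  proof
    fix f :: "'a mps" assume f: "f \<in> mvars {}"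
    have "f = mconst (mnth f {#})" by (rule mps_eqI) (use mvarsD[OF f] in \<open>auto simp: mnth_mconst\<close>)
    then show "f \<in> range mconst" by blast
  qed
qed (use mconst_in_mvars in auto)

subsection \<open>Leading monomials\<close>

definition lead :: "'a::comm_ring_1 mps \<Rightarrow> nat multiset"
  where "lead f = (LEAST M. mnth f M \<noteq> 0)"

lemma mnth_lead: "f \<noteq> 0 \<Longrightarrow> mnth f (lead f) \<noteq> 0"
proof -
  assume "f \<noteq> 0"
  then obtain M where "mnth f M \<noteq> 0" using mps_eqI[of f 0] by auto
  then show ?thesis unfolding lead_def by (rule LeastI)
qed

lemma lead_le: "mnth f M \<noteq> 0 \<Longrightarrow> lead f \<le> M"
  unfolding lead_def by (rule Least_le)

lemma lead_eqI: "mnth f M \<noteq> 0 \<Longrightarrow> (\<And>N. N < M \<Longrightarrow> mnth f N = 0) \<Longrightarrow> lead f = M"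
  unfolding lead_def by (rule Least_equality) (auto simp: not_less[symmetric])

text \<open>
  Monomials are ordered compatibly with multiplication, so a product of two series has only
  one contribution at the product of the least monomials.
\<close>

lemma add_eq_imp_less_multiset:
  fixes P Q M N :: "nat multiset"
  assumes "P + Q = M + N" "N < Q" shows "P < M"
proof (rule ccontr)
  assume "\<not> P < M"
  then have "M + N < P + Q" using assms(2) by (intro add_le_less_mono) auto
  then show False using assms(1) by simp
qed

lemma mnth_mult_lead: "mnth (f * g) (lead f + lead g) = mnth f (lead f) * mnth g (lead g)"
proof -
  have "mnth f (fst u) * mnth g (snd u) = 0"
    if "u \<in> splits (lead f + lead g) - {(lead f, lead g)}" for u
  proof (rule ccontr)
    assume "mnth f (fst u) * mnth g (snd u) \<noteq> 0"
    then have "lead f \<le> fst u" "lead g \<le> snd u" by (auto intro: lead_le)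
    moreover have e: "fst u + snd u = lead f + lead g" using that by (cases u) auto
    ultimately have "snd u = lead g"
      using add_eq_imp_less_multiset[OF e] by (metis leD order_le_less)
    then show False using e that by (cases u) auto
  qed
  then have "mnth (f * g) (lead f + lead g) = (\<Sum>u\<in>{(lead f, lead g)}. mnth f (fst u) * mnth g (snd u))"
    unfolding mnth_mult by (intro sum.mono_neutral_right) auto
  then show ?thesis by simp
qed

instance mps :: (idom) idom
proof
  fix f g :: "'a mps" assume "f \<noteq> 0" "g \<noteq> 0"
  then have "mnth (f * g) (lead f + lead g) \<noteq> 0" by (simp add: mnth_mult_lead mnth_lead)
  then show "f * g \<noteq> 0" by auto
qed

lemma lead_mult:
  fixes f g :: "'a::idom mps"
  assumes "f \<noteq> 0" "g \<noteq> 0"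
  shows "lead (f * g) = lead f + lead g"
proof (rule lead_eqI)
  show "mnth (f * g) (lead f + lead g) \<noteq> 0" using assms by (simp add: mnth_mult_lead mnth_lead)
  fix N assume N: "N < lead f + lead g"
  have "mnth f (fst u) * mnth g (snd u) = 0" if "u \<in> splits N" for u
  proof (rule ccontr)
    assume "mnth f (fst u) * mnth g (snd u) \<noteq> 0"
    then have "lead f \<le> fst u" "lead g \<le> snd u" by (auto intro: lead_le)
    then have "lead f + lead g \<le> N" using that by (cases u) (auto intro: add_mono)
    then show False using N by simp
  qed
  then show "mnth (f * g) N = 0" unfolding mnth_mult by (intro sum.neutral) auto
qed

lemma lead_power:
  fixes f :: "'a::idom mps"
  assumes "f \<noteq> 0"
  shows "lead (f ^ n) = repeat_mset n (lead f) \<and> mnth (f ^ n) (lead (f ^ n)) = mnth f (lead f) ^ n"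
proof (induction n)
  case 0
  have "lead (1 :: 'a mps) = {#}" by (rule lead_eqI) auto
  then show ?case by simp
next
  case (Suc n)
  have "f ^ n \<noteq> 0" using assms by simp
  then have "lead (f ^ Suc n) = lead f + lead (f ^ n)" using assms by (simp add: lead_mult)
  moreover from this have "mnth (f ^ Suc n) (lead (f ^ Suc n)) = mnth f (lead f) * mnth (f ^ n) (lead (f ^ n))"
    by (simp add: mnth_mult_lead)
  ultimately show ?case using conjunct1[OF Suc] conjunct2[OF Suc] by simp
qed

subsection \<open>Division by a power series\<close>

text \<open>
  The coefficients of the quotient are determined by recursion along the monomial order: in
  \<open>(q a)\<^sub>M\<^sub>+\<^sub>\<mu>\<close> with \<open>\<mu>\<close> the leading exponent of \<open>a\<close>, the coefficient \<open>q\<^sub>M\<close> is multiplied by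
  the leading coefficient and all other \<open>q\<^sub>P\<close> that occur have \<open>P < M\<close>. The remainder \<open>f - q a\<close>
  has no monomial divisible by the leading monomial of \<open>a\<close>.
\<close>

lemma mps_division:
  fixes a f :: "'a::field mps"
  assumes a: "a \<in> mvars V" "a \<noteq> 0" and f: "f \<in> mvars V"
  shows "\<exists>q\<in>mvars V. \<forall>M. mnth (f - q * a) (M + lead a) = 0"
proof -
  let ?\<mu> = "lead a"
  define S where "S M = splits (M + ?\<mu>) - {(M, ?\<mu>)}" for M
  define H where "H q M = (mnth f (M + ?\<mu>) - (\<Sum>u\<in>S M. q (fst u) * mnth a (snd u))) / mnth a ?\<mu>"
    for q :: "nat multiset \<Rightarrow> 'a" and M
  define q where "q \<equiv> wfrec {(M, N). M < N} H"
  have less: "fst u < M" if "u \<in> S M" "mnth a (snd u) \<noteq> 0" for u M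
  proof -
    have e: "fst u + snd u = M + ?\<mu>" "(fst u, snd u) \<noteq> (M, ?\<mu>)"
      using that(1) unfolding S_def by (cases u; auto)+
    have "snd u \<noteq> ?\<mu>" using e by (metis add_right_cancel)
    then have "?\<mu> < snd u" using lead_le[OF that(2)] by simp
    then show ?thesis using add_eq_imp_less_multiset[OF e(1)] by blast
  qed
  have q: "q M = H q M" for M
  proof -
    have "q M = H (cut q {(M, N). M < N} M) M"
      by (rule def_wfrec[OF q_def[THEN meta_eq_to_obj_eq, THEN eq_reflection]]) (rule wf_less_multiset)
    also have "\<dots> = H q M"
    proof -
      have "cut q {(M, N). M < N} M (fst u) * mnth a (snd u) = q (fst u) * mnth a (snd u)" if "u \<in> S M" for u
        using less[OF that] by (cases "mnth a (snd u) = 0") (auto simp: cut_def)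
      then have "(\<Sum>u\<in>S M. cut q {(M, N). M < N} M (fst u) * mnth a (snd u)) = (\<Sum>u\<in>S M. q (fst u) * mnth a (snd u))"
        by (intro sum.cong) auto
      then show ?thesis unfolding H_def by simp
    qed
    finally show ?thesis .
  qed
  define Q where "Q = Abs_mps q"
  have Qq: "mnth Q M = q M" for M unfolding Q_def by (simp add: Abs_mps_inverse)
  have \<mu>V: "set_mset ?\<mu> \<subseteq> V" using mnth_lead[OF a(2)] mvarsD[OF a(1)] by blast
  \<comment> \<open>The same recursion shows that no variables outside the given set enter.\<close>
  have "q M = 0" if "\<not> set_mset M \<subseteq> V" for M
    using that
  proof (induction M rule: wf_induct_rule[OF wf_less_multiset])
    case (1 M)
    have "q (fst u) * mnth a (snd u) = 0" if u: "u \<in> S M" for u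
    proof (cases "mnth a (snd u) = 0")
      case False
      then have "set_mset (snd u) \<subseteq> V" using mvarsD[OF a(1)] by blast
      moreover have "fst u + snd u = M + ?\<mu>" using u unfolding S_def by (cases u) auto
      then have "set_mset (fst u) \<union> set_mset (snd u) = set_mset M \<union> set_mset ?\<mu>" by (metis set_mset_union)
      ultimately have "\<not> set_mset (fst u) \<subseteq> V" using 1(2) by blast
      then show ?thesis using 1(1) less[OF u False] by simp
    qed simp
    moreover have "mnth f (M + ?\<mu>) = 0" using mvarsD[OF f] 1(2) by simp
    ultimately have "H q M = 0" unfolding H_def by (simp add: sum.neutral)
    then show ?case using q by simp
  qed
  then have QV: "Q \<in> mvars V" by (intro mvarsI) (simp add: Qq)
  have "mnth (f - Q * a) (M + ?\<mu>) = 0" for M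
  proof -
    have "mnth (Q * a) (M + ?\<mu>) = q M * mnth a ?\<mu> + (\<Sum>u\<in>S M. q (fst u) * mnth a (snd u))"
      unfolding mnth_mult S_def Qq by (subst sum.remove[of _ "(M, ?\<mu>)"]) auto
    also have "q M * mnth a ?\<mu> = mnth f (M + ?\<mu>) - (\<Sum>u\<in>S M. q (fst u) * mnth a (snd u))"
      using mnth_lead[OF a(2)] by (subst q) (simp add: H_def)
    finally show ?thesis by simp
  qed
  then show ?thesis using QV by blast
qed

text \<open>
  The remainder of the general division has no monomial divisible by \<open>v\<^sup>d\<close>; collecting it by
  powers of \<open>v\<close> gives the coefficients \<open>r i\<close> for \<open>i < d\<close>.
\<close>

lemma weierstrass_division:
  fixes a f :: "'a::field mps"
  assumes a: "a \<in> mvars V" "a \<noteq> 0" "lead a = replicate_mset d v" and v: "v \<in> V" and f: "f \<in> mvars V"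
  shows "\<exists>q\<in>mvars V. \<exists>r. (\<forall>i. r i \<in> mvars (V - {v})) \<and>
    f = q * a + (\<Sum>i<d. mmon (replicate_mset i v) * r i)"
proof -
  obtain q where q: "q \<in> mvars V" "\<And>M. mnth (f - q * a) (M + lead a) = 0"
    using mps_division[OF a(1,2) f] by blast
  let ?g = "f - q * a"
  have g: "?g \<in> mvars V" using sub_ringD(4,6)[OF sub_ring_mvars] a(1) f q(1) by blast
  define r where "r i = Abs_mps (\<lambda>N. if v \<in># N then 0 else mnth ?g (N + replicate_mset i v))" for i
  have rn: "mnth (r i) N = (if v \<in># N then 0 else mnth ?g (N + replicate_mset i v))" for i N
    unfolding r_def by (simp add: Abs_mps_inverse)
  have "r i \<in> mvars (V - {v})" for i
  proof (rule mvarsI)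
    fix M assume "\<not> set_mset M \<subseteq> V - {v}"
    then show "mnth (r i) M = 0" using mvarsD[OF g, of "M + replicate_mset i v"] by (auto simp: rn)
  qed
  moreover have "?g = (\<Sum>i<d. mmon (replicate_mset i v) * r i)"
  proof (rule mps_eqI)
    fix N
    let ?c = "count N v"
    have *: "replicate_mset i v \<subseteq># N \<longleftrightarrow> i \<le> ?c" for i by (metis count_le_replicate_mset_subset_eq)
    have "mnth (mmon (replicate_mset i v) * r i) N = (if i = ?c then mnth ?g N else 0)" for i
    proof (cases "i \<le> ?c")
      case True
      then have sub: "replicate_mset i v \<subseteq># N" using * by blast
      have "v \<in># N - replicate_mset i v \<longleftrightarrow> i < ?c" by (simp add: in_diff_count)
      then show ?thesis using True sub by (auto simp: mnth_mmon_mult rn simp del: mnth_simps)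
    next
      case False
      then show ?thesis using * by (simp add: mnth_mmon_mult del: mnth_simps)
    qed
    then have "mnth (\<Sum>i<d. mmon (replicate_mset i v) * r i) N = (if ?c < d then mnth ?g N else 0)"
      by (simp add: mnth_sum del: mnth_simps)
    also have "\<dots> = mnth ?g N"
    proof (cases "?c < d")
      case False
      then have "replicate_mset d v \<subseteq># N" using * by simp
      then show ?thesis using q(2)[of "N - replicate_mset d v"] False a(3) by simp
    qed simp
    finally show "mnth ?g N = mnth (\<Sum>i<d. mmon (replicate_mset i v) * r i) N" by simp
  qed
  ultimately show ?thesis using q(1)
    by (intro bexI[of _ q] exI[of _ r]) (auto simp: algebra_simps)
qed

subsection \<open>Substitution\<close>

text \<open>
  The monomial with exponent \<open>M\<close> evaluated at \<open>y\<close>.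
\<close>

definition ymon :: "(nat \<Rightarrow> 'a::comm_ring_1 mps) \<Rightarrow> nat multiset \<Rightarrow> 'a mps"
  where "ymon y M = prod_mset (image_mset y M)"

definition bounded_exps :: "nat set \<Rightarrow> nat \<Rightarrow> nat multiset set"
  where "bounded_exps V k = {M. set_mset M \<subseteq> V \<and> size M \<le> k}"

text \<open>
  When the substituted series have no constant term, only monomials of degree at most the size
  of \<open>N\<close> contribute to the coefficient of \<open>N\<close>, which makes the sum finite.
\<close>

definition msubst :: "nat set \<Rightarrow> (nat \<Rightarrow> 'a::comm_ring_1 mps) \<Rightarrow> 'a mps \<Rightarrow> 'a mps"
  where "msubst V y f = Abs_mps (\<lambda>N. \<Sum>M\<in>bounded_exps V (size N). mnth f M * mnth (ymon y M) N)"

definition vanishing :: "nat set \<Rightarrow> (nat \<Rightarrow> 'a::comm_ring_1 mps) \<Rightarrow> bool"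
  where "vanishing V y \<longleftrightarrow> finite V \<and> (\<forall>i\<in>V. mnth (y i) {#} = 0)"

lemma ymon_simps [simp]: "ymon y {#} = 1" "ymon y (add_mset i M) = y i * ymon y M"
  "ymon y (M + N) = ymon y M * ymon y N"
  by (simp_all add: ymon_def)

lemma mmon_add_mset: "mmon (add_mset i M) = mmon {#i#} * mmon M"
  using mmon_add[of "{#i#}" M] by simp

lemma finite_bounded_exps: "finite V \<Longrightarrow> finite (bounded_exps V k)"
  unfolding bounded_exps_def by (rule finite_bounded_multisets)

lemma mnth_ymon_low:
  assumes y: "vanishing V y" and "set_mset M \<subseteq> V" "size N < size M"
  shows "mnth (ymon y M) N = 0"
  using assms(2,3)
proof (induction M arbitrary: N)
  case (add i M)
  have "mnth (y i) (fst u) * mnth (ymon y M) (snd u) = 0" if u: "u \<in> splits N" for u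
  proof (cases "fst u = {#}")
    case True
    then show ?thesis using y add.prems(1) unfolding vanishing_def by simp
  next
    case False
    then have "size (fst u) > 0" by (simp add: nonempty_has_size)
    moreover have "size (fst u) + size (snd u) = size N" using u by (cases u) auto
    ultimately have "size (snd u) < size M" using add.prems(2) by simp
    then show ?thesis using add by simp
  qed
  then show ?case by (simp add: mnth_mult sum.neutral)
qed simp

text \<open>
  The bound on the degree can be enlarged, so that a common one serves for all coefficients in
  a computation.
\<close>

lemma mnth_msubst:
  assumes y: "vanishing V y" and k: "size N \<le> k"
  shows "mnth (msubst V y f) N = (\<Sum>M\<in>bounded_exps V k. mnth f M * mnth (ymon y M) N)"
proof -
  have fin: "finite (bounded_exps V k)" using y finite_bounded_exps unfolding vanishing_def by blast
  have "mnth (msubst V y f) N = (\<Sum>M\<in>bounded_exps V (size N). mnth f M * mnth (ymon y M) N)"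
    unfolding msubst_def by (simp add: Abs_mps_inverse)
  also have "\<dots> = (\<Sum>M\<in>bounded_exps V k. mnth f M * mnth (ymon y M) N)"
  proof (rule sum.mono_neutral_left[OF fin])
    show "bounded_exps V (size N) \<subseteq> bounded_exps V k" using k by (auto simp: bounded_exps_def)
    show "\<forall>M\<in>bounded_exps V k - bounded_exps V (size N). mnth f M * mnth (ymon y M) N = 0"
    proof
      fix M assume "M \<in> bounded_exps V k - bounded_exps V (size N)"
      then have "set_mset M \<subseteq> V" "size N < size M" by (auto simp: bounded_exps_def)
      then show "mnth f M * mnth (ymon y M) N = 0" using mnth_ymon_low[OF y] by simp
    qed
  qed
  finally show ?thesis .
qed

lemma msubst_add: "vanishing V y \<Longrightarrow> msubst V y (f + g) = msubst V y f + msubst V y g"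
  by (rule mps_eqI) (simp add: mnth_msubst[OF _ le_refl] distrib_right sum.distrib)

lemma msubst_mult:
  assumes y: "vanishing V y" and f: "f \<in> mvars V" and g: "g \<in> mvars V"
  shows "msubst V y (f * g) = msubst V y f * msubst V y g"
proof (rule mps_eqI)
  fix N :: "nat multiset"
  define k where "k = size N"
  let ?E = "bounded_exps V k" and ?Y = "ymon y"
  let ?h = "\<lambda>u. mnth f (fst u) * mnth g (snd u) * mnth (?Y (fst u + snd u)) N"
  have fin: "finite ?E" using y finite_bounded_exps unfolding vanishing_def by blast
  have "mnth (msubst V y f * msubst V y g) N
      = (\<Sum>u\<in>splits N. (\<Sum>M\<in>?E. mnth f M * mnth (?Y M) (fst u)) * (\<Sum>M\<in>?E. mnth g M * mnth (?Y M) (snd u)))"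
    unfolding mnth_mult
  proof (rule sum.cong[OF refl])
    fix u assume "u \<in> splits N"
    then have "size (fst u) \<le> k" "size (snd u) \<le> k" unfolding k_def by (cases u; auto)+
    then show "mnth (msubst V y f) (fst u) * mnth (msubst V y g) (snd u) =
        (\<Sum>M\<in>?E. mnth f M * mnth (?Y M) (fst u)) * (\<Sum>M\<in>?E. mnth g M * mnth (?Y M) (snd u))"
      by (simp add: mnth_msubst[OF y])
  qed
  also have "\<dots> = (\<Sum>u\<in>splits N. \<Sum>M\<in>?E. \<Sum>L\<in>?E. mnth f M * mnth g L * (mnth (?Y M) (fst u) * mnth (?Y L) (snd u)))"
    by (simp add: sum_product ac_simps)
  also have "\<dots> = (\<Sum>M\<in>?E. \<Sum>L\<in>?E. \<Sum>u\<in>splits N. mnth f M * mnth g L * (mnth (?Y M) (fst u) * mnth (?Y L) (snd u)))"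
    by (subst sum.swap, rule sum.cong[OF refl], subst sum.swap) simp
  also have "\<dots> = (\<Sum>M\<in>?E. \<Sum>L\<in>?E. ?h (M, L))"
    by (simp add: mnth_mult sum_distrib_left)
  also have "\<dots> = (\<Sum>u\<in>?E \<times> ?E. ?h u)"
    by (simp add: sum.cartesian_product case_prod_unfold)
  \<comment> \<open>Products of monomials whose degree exceeds the bound do not contribute.\<close>
  also have "\<dots> = (\<Sum>u\<in>{u \<in> ?E \<times> ?E. fst u + snd u \<in> ?E}. ?h u)"
  proof (rule sum.mono_neutral_right)
    show "\<forall>u\<in>?E \<times> ?E - {u \<in> ?E \<times> ?E. fst u + snd u \<in> ?E}. ?h u = 0"
    proof
      fix u assume u: "u \<in> ?E \<times> ?E - {u \<in> ?E \<times> ?E. fst u + snd u \<in> ?E}"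
      then have "set_mset (fst u + snd u) \<subseteq> V" "size N < size (fst u + snd u)"
        unfolding bounded_exps_def k_def by auto
      then have "mnth (?Y (fst u + snd u)) N = 0" using mnth_ymon_low[OF y] by blast
      then show "?h u = 0" by (simp only: mult_zero_right)
    qed
  qed (use fin in auto)
  also have "\<dots> = (\<Sum>(L,u)\<in>Sigma ?E splits. mnth f (fst u) * mnth g (snd u) * mnth (?Y L) N)"
    by (rule sum.reindex_bij_witness[of _ snd "\<lambda>u. (fst u + snd u, u)"])
      (auto simp: bounded_exps_def subset_iff)
  also have "\<dots> = (\<Sum>L\<in>?E. \<Sum>u\<in>splits L. mnth f (fst u) * mnth g (snd u) * mnth (?Y L) N)"
    by (rule sum.Sigma[symmetric]) (use fin in auto)
  also have "\<dots> = mnth (msubst V y (f * g)) N"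
    by (simp add: mnth_msubst[OF y, of N k] k_def mnth_mult[of f g] sum_distrib_right)
  finally show "mnth (msubst V y (f * g)) N = mnth (msubst V y f * msubst V y g) N" by simp
qed

lemma msubst_mmon:
  assumes y: "vanishing V y" and M: "set_mset M \<subseteq> V"
  shows "msubst V y (mmon M) = ymon y M"
proof (rule mps_eqI)
  fix N :: "nat multiset"
  let ?k = "max (size N) (size M)"
  have fin: "finite (bounded_exps V ?k)" using y finite_bounded_exps unfolding vanishing_def by blast
  have "mnth (msubst V y (mmon M)) N = (\<Sum>L\<in>bounded_exps V ?k. if L = M then mnth (ymon y M) N else 0)"
    unfolding mnth_msubst[OF y max.cobounded1[of "size N" "size M"]]
    by (rule sum.cong) (auto simp: mnth_mmon)
  also have "\<dots> = mnth (ymon y M) N" using M fin by (simp add: bounded_exps_def)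
  finally show "mnth (msubst V y (mmon M)) N = mnth (ymon y M) N" .
qed

lemma msubst_mconst: "vanishing V y \<Longrightarrow> msubst V y (mconst c) = mconst c"
proof (rule mps_eqI)
  fix N :: "nat multiset" assume y: "vanishing V y"
  have fin: "finite (bounded_exps V (size N))" using y finite_bounded_exps unfolding vanishing_def by blast
  have "mnth (msubst V y (mconst c)) N = (\<Sum>L\<in>bounded_exps V (size N). if L = {#} then c * mnth (ymon y {#}) N else 0)"
    unfolding mnth_msubst[OF y le_refl] by (rule sum.cong) (auto simp: mnth_mconst)
  also have "\<dots> = mnth (mconst c) N" using fin by (simp add: bounded_exps_def mnth_mconst)
  finally show "mnth (msubst V y (mconst c)) N = mnth (mconst c) N" .
qed

lemma ymon_in_mvars:
  assumes "\<And>i. i \<in> V \<Longrightarrow> y i \<in> mvars W" "set_mset M \<subseteq> V"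
  shows "ymon y M \<in> mvars W"
  using assms(2) by (induction M) (auto simp: sub_ringD[OF sub_ring_mvars] assms(1))

lemma msubst_in_mvars:
  assumes "\<And>i. i \<in> V \<Longrightarrow> y i \<in> mvars W"
  shows "msubst V y f \<in> mvars W"
proof (rule mvarsI)
  fix N assume N: "\<not> set_mset N \<subseteq> W"
  have "mnth (ymon y M) N = 0" if "M \<in> bounded_exps V (size N)" for M
    using mvarsD[OF ymon_in_mvars[of V y W M] N] assms that unfolding bounded_exps_def by auto
  then show "mnth (msubst V y f) N = 0" unfolding msubst_def by (simp add: Abs_mps_inverse)
qed

text \<open>
  It suffices that the substitutions cancel on the variables: the composite then fixes all
  monomials, and the coefficient of \<open>N\<close> involves finitely many of them.
\<close>

lemma msubst_msubst:
  assumes y: "vanishing V y" "\<And>i. i \<in> V \<Longrightarrow> y i \<in> mvars V" and z: "vanishing V z"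
    and inv: "\<And>i. i \<in> V \<Longrightarrow> msubst V z (y i) = mmon {#i#}" and f: "f \<in> mvars V"
  shows "msubst V z (msubst V y f) = f"
proof (rule mps_eqI)
  fix N :: "nat multiset"
  let ?E = "bounded_exps V (size N)"
  have fin: "finite ?E" using y finite_bounded_exps unfolding vanishing_def by blast
  have zy: "msubst V z (ymon y L) = mmon L" if "set_mset L \<subseteq> V" for L
    using that
  proof (induction L)
    case empty
    then show ?case using msubst_mconst[OF z, of 1] by (simp add: mconst_hom)
  next
    case (add i L)
    then have "ymon y L \<in> mvars V" using ymon_in_mvars[OF y(2)] by auto
    then have "msubst V z (ymon y (add_mset i L)) = msubst V z (y i) * msubst V z (ymon y L)"
      using add.prems y(2) by (simp add: msubst_mult[OF z])
    also have "\<dots> = mmon {#i#} * mmon L" using add inv by simp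
    also have "\<dots> = mmon (add_mset i L)" by (rule mmon_add_mset[symmetric])
    finally show ?case .
  qed
  have "mnth (msubst V z (msubst V y f)) N
      = (\<Sum>M\<in>?E. (\<Sum>L\<in>?E. mnth f L * mnth (ymon y L) M) * mnth (ymon z M) N)"
    unfolding mnth_msubst[OF z le_refl]
    by (rule sum.cong) (auto simp: mnth_msubst[OF y(1), of _ "size N"] bounded_exps_def)
  also have "\<dots> = (\<Sum>M\<in>?E. \<Sum>L\<in>?E. mnth f L * (mnth (ymon y L) M * mnth (ymon z M) N))"
    by (simp add: sum_distrib_right mult.assoc)
  also have "\<dots> = (\<Sum>L\<in>?E. \<Sum>M\<in>?E. mnth f L * (mnth (ymon y L) M * mnth (ymon z M) N))"
    by (rule sum.swap)
  also have "\<dots> = (\<Sum>L\<in>?E. mnth f L * (\<Sum>M\<in>?E. mnth (ymon y L) M * mnth (ymon z M) N))"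
    by (simp add: sum_distrib_left)
  also have "\<dots> = (\<Sum>L\<in>?E. mnth f L * mnth (mmon L) N)"
  proof (rule sum.cong[OF refl])
    fix L assume "L \<in> ?E"
    then have "set_mset L \<subseteq> V" by (simp add: bounded_exps_def)
    then show "mnth f L * (\<Sum>M\<in>?E. mnth (ymon y L) M * mnth (ymon z M) N) = mnth f L * mnth (mmon L) N"
      using mnth_msubst[OF z le_refl, of "ymon y L" N] zy by simp
  qed
  also have "\<dots> = (\<Sum>L\<in>?E. if L = N then mnth f N else 0)"
    by (rule sum.cong) (auto simp: mnth_mmon)
  also have "\<dots> = mnth f N"
    using fin mvarsD[OF f, of N] by (auto simp: bounded_exps_def)
  finally show "mnth (msubst V z (msubst V y f)) N = mnth f N" .
qed

subsection \<open>Making a power series regular in one variable\<close>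

text \<open>
  Setting all variables other than \<open>v\<close> to zero turns \<open>f\<close> into the \<open>e\<close>-th power of \<open>v\<close>.
\<close>

definition axis_power :: "nat \<Rightarrow> 'a::comm_ring_1 mps \<Rightarrow> nat \<Rightarrow> bool"
  where "axis_power v f e \<longleftrightarrow> (\<forall>i. mnth f (replicate_mset i v) = (if i = e then 1 else 0))"

lemma axis_power_mult:
  assumes "axis_power v f d" "axis_power v g e"
  shows "axis_power v (f * g) (d + e)"
  unfolding axis_power_def
proof
  fix i
  have "mnth (f * g) (replicate_mset i v)
      = (\<Sum>u\<in>(if i = d + e then {(replicate_mset d v, replicate_mset e v)} else {}). mnth f (fst u) * mnth g (snd u))"
    unfolding mnth_mult
  proof (rule sum.mono_neutral_right)
    show "\<forall>u\<in>splits (replicate_mset i v) - (if i = d + e then {(replicate_mset d v, replicate_mset e v)} else {}).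
        mnth f (fst u) * mnth g (snd u) = 0"
    proof
      fix u assume u: "u \<in> splits (replicate_mset i v) - (if i = d + e then {(replicate_mset d v, replicate_mset e v)} else {})"
      then have s: "fst u + snd u = replicate_mset i v" by (cases u) auto
      then have "fst u \<subseteq># replicate_mset i v" "snd u \<subseteq># replicate_mset i v"
        by (metis mset_subset_eq_add_left, metis mset_subset_eq_add_right)
      then obtain a b where ab: "fst u = replicate_mset a v" "snd u = replicate_mset b v"
        by (auto elim!: msubseteq_replicate_msetE)
      then have "i = a + b" using arg_cong[OF s, of size] by simp
      then have "a \<noteq> d \<or> b \<noteq> e" using u ab by (cases u) auto
      then show "mnth f (fst u) * mnth g (snd u) = 0" using assms ab unfolding axis_power_def by auto
    qed
  qed (auto simp: multiset_eq_iff)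
  then show "mnth (f * g) (replicate_mset i v) = (if i = d + e then 1 else 0)"
    using assms unfolding axis_power_def by auto
qed

text \<open>
  With weights growing fast enough, the largest index at which the exponents differ outweighs
  all smaller ones, so that the weight is compatible with the monomial order above \<open>M\<close>.
\<close>

lemma weight_less:
  fixes e :: "nat \<Rightarrow> nat"
  assumes V: "finite V" and M: "set_mset M \<subseteq> V" "set_mset N \<subseteq> V" and less: "M < N"
    and e: "\<And>i j. i \<in> V \<Longrightarrow> j \<in> V \<Longrightarrow> j < i \<Longrightarrow> (size M + 1) * e j \<le> e i" "\<And>i. i \<in> V \<Longrightarrow> e i > 0"
  shows "(\<Sum>i\<in>V. count M i * e i) < (\<Sum>i\<in>V. count N i * e i)"
proof -
  define D where "D = {i. count M i \<noteq> count N i}"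
  have "D \<subseteq> V" using M unfolding D_def by (auto simp: not_in_iff) (metis not_in_iff subsetD)
  then have fD: "finite D" using V finite_subset by blast
  have "D \<noteq> {}"
  proof
    assume "D = {}"
    then have "M = N" unfolding D_def by (intro multiset_eqI) auto
    then show False using less by simp
  qed
  define i where "i = Max D"
  have i: "i \<in> D" "\<And>j. j > i \<Longrightarrow> count M j = count N j"
    using Max_in[OF fD \<open>D \<noteq> {}\<close>] Max_ge[OF fD] unfolding i_def D_def
    by (auto simp: not_less[symmetric])
  have iV: "i \<in> V" using i \<open>D \<subseteq> V\<close> by blast
  have ci: "count M i < count N i"
  proof (rule ccontr)
    assume "\<not> count M i < count N i"
    then have "count N i < count M i" using i(1) unfolding D_def by simp
    then obtain j where "j > i" "count M j < count N j" using less unfolding less_multiset\<^sub>H\<^sub>O by blast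
    then show False using i(2) by simp
  qed
  let ?L = "{j \<in> V. j < i}" and ?U = "{j \<in> V. j > i}"
  have split: "(\<Sum>j\<in>V. f j) = (\<Sum>j\<in>?L. f j) + f i + (\<Sum>j\<in>?U. f j)" for f :: "nat \<Rightarrow> nat"
  proof -
    have "(\<Sum>j\<in>V. f j) = (\<Sum>j\<in>?L \<union> insert i ?U. f j)"
      by (rule sum.cong) (use iV in auto)
    also have "\<dots> = (\<Sum>j\<in>?L. f j) + (\<Sum>j\<in>insert i ?U. f j)" by (rule sum.union_disjoint) (use V in \<open>simp_all add: disjoint_iff\<close>)
    also have "(\<Sum>j\<in>insert i ?U. f j) = f i + (\<Sum>j\<in>?U. f j)" by (rule sum.insert) (use V in simp_all)
    finally show ?thesis by (simp only: add.assoc)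
  qed
  have "(size M + 1) * (\<Sum>j\<in>?L. count M j * e j) = (\<Sum>j\<in>?L. count M j * ((size M + 1) * e j))"
    by (simp only: sum_distrib_left mult.left_commute)
  also have "\<dots> \<le> (\<Sum>j\<in>?L. count M j * e i)" using e(1) iV by (intro sum_mono mult_le_mono2) auto
  also have "\<dots> = (\<Sum>j\<in>?L. count M j) * e i" by (simp add: sum_distrib_right)
  also have "\<dots> \<le> size M * e i"
  proof (rule mult_le_mono1)
    have "(\<Sum>j\<in>?L. count M j) \<le> (\<Sum>j\<in>V. count M j)" using V by (intro sum_mono2) auto
    also have "\<dots> = size M"
      unfolding size_multiset_overloaded_eq
      by (rule sum.mono_neutral_right[OF V M(1)]) (auto simp: not_in_iff)
    finally show "(\<Sum>j\<in>?L. count M j) \<le> size M" .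
  qed
  also have "\<dots> < (size M + 1) * e i" using e(2)[OF iV] by simp
  finally have low: "(\<Sum>j\<in>?L. count M j * e j) < e i" by (metis mult_less_cancel1)
  have "(\<Sum>j\<in>V. count M j * e j) < (count M i + 1) * e i + (\<Sum>j\<in>?U. count M j * e j)"
    unfolding split using low by (simp add: algebra_simps)
  also have "(\<Sum>j\<in>?U. count M j * e j) = (\<Sum>j\<in>?U. count N j * e j)" using i(2) by (intro sum.cong) auto
  also have "(count M i + 1) * e i \<le> count N i * e i" using ci by (intro mult_le_mono1) simp
  finally show ?thesis unfolding split[of "\<lambda>j. count N j * e j"] by linarith
qed

text \<open>
  The substitution that adds \<open>v\<close> to the power \<open>e i\<close> to the \<open>i\<close>-th variable and fixes the
  smallest variable \<open>v\<close> is inverted by subtracting the same powers. On the axis of \<open>v\<close> a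
  monomial becomes the power of \<open>v\<close> given by its weight, and for rapidly growing \<open>e\<close> the least
  monomial of \<open>a\<close> has a smaller weight than all others. So \<open>a\<close> does not vanish on this axis,
  and since \<open>v\<close> is the smallest variable, the first power of \<open>v\<close> that occurs is the leading
  monomial.
\<close>

lemma coordinate_change:
  fixes a :: "'a::field mps"
  assumes V: "finite V" "V \<noteq> {}" and a: "a \<in> mvars V" "a \<noteq> 0"
  obtains y z d where "vanishing V y" "vanishing V z"
    "\<And>i. i \<in> V \<Longrightarrow> y i \<in> mvars V" "\<And>i. i \<in> V \<Longrightarrow> z i \<in> mvars V"
    "\<And>f. f \<in> mvars V \<Longrightarrow> msubst V z (msubst V y f) = f" "\<And>f. f \<in> mvars V \<Longrightarrow> msubst V y (msubst V z f) = f"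
    "msubst V y a \<noteq> 0" "lead (msubst V y a) = replicate_mset d (Min V)"
proof -
  define v where "v = Min V"
  have v: "v \<in> V" "\<And>i. i \<in> V \<Longrightarrow> v \<le> i" using V unfolding v_def by auto
  let ?\<mu> = "lead a"
  have \<mu>V: "set_mset ?\<mu> \<subseteq> V" using mnth_lead[OF a(2)] mvarsD[OF a(1)] by blast
  define D where "D = size ?\<mu> + 1"
  \<comment> \<open>With this base the weights grow as fast as the comparison of weights requires.\<close>
  define e where "e i = D ^ (i - v)" for i
  have e0: "e i > 0" for i unfolding e_def D_def by simp
  have eV: "D * e j \<le> e i" if "i \<in> V" "j \<in> V" "j < i" for i j
  proof -
    have "D ^ Suc (j - v) \<le> D ^ (i - v)" using that v(2)[of j] by (intro power_increasing) (auto simp: D_def)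
    then show ?thesis unfolding e_def by simp
  qed
  define y :: "nat \<Rightarrow> 'a mps" where "y i = (if i = v then mmon {#v#} else mmon {#i#} + mmon (replicate_mset (e i) v))" for i
  define z :: "nat \<Rightarrow> 'a mps" where "z i = (if i = v then mmon {#v#} else mmon {#i#} - mmon (replicate_mset (e i) v))" for i
  have e_ne: "e i \<noteq> 0" for i using e0[of i] by simp
  have van: "vanishing V y" "vanishing V z"
    unfolding vanishing_def y_def z_def using V by (auto simp: mnth_mmon e_ne)
  have rep: "set_mset (replicate_mset k v) \<subseteq> V" for k using v(1) by (auto split: if_splits)
  have yV: "y i \<in> mvars V" "z i \<in> mvars V" if "i \<in> V" for i
    unfolding y_def z_def using that v(1) rep
    by (auto intro!: mmon_in_mvars sub_ringD(3,6)[OF sub_ring_mvars] simp del: set_mset_replicate_mset_subset)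
  have yrep: "ymon y (replicate_mset k v) = mmon (replicate_mset k v)" "ymon z (replicate_mset k v) = mmon (replicate_mset k v)" for k
  proof (induction k)
    case (Suc k)
    { case 1 show ?case using Suc(1) by (simp add: y_def mmon_add_mset[of v "replicate_mset k v"]) }
    { case 2 show ?case using Suc(2) by (simp add: z_def mmon_add_mset[of v "replicate_mset k v"]) }
  qed auto
  have msubst_diff: "msubst V w (f - g) = msubst V w f - msubst V w g" if "vanishing V w" for w and f g :: "'a mps"
    using msubst_add[OF that, of "f - g" g] by simp
  have "msubst V z (y i) = mmon {#i#}" if "i \<in> V" for i
  proof (cases "i = v")
    case True
    then show ?thesis using msubst_mmon[OF van(2), of "{#v#}"] v(1) by (simp add: y_def z_def)
  next
    case False
    then show ?thesis using that v(1) rep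
      by (simp add: y_def msubst_add[OF van(2)] msubst_mmon[OF van(2)] yrep del: set_mset_replicate_mset_subset)
        (simp add: z_def)
  qed
  then have zy: "msubst V z (msubst V y f) = f" if "f \<in> mvars V" for f
    using msubst_msubst[OF van(1) yV(1) van(2) _ that] by blast
  have "msubst V y (z i) = mmon {#i#}" if "i \<in> V" for i
  proof (cases "i = v")
    case True
    then show ?thesis using msubst_mmon[OF van(1), of "{#v#}"] v(1) by (simp add: y_def z_def)
  next
    case False
    then show ?thesis using that v(1) rep
      by (simp add: z_def msubst_diff[OF van(1)] msubst_mmon[OF van(1)] yrep del: set_mset_replicate_mset_subset)
        (simp add: y_def)
  qed
  then have yz: "msubst V y (msubst V z f) = f" if "f \<in> mvars V" for f
    using msubst_msubst[OF van(2) yV(2) van(1) _ that] by blast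
  \<comment> \<open>The exponent of the power to which a monomial restricts on the axis.\<close>
  define w where "w M = (\<Sum>i\<in>V. count M i * e i)" for M
  have ev: "e v = 1" unfolding e_def by simp
  have axis_y: "axis_power v (y i) (e i)" for i
  proof -
    have "replicate_mset k v \<noteq> {#i#}" if "i \<noteq> v" for k
    proof
      assume "replicate_mset k v = {#i#}"
      then have "count (replicate_mset k v) i = count {#i#} i" by (rule arg_cong)
      then show False using that by simp
    qed
    moreover have "replicate_mset k v = {#v#} \<longleftrightarrow> k = 1" for k
      using replicate_mset_eq_iff[of k v 1 v] by simp
    ultimately show ?thesis
      unfolding axis_power_def y_def using ev by (simp add: mnth_mmon replicate_mset_eq_iff)
  qed
  have wy: "axis_power v (ymon y M) (w M) \<and> size M \<le> w M" if "set_mset M \<subseteq> V" for M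
    using that
  proof (induction M)
    case empty
    then show ?case by (auto simp: axis_power_def w_def)
  next
    case (add i M)
    have "w (add_mset i M) = (\<Sum>j\<in>V. (if j = i then e i else 0) + count M j * e j)"
      unfolding w_def by (rule sum.cong) auto
    also have "\<dots> = e i + w M" using add.prems V(1) by (simp add: sum.distrib w_def)
    finally have "w (add_mset i M) = e i + w M" .
    then show ?case using axis_power_mult[OF axis_y[of i]] add e0[of i] by auto
  qed
  define d where "d = w ?\<mu>"
  have wl: "d < w M" if "mnth a M \<noteq> 0" "M \<noteq> ?\<mu>" for M
  proof -
    have "?\<mu> < M" using lead_le[OF that(1)] that(2) by simp
    moreover have "set_mset M \<subseteq> V" using that mvarsD[OF a(1)] by blast
    ultimately show ?thesis unfolding d_def w_def
      using weight_less[OF V(1) \<mu>V, of M e] eV e0 unfolding D_def by blast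
  qed
  have axis: "mnth (msubst V y a) (replicate_mset i v) = (if i = d then mnth a ?\<mu> else 0)" if "i \<le> d" for i
  proof -
    have fin: "finite (bounded_exps V i)" using V finite_bounded_exps by blast
    have "mnth (msubst V y a) (replicate_mset i v) = (\<Sum>M\<in>bounded_exps V i. mnth a M * mnth (ymon y M) (replicate_mset i v))"
      by (rule mnth_msubst[OF van(1)]) simp
    also have "\<dots> = (\<Sum>M\<in>bounded_exps V i. if M = ?\<mu> then (if i = d then mnth a ?\<mu> else 0) else 0)"
    proof (rule sum.cong[OF refl])
      fix M assume M: "M \<in> bounded_exps V i"
      then have "mnth (ymon y M) (replicate_mset i v) = (if i = w M then 1 else 0)"
        using wy[of M] unfolding bounded_exps_def axis_power_def by blast
      then show "mnth a M * mnth (ymon y M) (replicate_mset i v) = (if M = ?\<mu> then (if i = d then mnth a ?\<mu> else 0) else 0)"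
        using wl[of M] that by (cases "M = ?\<mu>"; cases "mnth a M = 0") (auto simp: d_def)
    qed
    also have "\<dots> = (if i = d then mnth a ?\<mu> else 0)"
      using fin \<mu>V wy[OF \<mu>V] by (auto simp: bounded_exps_def d_def)
    finally show ?thesis .
  qed
  have nz: "mnth (msubst V y a) (replicate_mset d v) \<noteq> 0" using axis[of d] mnth_lead[OF a(2)] by simp
  have "lead (msubst V y a) = replicate_mset d v"
  proof (rule lead_eqI[OF nz])
    fix N assume N: "N < replicate_mset d v"
    show "mnth (msubst V y a) N = 0"
    proof (cases "set_mset N \<subseteq> {v}")
      case True
      then obtain i where i: "N = replicate_mset i v" by (metis set_mset_subset_singletonD)
      have "i < d"
      proof (rule ccontr)
        assume "\<not> i < d"
        then have "replicate_mset d v \<subseteq># N" using i by (simp add: replicate_mset_msubseteq_iff)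
        then have "replicate_mset d v \<le> N" by (rule subset_eq_imp_le_multiset)
        then show False using N by simp
      qed
      then show ?thesis using axis[of i] i by simp
    next
      case False
      \<comment> \<open>An exponent below a power of the smallest variable that involves another index
        involves one outside the set of variables.\<close>
      have "\<not> set_mset N \<subseteq> V"
      proof
        assume NV: "set_mset N \<subseteq> V"
        obtain j where j: "j \<in># N" "j \<noteq> v" using False by blast
        then have "v < j" using v(2) NV by (metis le_neq_implies_less subsetD)
        have "count (replicate_mset d v) j < count N j" using j by simp
        then obtain k where "k > j" "count N k < count (replicate_mset d v) k"
          using N unfolding less_multiset\<^sub>H\<^sub>O by blast
        then show False using \<open>v < j\<close> by (auto split: if_splits)
      qed
      then show ?thesis using mvarsD[OF msubst_in_mvars[of V y V]] yV(1) by blast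
    qed
  qed
  moreover have "msubst V y a \<noteq> 0" using nz by auto
  ultimately show ?thesis using that[OF van yV zy yz] unfolding v_def by blast
qed

section \<open>Power series rings with all \<open>p\<close>-power roots of an indeterminate\<close>

locale series_tower = perfect_tower p t C for p and t :: "nat \<Rightarrow> 'u::field" and C +
  fixes \<kappa> :: "'l::field \<Rightarrow> 'u"
  assumes \<kappa>: "range \<kappa> = C"
begin

text \<open>
  Embeddings are used instead of subrings because a change of coordinates keeps the image and
  changes the embedding.
\<close>

definition embeds :: "nat set \<Rightarrow> ('l mps \<Rightarrow> 'u) \<Rightarrow> bool"
  where "embeds V \<psi> \<longleftrightarrow> (\<forall>f\<in>mvars V. \<forall>g\<in>mvars V. \<psi> (f + g) = \<psi> f + \<psi> g \<and> \<psi> (f * g) = \<psi> f * \<psi> g) \<and>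
    (\<forall>f\<in>mvars V. \<psi> f = 0 \<longrightarrow> f = 0) \<and> (\<forall>c. \<psi> (mconst c) = \<kappa> c)"

lemma embedsD:
  assumes e: "embeds V \<psi>"
  shows "f \<in> mvars V \<Longrightarrow> g \<in> mvars V \<Longrightarrow> \<psi> (f + g) = \<psi> f + \<psi> g"
    "f \<in> mvars V \<Longrightarrow> g \<in> mvars V \<Longrightarrow> \<psi> (f * g) = \<psi> f * \<psi> g"
    "f \<in> mvars V \<Longrightarrow> \<psi> f = 0 \<longleftrightarrow> f = 0" "\<psi> (mconst c) = \<kappa> c" "\<psi> 0 = 0" "\<psi> 1 = 1"
    "f \<in> mvars V \<Longrightarrow> g \<in> mvars V \<Longrightarrow> \<psi> (f - g) = \<psi> f - \<psi> g"
    "f \<in> mvars V \<Longrightarrow> \<psi> (f ^ n) = \<psi> f ^ n"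
    "(\<And>i. i \<in> S \<Longrightarrow> h i \<in> mvars V) \<Longrightarrow> \<psi> (sum h S) = (\<Sum>i\<in>S. \<psi> (h i))"
proof -
  note D = sub_ringD[OF sub_ring_mvars[of V]]
  show add: "f \<in> mvars V \<Longrightarrow> g \<in> mvars V \<Longrightarrow> \<psi> (f + g) = \<psi> f + \<psi> g" for f g
    using e unfolding embeds_def by blast
  show mult: "f \<in> mvars V \<Longrightarrow> g \<in> mvars V \<Longrightarrow> \<psi> (f * g) = \<psi> f * \<psi> g" for f g
    using e unfolding embeds_def by blast
  have "\<psi> 0 = \<psi> 0 + \<psi> 0" using add[OF D(1) D(1)] by (simp only: add_0_left)
  then show zero: "\<psi> 0 = 0" by (metis add_cancel_right_right)
  show inj: "f \<in> mvars V \<Longrightarrow> \<psi> f = 0 \<longleftrightarrow> f = 0" for f using e zero unfolding embeds_def by auto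
  show "\<psi> (mconst c) = \<kappa> c" using e unfolding embeds_def by blast
  show one: "\<psi> 1 = 1" using mult[of 1 1] inj[of 1] D(2) by simp
  show "\<psi> (f - g) = \<psi> f - \<psi> g" if "f \<in> mvars V" "g \<in> mvars V"
    using add[OF D(6)[OF that] that(2)] by (simp add: eq_diff_eq)
  show "f \<in> mvars V \<Longrightarrow> \<psi> (f ^ n) = \<psi> f ^ n"
    by (induction n) (auto simp: one mult sub_ring_power[OF sub_ring_mvars])
  show "(\<And>i. i \<in> S \<Longrightarrow> h i \<in> mvars V) \<Longrightarrow> \<psi> (sum h S) = (\<Sum>i\<in>S. \<psi> (h i))"
    by (induction S rule: infinite_finite_induct) (auto simp: zero add sub_ring_sum[OF sub_ring_mvars])
qed

lemma embeds_subset: "embeds V \<psi> \<Longrightarrow> W \<subseteq> V \<Longrightarrow> embeds W \<psi>"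
  using mvars_mono[of W V] unfolding embeds_def by blast

lemma sub_ring_embeds:
  assumes e: "embeds V \<psi>"
  shows "sub_ring (\<psi> ` mvars V)"
  unfolding sub_ring_def
proof (intro conjI ballI)
  note D = sub_ringD[OF sub_ring_mvars[of V]] and E = embedsD[OF e]
  show "0 \<in> \<psi> ` mvars V" "1 \<in> \<psi> ` mvars V" using D(1,2) E(5,6) by (metis image_eqI)+
  fix x assume x: "x \<in> \<psi> ` mvars V"
  then obtain f where f: "f \<in> mvars V" "x = \<psi> f" by blast
  have "- x = \<psi> (0 - f)" using E(7)[OF D(1) f(1)] E(5) f(2) by simp
  then show "- x \<in> \<psi> ` mvars V" using D(6)[OF D(1) f(1)] by blast
  fix y assume "y \<in> \<psi> ` mvars V"
  then obtain g where g: "g \<in> mvars V" "y = \<psi> g" by blast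
  have "x + y = \<psi> (f + g)" "x * y = \<psi> (f * g)" using E(1,2) f g by simp_all
  then show "x + y \<in> \<psi> ` mvars V" "x * y \<in> \<psi> ` mvars V" using D(3,4)[OF f(1) g(1)] by blast+
qed

lemma constants_embeds: "embeds V \<psi> \<Longrightarrow> C \<subseteq> \<psi> ` mvars V"
  unfolding \<kappa>[symmetric] using embedsD(4) mconst_in_mvars by (metis image_eqI image_subset_iff)

abbreviation lead_coef :: "'l mps \<Rightarrow> 'l"
  where "lead_coef f \<equiv> mnth f (lead f)"

text \<open>
  Leading exponents and coefficients are compared in \<open>a b'\<^sup>q = b a'\<^sup>q\<close>.
\<close>

lemma root_of_fraction:
  assumes e: "embeds V \<psi>" and a: "a \<in> mvars V" "a \<noteq> 0" and b: "b \<in> mvars V" "b \<noteq> 0"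
    and y: "y \<in> fracs (\<psi> ` mvars V)" "\<psi> a / \<psi> b = y ^ q" and q: "q > 0"
  obtains a' b' where "a' \<in> mvars V" "a' \<noteq> 0" "b' \<in> mvars V" "b' \<noteq> 0" "y = \<psi> a' / \<psi> b'"
    "lead a + repeat_mset q (lead b') = lead b + repeat_mset q (lead a')"
    "lead_coef a * lead_coef b' ^ q = lead_coef b * lead_coef a' ^ q"
proof -
  note E = embedsD[OF e] and R = sub_ring_mvars[of V]
  obtain a' b' where ab: "a' \<in> mvars V" "b' \<in> mvars V" "\<psi> b' \<noteq> 0" "y = \<psi> a' / \<psi> b'"
    using y(1) by (auto elim!: fracsE)
  have nz: "\<psi> a \<noteq> 0" "\<psi> b \<noteq> 0" using E(3) a b by auto
  have "y \<noteq> 0" using y(2) nz q by (auto simp: power_0_left)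
  then have a'0: "a' \<noteq> 0" using ab(4) E(5) by auto
  have b'0: "b' \<noteq> 0" using ab(3) E(5) by auto
  have pw: "a' ^ q \<in> mvars V" "b' ^ q \<in> mvars V" using sub_ring_power[OF R] ab by blast+
  have "\<psi> a * \<psi> b' ^ q = \<psi> b * \<psi> a' ^ q"
    using y(2) nz ab(3) unfolding ab(4) by (simp add: power_divide field_simps)
  moreover have m: "a * b' ^ q \<in> mvars V" "b * a' ^ q \<in> mvars V" using sub_ringD(4)[OF R] a(1) b(1) pw by blast+
  ultimately have "\<psi> (a * b' ^ q - b * a' ^ q) = 0"
    using E(2)[OF a(1) pw(2)] E(2)[OF b(1) pw(1)] E(7)[OF m] E(8)[OF ab(1)] E(8)[OF ab(2)] by simp
  moreover have "a * b' ^ q - b * a' ^ q \<in> mvars V" using sub_ringD(4,6)[OF R] a(1) b(1) pw by blast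
  ultimately have eq: "a * b' ^ q = b * a' ^ q" using E(3) by simp
  have l: "lead (a * b' ^ q) = lead a + repeat_mset q (lead b')"
    "lead (b * a' ^ q) = lead b + repeat_mset q (lead a')"
    using a(2) b(2) a'0 b'0 lead_power[of a' q] lead_power[of b' q] by (simp_all add: lead_mult)
  have c: "mnth (a * b' ^ q) (lead a + repeat_mset q (lead b')) = lead_coef a * lead_coef b' ^ q"
    "mnth (b * a' ^ q) (lead b + repeat_mset q (lead a')) = lead_coef b * lead_coef a' ^ q"
    using mnth_mult_lead[of a "b' ^ q"] mnth_mult_lead[of b "a' ^ q"] lead_power[OF a'0, of q] lead_power[OF b'0, of q]
    by auto
  show ?thesis using that[OF ab(1) a'0 ab(2) b'0 ab(4)] l c eq by metis
qed

text \<open>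
  The difference of the leading exponents is divisible by all powers of \<open>p\<close>.
\<close>

lemma lead_eq_of_roots:
  assumes e: "embeds V \<psi>" and a: "a \<in> mvars V" "a \<noteq> 0" and b: "b \<in> mvars V" "b \<noteq> 0"
    and roots: "\<And>e. \<exists>y\<in>fracs (\<psi> ` mvars V). \<psi> a / \<psi> b = y ^ (p ^ e)"
  shows "lead a = lead b"
proof (rule multiset_eqI)
  fix j
  \<comment> \<open>A bound for the two numbers to be compared, which are then determined by their residues
    modulo the power.\<close>
  define n where "n = count (lead a) j + count (lead b) j"
  let ?q = "p ^ n"
  have "2 \<le> p" using prime_char[OF p] p(1) by (metis prime_ge_2_nat)
  then have "2 ^ n \<le> ?q" by (rule power_mono) simp
  then have q: "n < ?q" using less_exp[of n] by linarith
  obtain y where y: "y \<in> fracs (\<psi> ` mvars V)" "\<psi> a / \<psi> b = y ^ ?q" using roots by blast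
  have q0: "?q > 0" using q by linarith
  obtain a' b' where "a' \<in> mvars V" "a' \<noteq> 0" "b' \<in> mvars V" "b' \<noteq> 0" "y = \<psi> a' / \<psi> b'"
    and l: "lead a + repeat_mset ?q (lead b') = lead b + repeat_mset ?q (lead a')"
    and "lead_coef a * lead_coef b' ^ ?q = lead_coef b * lead_coef a' ^ ?q"
    by (rule root_of_fraction[OF e a b y q0])
  from arg_cong[OF l, of "\<lambda>M. count M j"]
  have "count (lead a) j + ?q * count (lead b') j = count (lead b) j + ?q * count (lead a') j" by simp
  then have "count (lead a) j mod ?q = count (lead b) j mod ?q" by (metis mod_mult_self2)
  then show "count (lead a) j = count (lead b) j" using q unfolding n_def by simp
qed

text \<open>
  If \<open>x\<close> has roots of all orders \<open>p\<^sup>e\<close>, then numerator and denominator have the same leading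
  exponent. The quotient \<open>c\<close> of the leading coefficients has roots of all these orders too,
  and so has \<open>x - c\<close>, as the Frobenius map is additive. But in \<open>x - c\<close> the leading term of the
  numerator is cancelled, so \<open>x - c = 0\<close>.
\<close>

lemma infinitely_divisible_constant:
  assumes e: "embeds V \<psi>"
    and roots: "\<And>e. \<exists>y\<in>fracs (\<psi> ` mvars V). x = y ^ (p ^ e)"
  shows "x \<in> C"
proof -
  note E = embedsD[OF e] and R = sub_ring_mvars[of V]
  have "\<exists>y\<in>fracs (\<psi> ` mvars V). x = y ^ (p ^ 0)" by (rule roots)
  then have "x \<in> fracs (\<psi> ` mvars V)" by auto
  then obtain a b where ab: "a \<in> mvars V" "b \<in> mvars V" "\<psi> b \<noteq> 0" "x = \<psi> a / \<psi> b"
    by (auto elim!: fracsE)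
  have b0: "b \<noteq> 0" using ab(3) E(5) by auto
  show ?thesis
  proof (cases "a = 0")
    case True
    then show ?thesis using ab(4) E(5) sub_ringD(1)[OF sub_fieldD(1)[OF C]] by simp
  next
    case False
    define c where "c = lead_coef a / lead_coef b"
    define a1 where "a1 = a - mconst c * b"
    have lab: "lead a = lead b" by (rule lead_eq_of_roots[OF e ab(1) False ab(2) b0]) (use roots ab(4) in blast)
    have a1V: "a1 \<in> mvars V" unfolding a1_def using sub_ringD(4,6)[OF R] mconst_in_mvars ab by blast
    have "\<psi> a1 = \<psi> a - \<kappa> c * \<psi> b"
      unfolding a1_def using E(7)[OF ab(1) sub_ringD(4)[OF R mconst_in_mvars ab(2)], of c] E(2)[OF mconst_in_mvars ab(2), of c] E(4)
      by simp
    then have a1x: "\<psi> a1 / \<psi> b = x - \<kappa> c" using ab(3,4) by (simp add: diff_divide_distrib)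
    have "a1 = 0"
    proof (rule ccontr)
      assume a10: "a1 \<noteq> 0"
      have "\<exists>y\<in>fracs (\<psi> ` mvars V). \<psi> a1 / \<psi> b = y ^ (p ^ n)" for n
      proof -
        let ?q = "p ^ n"
        obtain y where y: "y \<in> fracs (\<psi> ` mvars V)" "x = y ^ ?q" using roots by blast
        then have yq: "\<psi> a / \<psi> b = y ^ ?q" using ab(4) by simp
        have q0: "?q > 0" using p(2) by simp
        obtain a' b' where "a' \<in> mvars V" "a' \<noteq> 0" "b' \<in> mvars V" and b'0: "b' \<noteq> 0" and "y = \<psi> a' / \<psi> b'"
          "lead a + repeat_mset ?q (lead b') = lead b + repeat_mset ?q (lead a')"
          and co: "lead_coef a * lead_coef b' ^ ?q = lead_coef b * lead_coef a' ^ ?q"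
          by (rule root_of_fraction[OF e ab(1) False ab(2) b0 y(1) yq q0])
        note ab' = b'0 co
        define r where "r = lead_coef a' / lead_coef b'"
        have "c = r ^ ?q"
          using ab' mnth_lead[OF ab'(1)] mnth_lead[OF b0] unfolding c_def r_def
          by (simp add: power_divide field_simps)
        moreover have "mconst (r ^ k) = mconst r ^ k" for k
          by (induction k) (auto simp: mconst_hom)
        ultimately have kc: "\<kappa> c = \<kappa> r ^ ?q" using E(4) E(8)[OF mconst_in_mvars] by metis
        have F: "sub_ring (fracs (\<psi> ` mvars V))" using sub_fieldD(1)[OF sub_field_fracs[OF sub_ring_embeds[OF e]]] .
        have "\<kappa> r \<in> fracs (\<psi> ` mvars V)"
          using constants_embeds[OF e] subset_fracs[OF sub_ring_embeds[OF e]] \<kappa> by blast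
        then have "y - \<kappa> r \<in> fracs (\<psi> ` mvars V)" using sub_ringD(6)[OF F] y(1) by blast
        moreover have "(y - \<kappa> r) ^ ?q = x - \<kappa> c"
          using frob_add[OF p refl, of "y - \<kappa> r" "\<kappa> r" n] y(2) kc by simp
        ultimately show ?thesis unfolding a1x by metis
      qed
      then have "lead a1 = lead b" by (rule lead_eq_of_roots[OF e a1V a10 ab(2) b0])
      then have "lead_coef a1 = lead_coef a - c * lead_coef b" unfolding a1_def using lab by simp
      also have "\<dots> = 0" unfolding c_def using mnth_lead[OF b0] by simp
      finally show False using mnth_lead[OF a10] by simp
    qed
    then have "x = \<kappa> c" using a1x E(5) by simp
    then show ?thesis using \<kappa> by blast
  qed
qed

lemma embeds_msubst:
  assumes e: "embeds V \<psi>" and z: "vanishing V z" "\<And>i. i \<in> V \<Longrightarrow> z i \<in> mvars V"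
    and inv: "\<And>f. f \<in> mvars V \<Longrightarrow> msubst V y (msubst V z f) = f" and y: "vanishing V y"
  shows "embeds V (\<lambda>f. \<psi> (msubst V z f))"
proof -
  have m: "msubst V z f \<in> mvars V" for f by (rule msubst_in_mvars[OF z(2)])
  have "f = 0" if f: "f \<in> mvars V" "\<psi> (msubst V z f) = 0" for f
  proof -
    have "msubst V z f = 0" using f(2) embedsD(3)[OF e m] by blast
    then have "f = msubst V y 0" using inv[OF f(1)] by simp
    then show "f = 0" using msubst_mconst[OF y, of 0] by (simp add: mconst_hom)
  qed
  then show ?thesis
    unfolding embeds_def
    using embedsD(1,2,4)[OF e] m by (auto simp: msubst_add[OF z(1)] msubst_mult[OF z(1)] msubst_mconst[OF z(1)])
qed

lemma fin_gen_unit_ideal: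
  fixes a :: "'b::field"
  assumes R: "sub_ring R" and I: "sub_mod R I" "I \<subseteq> R" "a \<in> I" "inverse a \<in> R" "a \<noteq> 0"
  shows "fin_gen R I"
proof (rule fin_genI[of "{1}"])
  have "inverse a * a \<in> I" using sub_modD(3)[OF I(1) I(4) I(3)] .
  then show "{1} \<subseteq> I" using I(5) by simp
  show "I \<subseteq> lin_span R {1}"
  proof
    fix x assume "x \<in> I"
    then have "x * 1 \<in> lin_span R {1}"
      using I(2) sub_modD(3)[OF sub_mod_lin_span] lin_span_incl[of 1 "{1}"] by blast
    then show "x \<in> lin_span R {1}" by simp
  qed
qed simp

text \<open>
  A decomposition of the coefficients, such as Weierstrass division, carries over to
  polynomials and from there to the tower.
\<close>

lemma decompose_polys:
  fixes g :: "'b::comm_ring_1 poly"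
  assumes J: "finite J" and dec: "\<And>x. x \<in> A \<Longrightarrow> \<exists>q\<in>A. \<exists>r. (\<forall>i\<in>J. r i \<in> B) \<and> x = a * q + (\<Sum>i\<in>J. h i * r i)"
    and A: "sub_ring A" and B: "sub_ring B" and g: "g \<in> polys A"
  shows "\<exists>q\<in>polys A. \<exists>r. (\<forall>i\<in>J. r i \<in> polys B) \<and> g = Polynomial.smult a q + (\<Sum>i\<in>J. Polynomial.smult (h i) (r i))"
proof -
  let ?n = "Polynomial.degree g"
  have "\<forall>k. \<exists>q. q \<in> A \<and> (\<exists>r. (\<forall>i\<in>J. r i \<in> B) \<and> poly.coeff g k = a * q + (\<Sum>i\<in>J. h i * r i))"
    using dec polysD[OF g] by blast
  then obtain q where q: "\<And>k. q k \<in> A"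
    "\<And>k. \<exists>r. (\<forall>i\<in>J. r i \<in> B) \<and> poly.coeff g k = a * q k + (\<Sum>i\<in>J. h i * r i)" by metis
  then obtain r where r: "\<And>k i. i \<in> J \<Longrightarrow> r k i \<in> B"
    "\<And>k. poly.coeff g k = a * q k + (\<Sum>i\<in>J. h i * r k i)" by metis
  define Q where "Q = (\<Sum>k\<le>?n. Polynomial.monom (q k) k)"
  define S where "S i = (\<Sum>k\<le>?n. Polynomial.monom (r k i) k)" for i
  have "Q \<in> polys A" unfolding Q_def
    by (intro sub_ring_sum[OF sub_ring_polys[OF A]] monom_in_polys[OF A] q)
  moreover have "S i \<in> polys B" if "i \<in> J" for i unfolding S_def
    by (intro sub_ring_sum[OF sub_ring_polys[OF B]] monom_in_polys[OF B] r that)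
  moreover have sm: "Polynomial.smult c (\<Sum>k\<in>K. f k) = (\<Sum>k\<in>K. Polynomial.smult c (f k))"
    for c and f :: "nat \<Rightarrow> 'b poly" and K
    by (induction K rule: infinite_finite_induct) (auto simp: smult_add_right)
  have "g = Polynomial.smult a Q + (\<Sum>i\<in>J. Polynomial.smult (h i) (S i))"
  proof -
    have "g = (\<Sum>k\<le>?n. Polynomial.monom (a * q k + (\<Sum>i\<in>J. h i * r k i)) k)"
      unfolding r(2)[symmetric] by (simp add: poly_as_sum_of_monoms)
    also have "\<dots> = (\<Sum>k\<le>?n. Polynomial.smult a (Polynomial.monom (q k) k) + (\<Sum>i\<in>J. Polynomial.smult (h i) (Polynomial.monom (r k i) k)))"
      by (intro sum.cong refl poly_eqI) (simp add: coeff_sum)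
    also have "\<dots> = (\<Sum>k\<le>?n. Polynomial.smult a (Polynomial.monom (q k) k)) +
        (\<Sum>i\<in>J. \<Sum>k\<le>?n. Polynomial.smult (h i) (Polynomial.monom (r k i) k))"
      unfolding sum.distrib by (subst sum.swap) (rule refl)
    also have "\<dots> = Polynomial.smult a Q + (\<Sum>i\<in>J. Polynomial.smult (h i) (S i))"
      unfolding Q_def S_def sm by (rule refl)
    finally show ?thesis .
  qed
  ultimately show ?thesis by blast
qed

text \<open>
  The induction is on the set of variables, for all embeddings at once, since a change of
  coordinates is a change of the embedding. For \<open>a \<noteq> 0\<close>, coordinates are chosen in which \<open>a\<close>
  is regular in the smallest variable; Weierstrass division makes both \<open>A\<close> and its tower
  finite modulo \<open>a\<close> over the corresponding rings in one variable less.
\<close>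

theorem noeth_series:
  assumes "finite V" and "embeds V \<psi>"
  shows "noeth (\<psi> ` mvars V) \<and> noeth (tower (\<psi> ` mvars V))"
  using assms
proof (induction V arbitrary: \<psi> rule: finite_psubset_induct)
  case (psubset V)
  note e = psubset.prems
  define A where "A = \<psi> ` mvars V"
  note A = sub_ring_embeds[OF e, folded A_def] and CA = constants_embeds[OF e, folded A_def]
  note TA = sub_ring_tower[OF A CA]
  have AT: "A \<subseteq> tower A" by (rule subset_tower[OF A])
  have above: "(\<forall>I. sub_mod A I \<longrightarrow> I \<subseteq> A \<longrightarrow> a \<in> I \<longrightarrow> fin_gen A I) \<and>
      (\<forall>I. sub_mod (tower A) I \<longrightarrow> I \<subseteq> tower A \<longrightarrow> a \<in> I \<longrightarrow> fin_gen (tower A) I)"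
    if a: "a \<in> A" "a \<noteq> 0" for a
  proof (cases "V = {}")
    case True
    then have "a \<in> C" using a(1) embedsD(4)[OF e] \<kappa> unfolding A_def by (auto simp: mvars_empty)
    then have "inverse a \<in> A" using sub_fieldD(2)[OF C] CA by blast
    then show ?thesis using fin_gen_unit_ideal[OF A] fin_gen_unit_ideal[OF TA] AT a(2) by blast
  next
    case False
    obtain a0 where a0: "a0 \<in> mvars V" "a = \<psi> a0" using a(1) unfolding A_def by blast
    have "a0 \<noteq> 0" using a0 a(2) embedsD(5)[OF e] by auto
    then obtain y z d where yz: "vanishing V y" "vanishing V z"
      "\<And>i. i \<in> V \<Longrightarrow> y i \<in> mvars V" "\<And>i. i \<in> V \<Longrightarrow> z i \<in> mvars V"
      "\<And>f. f \<in> mvars V \<Longrightarrow> msubst V z (msubst V y f) = f" "\<And>f. f \<in> mvars V \<Longrightarrow> msubst V y (msubst V z f) = f"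
      "msubst V y a0 \<noteq> 0" "lead (msubst V y a0) = replicate_mset d (Min V)"
      using coordinate_change[OF psubset.hyps False a0(1)] by metis
    define v where "v = Min V"
    have v: "v \<in> V" using psubset.hyps False unfolding v_def by simp
    \<comment> \<open>The same subring in the new coordinates.\<close>
    define \<phi> where "\<phi> f = \<psi> (msubst V z f)" for f
    have e': "embeds V \<phi>" unfolding \<phi>_def by (rule embeds_msubst[OF e yz(2,4,6,1)])
    have A\<phi>: "A = \<phi> ` mvars V"
    proof
      show "A \<subseteq> \<phi> ` mvars V"
      proof
        fix x assume "x \<in> A"
        then obtain f where f: "f \<in> mvars V" "x = \<psi> f" unfolding A_def by blast
        then have "x = \<phi> (msubst V y f)" unfolding \<phi>_def using yz(5) by simp
        then show "x \<in> \<phi> ` mvars V" using msubst_in_mvars[of V y V f] yz(3) by blast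
      qed
      show "\<phi> ` mvars V \<subseteq> A" unfolding A_def \<phi>_def using msubst_in_mvars[of V z V] yz(4) by blast
    qed
    define a1 where "a1 = msubst V y a0"
    have a1: "a1 \<in> mvars V" "a1 \<noteq> 0" "lead a1 = replicate_mset d v" "\<phi> a1 = a"
      unfolding a1_def v_def \<phi>_def using msubst_in_mvars[of V y V] yz a0 by auto
    define B where "B = \<phi> ` mvars (V - {v})"
    have eB: "embeds (V - {v}) \<phi>" by (rule embeds_subset[OF e']) blast
    have nB: "noeth B" "noeth (tower B)"
      using psubset.IH[OF _ eB] v unfolding B_def by blast+
    note B = sub_ring_embeds[OF eB, folded B_def] and CB = constants_embeds[OF eB, folded B_def]
    have BA: "B \<subseteq> A" unfolding A\<phi> B_def by (rule image_mono[OF mvars_mono]) blast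
    define x where "x i = \<phi> (mmon (replicate_mset i v))" for i
    have rep: "mmon (replicate_mset i v) \<in> mvars V" for i using v by (intro mmon_in_mvars) auto
    have xA: "x i \<in> A" for i unfolding x_def A\<phi> using rep by blast
    have dec: "\<exists>q\<in>A. \<exists>r. (\<forall>i\<in>{..<d}. r i \<in> B) \<and> w = a * q + (\<Sum>i\<in>{..<d}. x i * r i)" if wA: "w \<in> A" for w
    proof -
      obtain f where f: "f \<in> mvars V" "w = \<phi> f" using wA unfolding A\<phi> by blast
      obtain q r where q: "q \<in> mvars V" "\<And>i. r i \<in> mvars (V - {v})"
        "f = q * a1 + (\<Sum>i<d. mmon (replicate_mset i v) * r i)"
        using weierstrass_division[OF a1(1-3) v f(1)] by blast
      have rV: "r i \<in> mvars V" for i using q(2) mvars_mono[of "V - {v}" V] by blast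
      have mr: "mmon (replicate_mset i v) * r i \<in> mvars V" for i
        using sub_ringD(4)[OF sub_ring_mvars rep rV] .
      have "w = \<phi> (q * a1) + \<phi> (\<Sum>i<d. mmon (replicate_mset i v) * r i)"
        unfolding f(2) q(3)
        by (rule embedsD(1)[OF e' sub_ringD(4)[OF sub_ring_mvars q(1) a1(1)] sub_ring_sum[OF sub_ring_mvars mr]])
      also have "\<dots> = \<phi> q * \<phi> a1 + (\<Sum>i<d. \<phi> (mmon (replicate_mset i v)) * \<phi> (r i))"
        by (simp only: embedsD(2)[OF e' q(1) a1(1)] embedsD(9)[OF e' mr] embedsD(2)[OF e' rep rV])
      finally have "w = \<phi> q * \<phi> a1 + (\<Sum>i<d. \<phi> (mmon (replicate_mset i v)) * \<phi> (r i))" .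
      then have "w = a * \<phi> q + (\<Sum>i\<in>{..<d}. x i * \<phi> (r i))" using a1(4) by (simp add: x_def mult.commute)
      moreover have "\<phi> q \<in> A" "\<And>i. \<phi> (r i) \<in> B" using q unfolding A\<phi> B_def by blast+
      ultimately show ?thesis by (intro bexI[of _ "\<phi> q"] exI[of _ "\<lambda>i. \<phi> (r i)"] conjI ballI)
    qed
    have J: "finite (x ` {..<d})" "x ` {..<d} \<subseteq> A" using xA by auto
    have genA: "\<exists>u\<in>lin_span B (x ` {..<d}). \<exists>q\<in>A. w = u + a * q" if w: "w \<in> A" for w
    proof -
      obtain q r where q: "q \<in> A" "\<forall>i\<in>{..<d}. r i \<in> B" "w = a * q + (\<Sum>i\<in>{..<d}. x i * r i)" using dec[OF w] by blast
      have "(\<Sum>i\<in>{..<d}. r i * x i) \<in> lin_span B (x ` {..<d})"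
        using q(2) by (intro sub_mod_sum[OF sub_mod_lin_span] sub_modD(3)[OF sub_mod_lin_span] lin_span_incl) auto
      then show ?thesis using q by (intro bexI[of _ "\<Sum>i\<in>{..<d}. r i * x i"] bexI[of _ q]) (auto simp: ac_simps)
    qed
    have genT: "\<exists>u\<in>lin_span (tower B) (x ` {..<d}). \<exists>q\<in>tower A. w = u + a * q" if w: "w \<in> tower A" for w
    proof -
      obtain m g s where g: "g \<in> polys A" "s \<in> polys C" "s \<noteq> 0" "w = poly g (t m) / poly s (t m)"
        using w unfolding tower_def by blast
      obtain q r where q: "q \<in> polys A" "\<And>i. i \<in> {..<d} \<Longrightarrow> r i \<in> polys B"
        "g = Polynomial.smult a q + (\<Sum>i\<in>{..<d}. Polynomial.smult (x i) (r i))"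
        using decompose_polys[OF finite_lessThan dec A B g(1)] by blast
      let ?s = "poly s (t m)"
      have "w = (\<Sum>i\<in>{..<d}. (poly (r i) (t m) / ?s) * x i) + a * (poly q (t m) / ?s)"
        unfolding g(4) q(3) by (simp add: poly_sum add_divide_distrib sum_divide_distrib mult.commute)
      moreover have "(\<Sum>i\<in>{..<d}. (poly (r i) (t m) / ?s) * x i) \<in> lin_span (tower B) (x ` {..<d})"
        by (intro sub_mod_sum[OF sub_mod_lin_span] sub_modD(3)[OF sub_mod_lin_span] lin_span_incl towerI q g) auto
      moreover have "poly q (t m) / ?s \<in> tower A" by (intro towerI q g)
      ultimately show ?thesis by blast
    qed
    have "fin_gen A I" if "sub_mod A I" "I \<subseteq> A" "a \<in> I" for I
      by (rule fin_gen_ideal_finite_mod[OF B nB(1) BA A J genA that])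
    moreover have "fin_gen (tower A) I" if I: "sub_mod (tower A) I" "I \<subseteq> tower A" "a \<in> I" for I
      by (rule fin_gen_ideal_finite_mod[OF sub_ring_tower[OF B CB] nB(2) tower_mono[OF BA] TA J(1) _ genT I])
        (use J(2) AT in blast)
    ultimately show ?thesis by blast
  qed
  have nA: "noeth A"
    unfolding noeth_def
  proof (intro allI impI)
    fix I assume I: "I \<subseteq> A" "sub_mod A I"
    show "fin_gen A I"
    proof (cases "I \<subseteq> {0}")
      case True
      then show ?thesis using fin_genI[of "{}" I A] lin_span_empty[of A] by auto
    next
      case False
      then obtain a where "a \<in> I" "a \<noteq> 0" by blast
      then show ?thesis using above[of a] I by blast
    qed
  qed
  interpret perfect_tower_domain p t C A
  proof
    show "sub_ring A" by (rule A)
    show "C \<subseteq> A" by (rule CA)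
    show "noeth A" by (rule nA)
    show "x \<in> C" if "\<And>e. \<exists>y\<in>fracs A. x = y ^ (p ^ e)" for x
      using infinitely_divisible_constant[OF e] that unfolding A_def by blast
    show "fin_gen (tower A) I" if "sub_mod (tower A) I" "I \<subseteq> tower A" "a \<in> A" "a \<noteq> 0" "a \<in> I" for I a
      using above that by blast
  qed
  show ?case using nA noeth_tower unfolding A_def by blast
qed

end

section \<open>Polynomials over an algebraic extension\<close>

lemma field_ring_simps [simp]:
  "carrier field_ring = UNIV" "x \<otimes>\<^bsub>field_ring\<^esub> y = x * y" "x \<oplus>\<^bsub>field_ring\<^esub> y = x + y"
  "\<one>\<^bsub>field_ring\<^esub> = 1" "\<zero>\<^bsub>field_ring\<^esub> = 0" for x y :: "'a::field"
  by (simp_all add: ring_of_type_algebra_def)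

lemma field_ring_minus: "\<ominus>\<^bsub>field_ring\<^esub> x = - x" for x :: "'a::field"
proof -
  interpret F: field "field_ring :: 'a ring" by (rule field_field_ring)
  show ?thesis by (rule F.minus_equality) simp_all
qed

lemma field_ring_inverse: "x \<noteq> 0 \<Longrightarrow> inv\<^bsub>field_ring\<^esub> x = inverse x" for x :: "'a::field"
proof -
  assume "x \<noteq> 0"
  interpret F: field "field_ring :: 'a ring" by (rule field_field_ring)
  show ?thesis by (rule F.comm_inv_char) (use \<open>x \<noteq> 0\<close> in simp_all)
qed

lemma field_ring_pow: "x [^]\<^bsub>field_ring\<^esub> (n::nat) = x ^ n" for x :: "'a::field"
proof -
  interpret F: field "field_ring :: 'a ring" by (rule field_field_ring)
  show ?thesis by (induction n) (simp_all add: mult.commute)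
qed

lemma field_hom:
  fixes h :: "'k::field \<Rightarrow> 'l::field"
  assumes "h \<in> ring_hom field_ring field_ring"
  shows "h (x * y) = h x * h y" "h (x + y) = h x + h y" "h 1 = 1" "h 0 = 0" "h (- x) = - h x"
    "h x = 0 \<longleftrightarrow> x = 0" "h (inverse x) = inverse (h x)"
proof -
  show m: "h (x * y) = h x * h y" and a: "h (x + y) = h x + h y" and o: "h 1 = 1" for x y
    using assms unfolding ring_hom_def by simp_all
  have "h 0 = h 0 + h 0" using a[of 0 0] by (simp only: add_0_left)
  then show z: "h 0 = 0" by (metis add_cancel_right_right)
  have "h x + h (- x) = 0" using a[of x "- x"] z by simp
  then show "h (- x) = - h x" by (simp add: eq_neg_iff_add_eq_0 add.commute)
  have inv: "h x * h (inverse x) = 1" if "x \<noteq> 0" for x using m[of x "inverse x"] that o by simp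
  show nz: "h x = 0 \<longleftrightarrow> x = 0" by (metis inv z mult_zero_left zero_neq_one)
  show "h (inverse x) = inverse (h x)"
  proof (cases "x = 0")
    case False
    then show ?thesis using inv[OF False] nz by (metis inverse_unique)
  qed (simp add: z)
qed

lemma sub_field_range:
  fixes h :: "'k::field \<Rightarrow> 'l::field"
  assumes h: "h \<in> ring_hom field_ring field_ring"
  shows "sub_field (range h)"
  unfolding sub_field_def sub_ring_def
proof (intro conjI ballI)
  note H = field_hom[OF h]
  show "0 \<in> range h" using H(4) by (metis rangeI)
  show "1 \<in> range h" using H(3) by (metis rangeI)
  fix x assume "x \<in> range h"
  then obtain a where a: "x = h a" by blast
  show "- x \<in> range h" unfolding a H(5)[symmetric] by (rule rangeI)
  show "inverse x \<in> range h" unfolding a H(7)[symmetric] by (rule rangeI)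
  fix y assume "y \<in> range h"
  then obtain b where b: "y = h b" by blast
  show "x + y \<in> range h" unfolding a b H(2)[symmetric] by (rule rangeI)
  show "x * y \<in> range h" unfolding a b H(1)[symmetric] by (rule rangeI)
qed

text \<open>
  Polynomials of the locale-based algebra are coefficient lists with the leading coefficient
  first.
\<close>

lemma eval_as_poly:
  fixes K :: "'a::field set"
  assumes K: "sub_ring K" and p: "set p \<subseteq> K"
  shows "\<exists>f\<in>polys K. poly f x = ring.eval field_ring p x \<and> (\<forall>i\<ge>length p. poly.coeff f i = 0) \<and>
    (p \<noteq> [] \<longrightarrow> poly.coeff f (length p - 1) = hd p)"
  using p
proof (induction p)
  case Nil
  interpret F: field "field_ring :: 'a ring" by (rule field_field_ring)
  show ?case using sub_ringD(1)[OF sub_ring_polys[OF K]] by (intro bexI[of _ 0]) auto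
next
  case (Cons c p)
  interpret F: field "field_ring :: 'a ring" by (rule field_field_ring)
  obtain f where f: "f \<in> polys K" "poly f x = ring.eval field_ring p x" "\<And>i. i \<ge> length p \<Longrightarrow> poly.coeff f i = 0"
    using Cons by auto
  let ?f = "Polynomial.monom c (length p) + f"
  have "?f \<in> polys K" using Cons.prems f(1) sub_ringD(3)[OF sub_ring_polys[OF K]] monom_in_polys[OF K] by auto
  moreover have "poly ?f x = ring.eval field_ring (c # p) x" using f(2) by (simp add: poly_monom field_ring_pow)
  ultimately show ?case using f(3) by (intro bexI[of _ ?f]) auto
qed

lemma algebraic_imp_monic_relation:
  fixes h :: "'k::field \<Rightarrow> 'l::field"
  assumes h: "algebraic_extension h"
  obtains f where "f \<in> polys (range h)" "lead_coeff f = 1" "poly f y = 0"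
proof -
  interpret F: field "field_ring :: 'l ring" by (rule field_field_ring)
  have hom: "h \<in> ring_hom field_ring field_ring" and alg: "ring.algebraic field_ring (range h) y"
    using h unfolding algebraic_extension_def by auto
  note K = sub_field_range[OF hom] and R = sub_fieldD(1)[OF sub_field_range[OF hom]]
  have "subring (range h) (field_ring :: 'l ring)"
    by (rule F.subringI) (use sub_ringD[OF R] in \<open>auto simp: field_ring_minus simp del: rangeI\<close>)
  then obtain q where q: "q \<in> carrier (univ_poly field_ring (range h))" "q \<noteq> []" "ring.eval field_ring q y = \<zero>\<^bsub>field_ring\<^esub>"
    using F.algebraicE[of "range h" y] alg unfolding over_def by auto
  have q': "set q \<subseteq> range h" "hd q \<noteq> 0"
    using q(1,2) unfolding univ_poly_carrier[symmetric] polynomial_def by auto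
  obtain f where f: "f \<in> polys (range h)" "poly f y = 0" "poly.coeff f (length q - 1) \<noteq> 0"
    using eval_as_poly[OF R q'(1), of y] q(2,3) q'(2) by auto
  have "f \<noteq> 0" using f(3) by auto
  let ?g = "Polynomial.smult (inverse (lead_coeff f)) f"
  have "?g \<in> polys (range h)"
    by (rule smult_in_polys[OF R sub_fieldD(2)[OF K] f(1)]) (rule polysD[OF f(1)])
  moreover have "lead_coeff ?g = 1" using \<open>f \<noteq> 0\<close> by simp
  moreover have "poly ?g y = 0" using f(2) by simp
  ultimately show ?thesis by (rule that)
qed

lemma lin_span_mult:
  assumes x: "x \<in> lin_span K G" and y: "y \<in> lin_span K H"
  shows "x * y \<in> lin_span K {g * h | g h. g \<in> G \<and> h \<in> H}"
proof -
  note s = sub_mod_lin_span[of K "{g * h | g h. g \<in> G \<and> h \<in> H}"]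
  have gy: "g * y \<in> lin_span K {g * h | g h. g \<in> G \<and> h \<in> H}" if "g \<in> G" for g
    by (rule lin_span_smult[OF y _ s]) (use that in \<open>auto intro!: lin_span_incl\<close>)
  have "y * x \<in> lin_span K {g * h | g h. g \<in> G \<and> h \<in> H}"
    by (rule lin_span_smult[OF x _ s]) (use gy in \<open>simp add: mult.commute\<close>)
  then show ?thesis by (simp add: mult.commute)
qed

text \<open>
  One element \<open>a\<close> is adjoined at a time: by its monic equation the powers below the degree
  span all powers of \<open>a\<close>.
\<close>

lemma finite_ring_of_algebraic:
  fixes h :: "'k::field \<Rightarrow> 'l::field"
  assumes h: "algebraic_extension h" and S: "finite S"
  shows "\<exists>R J. sub_ring R \<and> range h \<subseteq> R \<and> S \<subseteq> R \<and> finite J \<and> R \<subseteq> lin_span (range h) J"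
  using S
proof (induction S rule: finite_induct)
  case empty
  let ?K = "range h"
  have hom: "h \<in> ring_hom field_ring field_ring" using h unfolding algebraic_extension_def by auto
  note R = sub_fieldD(1)[OF sub_field_range[OF hom]]
  have "?K \<subseteq> lin_span ?K {1}"
  proof
    fix x assume "x \<in> ?K"
    then have "x * 1 \<in> lin_span ?K {1}" by (intro sub_modD(3)[OF sub_mod_lin_span] lin_span_incl) auto
    then show "x \<in> lin_span ?K {1}" by simp
  qed
  then show ?case using R by (intro exI[of _ ?K] exI[of _ "{1}"]) auto
next
  case (insert a S)
  let ?K = "range h"
  obtain R J where R: "sub_ring R" "?K \<subseteq> R" "S \<subseteq> R" "finite J" "R \<subseteq> lin_span ?K J" using insert.IH by blast
  obtain f where f: "f \<in> polys ?K" "lead_coeff f = 1" "poly f a = 0"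
    using algebraic_imp_monic_relation[OF h] by blast
  let ?D = "Polynomial.degree f"
  let ?P = "(\<lambda>i. a ^ i) ` {..<?D}"
  note sP = sub_mod_lin_span[of ?K ?P]
  have pw: "a ^ n \<in> lin_span ?K ?P" for n
  proof (induction n rule: less_induct)
    case (less n)
    show ?case
    proof (cases "n < ?D")
      case True
      then show ?thesis by (intro lin_span_incl) auto
    next
      case False
      have "0 = (\<Sum>i<?D. poly.coeff f i * a ^ i) + a ^ ?D"
        using f(2,3) unfolding poly_altdef by (simp add: lessThan_Suc_atMost[symmetric])
      then have "a ^ ?D = - (\<Sum>i<?D. poly.coeff f i * a ^ i)" by (simp add: eq_neg_iff_add_eq_0 add.commute)
      then have "a ^ ?D * a ^ (n - ?D) = (\<Sum>i<?D. (- poly.coeff f i) * a ^ (i + (n - ?D)))"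
        by (simp add: sum_distrib_right sum_negf power_add mult.assoc)
      moreover have "a ^ ?D * a ^ (n - ?D) = a ^ n" using False by (simp flip: power_add)
      moreover have "(\<Sum>i<?D. (- poly.coeff f i) * a ^ (i + (n - ?D))) \<in> lin_span ?K ?P"
      proof (intro sub_mod_sum[OF sP] sub_modD(3)[OF sP])
        fix i assume "i \<in> {..<?D}"
        then show "a ^ (i + (n - ?D)) \<in> lin_span ?K ?P" using False by (intro less.IH) auto
        have hom: "h \<in> ring_hom field_ring field_ring" using h unfolding algebraic_extension_def by auto
        show "- poly.coeff f i \<in> ?K"
          using sub_ringD(5)[OF sub_fieldD(1)[OF sub_field_range[OF hom]] polysD[OF f(1)]] .
      qed
      ultimately show ?thesis by simp
    qed
  qed
  let ?R = "(\<lambda>g. poly g a) ` polys R"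
  note P = sub_ring_polys[OF R(1)]
  have "sub_ring ?R"
    unfolding sub_ring_def
  proof (intro conjI ballI)
    show "0 \<in> ?R" using sub_ringD(1)[OF P] by (intro image_eqI[of _ _ 0]) auto
    show "1 \<in> ?R" using sub_ringD(2)[OF P] by (intro image_eqI[of _ _ 1]) auto
    fix x assume "x \<in> ?R"
    then obtain u where u: "u \<in> polys R" "x = poly u a" by blast
    show "- x \<in> ?R" using u sub_ringD(5)[OF P u(1)] by (intro image_eqI[of _ _ "- u"]) auto
    fix y assume "y \<in> ?R"
    then obtain v where v: "v \<in> polys R" "y = poly v a" by blast
    show "x + y \<in> ?R" using u v sub_ringD(3)[OF P u(1) v(1)] by (intro image_eqI[of _ _ "u + v"]) auto
    show "x * y \<in> ?R" using u v sub_ringD(4)[OF P u(1) v(1)] by (intro image_eqI[of _ _ "u * v"]) auto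
  qed
  moreover have RR: "R \<subseteq> ?R"
  proof
    fix x assume "x \<in> R"
    then show "x \<in> ?R" using const_in_polys[OF R(1)] by (intro image_eqI[of _ _ "[:x:]"]) auto
  qed
  then have "?K \<subseteq> ?R" using R(2) by (rule order_trans[rotated])
  moreover have aR: "a \<in> ?R"
    using monom_in_polys[OF R(1) sub_ringD(2)[OF R(1)], of 1] by (intro image_eqI[of _ _ "Polynomial.monom 1 1"]) (auto simp: poly_monom)
  moreover have "finite {u * v | u v. u \<in> J \<and> v \<in> ?P}"
  proof -
    have "{u * v | u v. u \<in> J \<and> v \<in> ?P} = (\<lambda>(u, v). u * v) ` (J \<times> ?P)" by auto
    then show ?thesis using R(4) by simp
  qed
  moreover have "?R \<subseteq> lin_span ?K {u * v | u v. u \<in> J \<and> v \<in> ?P}"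
  proof
    fix x assume "x \<in> ?R"
    then obtain u where u: "u \<in> polys R" "x = poly u a" by blast
    have "x = (\<Sum>i\<le>Polynomial.degree u. poly.coeff u i * a ^ i)" using u(2) by (simp add: poly_altdef)
    also have "\<dots> \<in> lin_span ?K {u * v | u v. u \<in> J \<and> v \<in> ?P}"
    proof (rule sub_mod_sum[OF sub_mod_lin_span])
      fix i
      have "poly.coeff u i \<in> lin_span ?K J" using polysD[OF u(1)] R(5) by blast
      then show "poly.coeff u i * a ^ i \<in> lin_span ?K {u * v | u v. u \<in> J \<and> v \<in> ?P}"
        using lin_span_mult pw by blast
    qed
    finally show "x \<in> lin_span ?K {u * v | u v. u \<in> J \<and> v \<in> ?P}" .
  qed
  moreover have "insert a S \<subseteq> ?R" using aR order_trans[OF R(3) RR] by (rule insert_subsetI)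
  ultimately show ?case
    by (intro exI[of _ ?R] exI[of _ "{u * v | u v. u \<in> J \<and> v \<in> ?P}"] conjI)
qed

lemma noeth_sub_field:
  assumes K: "sub_field K" shows "noeth K"
  unfolding noeth_def
proof (intro allI impI)
  fix I assume I: "I \<subseteq> K" "sub_mod K I"
  show "fin_gen K I"
  proof (cases "I \<subseteq> {0}")
    case True
    then show ?thesis using fin_genI[of "{}" I K] lin_span_empty[of K] by auto
  next
    case False
    then obtain a where a: "a \<in> I" "a \<noteq> 0" by blast
    show ?thesis
    proof (rule fin_genI[of "{a}"])
      show "I \<subseteq> lin_span K {a}"
      proof
        fix x assume "x \<in> I"
        then have "x / a \<in> K" using sub_fieldD(3)[OF K] I(1) a(1) by blast
        then have "x / a * a \<in> lin_span K {a}" by (intro sub_modD(3)[OF sub_mod_lin_span] lin_span_incl) auto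
        then show "x \<in> lin_span K {a}" using a(2) by simp
      qed
    qed (use a in auto)
  qed
qed

lemma lin_span_chain:
  assumes R: "sub_ring R" and x: "x \<in> lin_span R (range (r :: nat \<Rightarrow> 'a::comm_ring_1))"
  shows "\<exists>n. x \<in> lin_span R (r ` {..<n})"
proof -
  have mono: "lin_span R (r ` {..<i}) \<subseteq> lin_span R (r ` {..<j})" if "i \<le> j" for i j
    using that by (intro lin_span_mono image_mono) auto
  have "lin_span R (range r) \<subseteq> (\<Union>n. lin_span R (r ` {..<n}))"
  proof (rule lin_span_least)
    show "sub_mod R (\<Union>n. lin_span R (r ` {..<n}))"
      unfolding sub_mod_def
    proof (intro conjI ballI)
      show "0 \<in> (\<Union>n. lin_span R (r ` {..<n}))" using sub_modD(1)[OF sub_mod_lin_span] by blast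
    next
      fix x y assume "x \<in> (\<Union>n. lin_span R (r ` {..<n}))" "y \<in> (\<Union>n. lin_span R (r ` {..<n}))"
      then obtain i j where "x \<in> lin_span R (r ` {..<i})" "y \<in> lin_span R (r ` {..<j})" by blast
      then have "x \<in> lin_span R (r ` {..<max i j})" "y \<in> lin_span R (r ` {..<max i j})"
        using mono[of i "max i j"] mono[of j "max i j"] by auto
      then show "x + y \<in> (\<Union>n. lin_span R (r ` {..<n}))" using sub_modD(2)[OF sub_mod_lin_span] by blast
    next
      fix c x assume "c \<in> R" "x \<in> (\<Union>n. lin_span R (r ` {..<n}))"
      then show "c * x \<in> (\<Union>n. lin_span R (r ` {..<n}))" using sub_modD(3)[OF sub_mod_lin_span] by blast
    qed
    show "range r \<subseteq> (\<Union>n. lin_span R (r ` {..<n}))"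
    proof
      fix y assume "y \<in> range r"
      then obtain i where "y = r i" by blast
      then have "y \<in> lin_span R (r ` {..<Suc i})" by (intro lin_span_incl) simp
      then show "y \<in> (\<Union>n. lin_span R (r ` {..<n}))" by (rule UN_I[OF UNIV_I])
    qed
  qed
  then show ?thesis using x by blast
qed

text \<open>
  For monic \<open>s\<close> the coefficients lie in a ring that is finite over the base field. The
  remainders of \<open>1, x, x\<^sup>2, \<dots>\<close> modulo \<open>s\<close> then lie in a finite-dimensional space over the base
  field, so one of them is a combination of its predecessors; this gives a monic multiple of
  \<open>s\<close> with coefficients in the base field.
\<close>

lemma divides_base_poly:
  fixes h :: "'k::field \<Rightarrow> 'l::field"
  assumes h: "algebraic_extension h" and s: "s \<noteq> 0"
  shows "\<exists>u v. v \<in> polys (range h) \<and> v \<noteq> 0 \<and> v = s * u"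
proof -
  let ?K = "range h"
  have hom: "h \<in> ring_hom field_ring field_ring" using h unfolding algebraic_extension_def by auto
  note KF = sub_field_range[OF hom]
  note K = sub_fieldD(1)[OF KF]
  note PK = sub_ring_polys[OF K]
  define s1 where "s1 = Polynomial.smult (inverse (lead_coeff s)) s"
  have s1: "lead_coeff s1 = 1" "s1 dvd s" "s dvd s1" using s unfolding s1_def
    by (auto simp: smult_dvd_iff dvd_smult)
  let ?N = "Polynomial.degree s1"
  obtain R J where R: "sub_ring R" "?K \<subseteq> R" "poly.coeff s1 ` {..?N} \<subseteq> R" "finite J" "R \<subseteq> lin_span ?K J"
    using finite_ring_of_algebraic[OF h, of "poly.coeff s1 ` {..?N}"] by auto
  note P = sub_ring_polys[OF R(1)]
  have sP: "s1 \<in> polys R"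
    unfolding polys_def
  proof (intro CollectI allI)
    fix i show "poly.coeff s1 i \<in> R"
      using R(3) sub_ringD(1)[OF R(1)] by (cases "i \<le> ?N") (auto simp: coeff_eq_0)
  qed
  show ?thesis
  proof (cases "?N = 0")
    case True
    then obtain c where c: "s1 = [:c:]" by (rule degree_eq_zeroE)
    then have "s1 = 1" using s1(1) by (simp add: one_pCons)
    then have "s dvd 1" using s1(3) by simp
    then obtain u where "1 = s * u" by (rule dvdE)
    then show ?thesis using sub_ringD(2)[OF PK] by (intro exI[of _ u] exI[of _ 1]) auto
  next
    case False
    define x :: "'l poly" where "x = Polynomial.monom 1 1"
    \<comment> \<open>The remainder of the next power is obtained by one reduction step, which keeps the
      coefficients in the ring.\<close>
    define r where "r = rec_nat 1 (\<lambda>n g. x * g - Polynomial.smult (poly.coeff g (?N - 1)) s1)"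
    have r0: "r 0 = 1" and rS: "r (Suc n) = x * r n - Polynomial.smult (poly.coeff (r n) (?N - 1)) s1" for n
      unfolding r_def by simp_all
    have xm: "x * Polynomial.monom 1 n = Polynomial.monom 1 (Suc n)" for n unfolding x_def by (simp add: mult_monom)
    have inv: "r n \<in> polys R \<and> (\<forall>i\<ge>?N. poly.coeff (r n) i = 0) \<and> s1 dvd Polynomial.monom 1 n - r n" for n
    proof (induction n)
      case 0
      show ?case using sub_ringD(2)[OF P] False by (simp add: r0)
    next
      case (Suc n)
      have "r (Suc n) \<in> polys R"
        unfolding rS using Suc polysD sP
        by (intro sub_ringD(4,6)[OF P] smult_in_polys[OF R(1)]) (auto simp: x_def intro: monom_in_polys[OF R(1)] sub_ringD(2)[OF R(1)])
      moreover have "poly.coeff (r (Suc n)) i = 0" if "i \<ge> ?N" for i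
      proof (cases "i = ?N")
        case True
        then show ?thesis using False s1(1) by (simp add: rS x_def coeff_monom_mult)
      next
        case ne: False
        then have "poly.coeff s1 i = 0" "poly.coeff (r n) (i - 1) = 0" using that Suc by (auto simp: coeff_eq_0)
        then show ?thesis using False that by (simp add: rS x_def coeff_monom_mult)
      qed
      moreover have "s1 dvd Polynomial.monom 1 (Suc n) - r (Suc n)"
      proof -
        have "Polynomial.monom 1 (Suc n) - r (Suc n) =
            x * (Polynomial.monom 1 n - r n) + Polynomial.smult (poly.coeff (r n) (?N - 1)) s1"
          unfolding rS xm[symmetric] by (simp add: algebra_simps)
        moreover have "s1 dvd x * (Polynomial.monom 1 n - r n)" using Suc by (intro dvd_mult) blast
        moreover have "s1 dvd Polynomial.smult (poly.coeff (r n) (?N - 1)) s1" by (intro dvd_smult dvd_refl)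
        ultimately show ?thesis by (metis dvd_add)
      qed
      ultimately show ?case by blast
    qed
    \<comment> \<open>Scalars act on polynomials as constant polynomials.\<close>
    define c where "c = (\<lambda>a::'l. [:a:])"
    have cK: "sub_ring (c ` ?K)"
      unfolding c_def by (rule sub_ring_const_polys[OF K])
    have nc: "noeth (c ` ?K)" by (rule noeth_image[OF K noeth_sub_field[OF KF]]) (auto simp: c_def)
    let ?M = "(\<lambda>(j, i). Polynomial.monom j i) ` (J \<times> {..<?N})"
    note sM = sub_mod_lin_span[of "c ` ?K" ?M]
    have mon: "Polynomial.monom a i \<in> lin_span (c ` ?K) ?M" if a: "a \<in> lin_span ?K J" and i: "i < ?N" for a i
    proof -
      have "lin_span ?K J \<subseteq> {a. Polynomial.monom a i \<in> lin_span (c ` ?K) ?M}"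
      proof (rule lin_span_least)
        show "sub_mod ?K {a. Polynomial.monom a i \<in> lin_span (c ` ?K) ?M}"
          unfolding sub_mod_def
        proof (intro conjI ballI)
          show "0 \<in> {a. Polynomial.monom a i \<in> lin_span (c ` ?K) ?M}" using sub_modD(1)[OF sM] by simp
        next
          fix a b assume "a \<in> {a. Polynomial.monom a i \<in> lin_span (c ` ?K) ?M}" "b \<in> {a. Polynomial.monom a i \<in> lin_span (c ` ?K) ?M}"
          then show "a + b \<in> {a. Polynomial.monom a i \<in> lin_span (c ` ?K) ?M}"
            using sub_modD(2)[OF sM] by (simp flip: add_monom)
        next
          fix k a assume k: "k \<in> ?K" and "a \<in> {a. Polynomial.monom a i \<in> lin_span (c ` ?K) ?M}"
          then have "c k * Polynomial.monom a i \<in> lin_span (c ` ?K) ?M" using sub_modD(3)[OF sM] by blast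
          then show "k * a \<in> {a. Polynomial.monom a i \<in> lin_span (c ` ?K) ?M}"
            by (simp add: c_def smult_monom)
        qed
        show "J \<subseteq> {a. Polynomial.monom a i \<in> lin_span (c ` ?K) ?M}"
          using i by (auto intro!: lin_span_incl)
      qed
      then show ?thesis using a by blast
    qed
    have rM: "r n \<in> lin_span (c ` ?K) ?M" for n
    proof -
      have "Polynomial.degree (r n) \<le> ?N - 1" using inv[of n] False by (intro degree_le) auto
      then have "r n = (\<Sum>i\<le>?N - 1. Polynomial.monom (poly.coeff (r n) i) i)" by (simp add: poly_as_sum_of_monoms')
      also have "\<dots> \<in> lin_span (c ` ?K) ?M"
      proof (intro sub_mod_sum[OF sM] mon)
        fix i assume "i \<in> {..?N - 1}"
        then show "i < ?N" using False by auto
        show "poly.coeff (r n) i \<in> lin_span ?K J" using inv[of n] polysD R(5) by blast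
      qed
      finally show ?thesis .
    qed
    let ?L = "lin_span (c ` ?K) (range r)"
    have "fin_gen (c ` ?K) ?L"
    proof (rule fin_gen_submodule[OF cK, of 0 ?M])
      show "?L \<subseteq> lin_span (c ` ?K) ?M" by (rule lin_span_least[OF sM]) (use rM in auto)
      show "0 * j \<in> ?L" for j using sub_modD(1)[OF sub_mod_lin_span[of "c ` ?K" "range r"]] by simp
    qed (use sub_ringD(1)[OF cK] noethD[OF nc] R(4) sub_mod_lin_span in auto)
    then obtain G where G: "finite G" "G \<subseteq> ?L" "?L \<subseteq> lin_span (c ` ?K) G" by (rule fin_genE)
    have "\<exists>n. G \<subseteq> lin_span (c ` ?K) (r ` {..<n})" using G(1,2)
    proof (induction G rule: finite_induct)
      case (insert g G)
      then obtain i where i: "G \<subseteq> lin_span (c ` ?K) (r ` {..<i})" by auto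
      obtain j where j: "g \<in> lin_span (c ` ?K) (r ` {..<j})" using lin_span_chain[OF cK] insert.prems by blast
      have "lin_span (c ` ?K) (r ` {..<i}) \<subseteq> lin_span (c ` ?K) (r ` {..<max i j})"
        "lin_span (c ` ?K) (r ` {..<j}) \<subseteq> lin_span (c ` ?K) (r ` {..<max i j})"
        by (intro lin_span_mono image_mono; auto)+
      then show ?case using i j by (intro exI[of _ "max i j"]) auto
    qed auto
    then obtain n where n: "G \<subseteq> lin_span (c ` ?K) (r ` {..<n})" by blast
    have "r n \<in> lin_span (c ` ?K) (r ` {..<n})"
      using G(3) lin_span_least[OF sub_mod_lin_span n] lin_span_incl[of "r n" "range r"] by blast
    moreover have "lin_span (c ` ?K) (r ` {..<n}) \<subseteq>
        {f. \<exists>w\<in>polys ?K. (\<forall>i\<ge>n. poly.coeff w i = 0) \<and> s1 dvd f - w}"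
    proof (rule lin_span_least)
      show "sub_mod (c ` ?K) {f. \<exists>w\<in>polys ?K. (\<forall>i\<ge>n. poly.coeff w i = 0) \<and> s1 dvd f - w}"
        unfolding sub_mod_def
      proof (intro conjI ballI)
        show "0 \<in> {f. \<exists>w\<in>polys ?K. (\<forall>i\<ge>n. poly.coeff w i = 0) \<and> s1 dvd f - w}"
          using sub_ringD(1)[OF PK] by force
      next
        fix f g assume "f \<in> {f. \<exists>w\<in>polys ?K. (\<forall>i\<ge>n. poly.coeff w i = 0) \<and> s1 dvd f - w}"
          "g \<in> {f. \<exists>w\<in>polys ?K. (\<forall>i\<ge>n. poly.coeff w i = 0) \<and> s1 dvd f - w}"
        then obtain v w where v: "v \<in> polys ?K" "\<forall>i\<ge>n. poly.coeff v i = 0" "s1 dvd f - v"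
          and w: "w \<in> polys ?K" "\<forall>i\<ge>n. poly.coeff w i = 0" "s1 dvd g - w" by blast
        have "s1 dvd (f - v) + (g - w)" by (rule dvd_add[OF v(3) w(3)])
        then have "s1 dvd f + g - (v + w)" by (simp add: algebra_simps)
        moreover have "\<forall>i\<ge>n. poly.coeff (v + w) i = 0" using v(2) w(2) by simp
        ultimately show "f + g \<in> {f. \<exists>w\<in>polys ?K. (\<forall>i\<ge>n. poly.coeff w i = 0) \<and> s1 dvd f - w}"
          using sub_ringD(3)[OF PK v(1) w(1)] by blast
      next
        fix k f assume k: "k \<in> c ` ?K" and "f \<in> {f. \<exists>w\<in>polys ?K. (\<forall>i\<ge>n. poly.coeff w i = 0) \<and> s1 dvd f - w}"
        then obtain w where w: "w \<in> polys ?K" "\<forall>i\<ge>n. poly.coeff w i = 0" "s1 dvd f - w" by blast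
        obtain a where a: "a \<in> ?K" "k = [:a:]" using k unfolding c_def by blast
        have "k * f - Polynomial.smult a w = [:a:] * (f - w)" unfolding a(2) by (simp add: smult_diff_right)
        moreover have "s1 dvd [:a:] * (f - w)" using w(3) by (rule dvd_mult)
        ultimately have "s1 dvd k * f - Polynomial.smult a w" by simp
        moreover have "\<forall>i\<ge>n. poly.coeff (Polynomial.smult a w) i = 0" using w(2) by simp
        ultimately show "k * f \<in> {f. \<exists>w\<in>polys ?K. (\<forall>i\<ge>n. poly.coeff w i = 0) \<and> s1 dvd f - w}"
          using smult_in_polys[OF K a(1) w(1)] by blast
      qed
      show "r ` {..<n} \<subseteq> {f. \<exists>w\<in>polys ?K. (\<forall>i\<ge>n. poly.coeff w i = 0) \<and> s1 dvd f - w}"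
      proof (intro subsetI, elim imageE)
        fix f i assume "f = r i" "i \<in> {..<n}"
        moreover have "s1 dvd r i - Polynomial.monom 1 i" by (subst dvd_diff_commute) (use inv[of i] in blast)
        moreover have "Polynomial.monom 1 i \<in> polys ?K" by (rule monom_in_polys[OF K sub_ringD(2)[OF K]])
        ultimately show "f \<in> {f. \<exists>w\<in>polys ?K. (\<forall>i\<ge>n. poly.coeff w i = 0) \<and> s1 dvd f - w}"
          by (intro CollectI bexI[of _ "Polynomial.monom 1 i"]) simp_all
      qed
    qed
    ultimately obtain w where w: "w \<in> polys ?K" "\<forall>i\<ge>n. poly.coeff w i = 0" "s1 dvd r n - w" by blast
    have "s1 dvd (Polynomial.monom 1 n - r n) + (r n - w)" using inv[of n] w(3) by (intro dvd_add) blast+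
    then have "s1 dvd Polynomial.monom 1 n - w" by simp
    then have "s dvd Polynomial.monom 1 n - w" using s1(3) dvd_trans by blast
    then obtain u where "Polynomial.monom 1 n - w = s * u" by (rule dvdE)
    moreover have "Polynomial.monom 1 n - w \<in> polys ?K"
      using sub_ringD(6)[OF PK monom_in_polys[OF K sub_ringD(2)[OF K]] w(1)] .
    moreover have "Polynomial.monom 1 n - w \<noteq> 0"
    proof
      assume "Polynomial.monom 1 n - w = 0"
      then have "poly.coeff (Polynomial.monom 1 n - w) n = 0" by simp
      then show False using w(2) by simp
    qed
    ultimately show ?thesis by blast
  qed
qed

section \<open>The fractions of a polynomial ring in an algebraically closed field\<close>

definition cst :: "'a::idom \<Rightarrow> 'a poly fract alg_closure"
  where "cst c = to_ac (Fraction_Field.Fract [:c:] 1)"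

definition indet :: "'a::idom poly fract alg_closure"
  where "indet = to_ac (Fraction_Field.Fract [:0, 1:] 1)"

lemma cst_hom:
  fixes c d :: "'a::idom"
  shows "cst (c + d) = cst c + cst d" "cst (c * d) = cst c * cst d" "cst (0 :: 'a) = 0" "cst (1 :: 'a) = 1"
    "cst c = 0 \<longleftrightarrow> c = 0"
proof -
  have 0: "Fraction_Field.Fract 0 1 = (0 :: 'a poly fract)"
    by (rule Fraction_Field.Zero_fract_def[symmetric])
  show "cst (c + d) = cst c + cst d" "cst (c * d) = cst c * cst d"
    unfolding cst_def to_ac_add[symmetric] to_ac_mult[symmetric] by (simp_all add: mult.commute)
  show "cst (0 :: 'a) = 0" unfolding cst_def pCons_0_0 0 by simp
  have "Fraction_Field.Fract [:1:] 1 = (1 :: 'a poly fract)"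
    by (simp add: Fraction_Field.One_fract_def one_pCons)
  then show "cst (1 :: 'a) = 1" unfolding cst_def by simp
  have "Fraction_Field.Fract [:c:] 1 = Fraction_Field.Fract 0 1 \<longleftrightarrow> [:c:] * 1 = 0 * 1"
    by (rule eq_fract(1)) simp_all
  then show "cst c = 0 \<longleftrightarrow> c = 0" unfolding cst_def to_ac_eq_0_iff 0 by simp
qed

lemma map_poly_hom:
  fixes f :: "'a::comm_ring_1 \<Rightarrow> 'b::comm_ring_1"
  assumes "f 0 = 0" "\<And>x y. f (x + y) = f x + f y" "\<And>x y. f (x * y) = f x * f y"
  shows "map_poly f (g + h) = map_poly f g + map_poly f h" "map_poly f (g * h) = map_poly f g * map_poly f h"
proof -
  have s: "f (sum k S) = (\<Sum>i\<in>S. f (k i))" for k and S :: "nat set"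
    by (induction S rule: infinite_finite_induct) (auto simp: assms)
  show "map_poly f (g + h) = map_poly f g + map_poly f h"
    by (rule poly_eqI) (simp add: coeff_map_poly assms)
  show "map_poly f (g * h) = map_poly f g * map_poly f h"
    by (rule poly_eqI) (simp add: coeff_map_poly coeff_mult assms s)
qed

lemma map_poly_psub:
  fixes f :: "'a::comm_ring_1 \<Rightarrow> 'b::comm_ring_1"
  assumes "f 0 = 0" "q > 0"
  shows "map_poly f (psub q g) = psub q (map_poly f g)"
  using assms by (intro poly_eqI) (simp add: coeff_map_poly coeff_psub)

lemma polys_image:
  assumes "g \<in> polys (f ` A)" "0 \<in> A" "inj_on f A" "f 0 = 0"
  shows "\<exists>g'\<in>polys A. g = map_poly f g'"
proof
  let ?g = "map_poly (inv_into A f) g"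
  have i0: "inv_into A f 0 = 0" using assms(2,3,4) by (metis inv_into_f_f)
  have c: "poly.coeff ?g i = inv_into A f (poly.coeff g i)" for i by (simp add: coeff_map_poly i0)
  have "poly.coeff ?g i \<in> A" for i unfolding c by (rule inv_into_into[OF polysD[OF assms(1)]])
  then show "?g \<in> polys A" unfolding polys_def by blast
  show "g = map_poly f ?g"
  proof (rule poly_eqI)
    fix i
    have "poly.coeff (map_poly f ?g) i = f (inv_into A f (poly.coeff g i))"
      by (subst coeff_map_poly[where f = f, OF assms(4)]) (simp only: c)
    also have "\<dots> = poly.coeff g i" by (rule f_inv_into_f[OF polysD[OF assms(1)]])
    finally show "poly.coeff g i = poly.coeff (map_poly f ?g) i" by simp
  qed
qed

lemma map_poly_in_polys: "f 0 = 0 \<Longrightarrow> g \<in> polys A \<Longrightarrow> map_poly f g \<in> polys (f ` A)"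
  by (auto simp: polys_def coeff_map_poly)

lemma poly_cst_indet: "poly (map_poly cst g) indet = to_ac (Fraction_Field.Fract g 1)"
proof (induction g)
  case 0
  then show ?case by (simp add: Fraction_Field.Zero_fract_def[symmetric])
next
  case (pCons a g)
  have "pCons a g = [:a:] + [:0, 1:] * g" by simp
  then have e: "Fraction_Field.Fract (pCons a g) 1 =
      Fraction_Field.Fract [:a:] 1 + Fraction_Field.Fract [:0, 1:] 1 * Fraction_Field.Fract g 1"
    by simp
  have "poly (map_poly cst (pCons a g)) indet = cst a + indet * to_ac (Fraction_Field.Fract g 1)"
    using pCons.IH by (simp add: map_poly_pCons cst_hom)
  then show ?case unfolding e to_ac_add to_ac_mult cst_def indet_def .
qed

lemma CHAR_hom:
  fixes f :: "'a::comm_ring_1 \<Rightarrow> 'b::comm_ring_1"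
  assumes "f 0 = 0" "\<And>x y. f (x + y) = f x + f y" "f 1 = 1" "\<And>x. f x = 0 \<Longrightarrow> x = 0"
  shows "CHAR('b) = CHAR('a)"
proof (rule CHAR_eqI)
  have n: "f (of_nat n) = of_nat n" for n by (induction n) (auto simp: assms)
  show "of_nat CHAR('a) = (0::'b)" using n[of "CHAR('a)"] assms(1) by simp
  fix x assume "of_nat x = (0::'b)"
  then have "of_nat x = (0::'a)" using n[of x] assms(4) by simp
  then show "CHAR('a) dvd x" by (simp add: of_nat_eq_0_iff_char_dvd)
qed

lemma CHAR_fractions: "CHAR('a::idom poly fract alg_closure) = CHAR('a)"
  by (rule CHAR_hom[of cst]) (auto simp: cst_hom)

text \<open>
  With \<open>q = p\<^sup>m\<close>, the \<open>q\<close>-th power of \<open>g(x)\<close> is the value at the indeterminate of the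
  polynomial whose coefficients are the \<open>q\<close>-th powers of those of \<open>g\<close>.
\<close>

lemma root_of_indet_transcendental:
  fixes g :: "'a::idom poly"
  assumes p: "CHAR('a) > 0" and x: "x ^ (CHAR('a) ^ m) = indet" and z: "poly (map_poly cst g) x = 0"
  shows "g = 0"
proof -
  let ?q = "CHAR('a) ^ m" and ?f = "map_poly cst g"
  have q: "?q > 0" using p by simp
  have "poly (?f ^ ?q) x = 0" using z q by (simp add: poly_power power_0_left)
  moreover have "?f ^ ?q = psub ?q (frob_poly ?q ?f)"
    by (rule psub_frob_poly[symmetric, where p = "CHAR('a)" and e = m]) (rule CHAR_fractions[symmetric], rule p, rule refl)
  ultimately have "poly (frob_poly ?q ?f) indet = 0" by (simp add: poly_psub x)
  moreover have "cst (c ^ n) = cst c ^ n" for c :: 'a and n by (induction n) (auto simp: cst_hom)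
  then have "frob_poly ?q ?f = map_poly cst (map_poly (\<lambda>c. c ^ ?q) g)"
    using q by (intro poly_eqI) (simp add: coeff_map_poly cst_hom)
  ultimately have "to_ac (Fraction_Field.Fract (map_poly (\<lambda>c. c ^ ?q) g) 1) = 0"
    by (simp add: poly_cst_indet)
  then have "Fraction_Field.Fract (map_poly (\<lambda>c. c ^ ?q) g) 1 = Fraction_Field.Fract 0 1"
    unfolding to_ac_eq_0_iff Fraction_Field.Zero_fract_def .
  then have 0: "map_poly (\<lambda>c. c ^ ?q) g = 0" by (simp add: eq_fract)
  show "g = 0"
  proof (rule poly_eqI)
    fix i
    have "poly.coeff g i ^ ?q = 0" using arg_cong[OF 0, of "\<lambda>f. poly.coeff f i"] q by (simp add: coeff_map_poly)
    then show "poly.coeff g i = poly.coeff 0 i" by simp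
  qed
qed

lemma ex_root_sequence:
  fixes x :: "'a::alg_closed_field"
  assumes "p > 0"
  shows "\<exists>t. t 0 = x \<and> (\<forall>m. t (Suc m) ^ p = t m)"
proof -
  define t where "t = rec_nat x (\<lambda>_ y. SOME z. z ^ p = y)"
  have "t (Suc m) ^ p = t m" for m
    using someI_ex[OF nth_root_exists[OF assms, of "t m"]] by (simp add: t_def)
  then show ?thesis by (intro exI[of _ t]) (simp add: t_def)
qed

section \<open>Rings generated by a power series ring and roots of one element\<close>

text \<open>
  Horner's scheme in a ring given as a record; the coefficients are elements of a type.
\<close>

definition ring_eval :: "('r, 'm) ring_scheme \<Rightarrow> ('a::comm_ring_1 \<Rightarrow> 'r) \<Rightarrow> 'r \<Rightarrow> 'a poly \<Rightarrow> 'r"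
  where "ring_eval R \<alpha> x g = fold_coeffs (\<lambda>a y. \<alpha> a \<oplus>\<^bsub>R\<^esub> x \<otimes>\<^bsub>R\<^esub> y) g \<zero>\<^bsub>R\<^esub>"

text \<open>
  A ring \<open>R\<close> with the data of a map from the union of the levels \<open>A[t\<^sub>m]\<close>: the map \<open>\<alpha>\<close> on
  power series and compatible roots \<open>\<tau> m\<close>, the images of \<open>t\<^sub>m\<close>. The map at level \<open>m\<close> is
  \<open>phi m\<close>.
\<close>

locale tower_eval = cring R for R :: "('r, 'm) ring_scheme" (structure) +
  fixes p :: nat and V :: "nat set" and \<alpha> :: "'l::field mps \<Rightarrow> 'r" and \<tau> :: "nat \<Rightarrow> 'r"
  assumes p: "p = CHAR('l)" "p > 0" and V: "finite V"
    and \<alpha>_closed: "f \<in> mvars V \<Longrightarrow> \<alpha> f \<in> carrier R"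
    and \<alpha>_add: "f \<in> mvars V \<Longrightarrow> g \<in> mvars V \<Longrightarrow> \<alpha> (f + g) = \<alpha> f \<oplus> \<alpha> g"
    and \<alpha>_mult: "f \<in> mvars V \<Longrightarrow> g \<in> mvars V \<Longrightarrow> \<alpha> (f * g) = \<alpha> f \<otimes> \<alpha> g"
    and \<alpha>_one: "\<alpha> 1 = \<one>"
    and \<tau>_closed: "\<tau> m \<in> carrier R" and \<tau>_Suc: "\<tau> (Suc m) [^] p = \<tau> m"
begin

abbreviation "P \<equiv> polys (mvars V :: 'l mps set)"

definition phi :: "nat \<Rightarrow> 'l mps poly \<Rightarrow> 'r"
  where "phi m g = ring_eval R \<alpha> (\<tau> m) g"

abbreviation denom :: "'l poly \<Rightarrow> 'l mps poly"
  where "denom s \<equiv> map_poly mconst s"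

lemmas A_ring = sub_ring_mvars[of V, where 'a = 'l]
lemmas P_ring = sub_ring_polys[OF A_ring]

lemma \<alpha>_zero: "\<alpha> 0 = \<zero>"
proof -
  have z: "\<alpha> 0 \<in> carrier R" by (rule \<alpha>_closed[OF sub_ringD(1)[OF A_ring]])
  have "\<alpha> 0 \<oplus> \<alpha> 0 = \<alpha> 0"
    using \<alpha>_add[OF sub_ringD(1)[OF A_ring] sub_ringD(1)[OF A_ring]] by simp
  then show ?thesis using z by (metis add.l_cancel r_zero zero_closed)
qed

lemma phi_zero [simp]: "phi m 0 = \<zero>"
  by (simp add: phi_def ring_eval_def)

lemma pCons_in_P: "pCons a g \<in> P \<longleftrightarrow> a \<in> mvars V \<and> g \<in> P"
  by (auto simp: polys_def coeff_pCons split: nat.splits)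

lemma phi_pCons: "phi m (pCons a g) = \<alpha> a \<oplus> \<tau> m \<otimes> phi m g"
proof (cases "a = 0 \<and> g = 0")
  case True
  then show ?thesis using \<tau>_closed by (simp add: \<alpha>_zero)
next
  case False
  then have "fold_coeffs f (pCons a g) = f a \<circ> fold_coeffs f g" for f :: "'l mps \<Rightarrow> 'r \<Rightarrow> 'r"
    by (cases "a = 0") (simp_all add: fold_coeffs_pCons_coeff_not_0_eq fold_coeffs_pCons_not_0_0_eq)
  then show ?thesis by (simp add: phi_def ring_eval_def)
qed

lemma phi_closed: "g \<in> P \<Longrightarrow> phi m g \<in> carrier R"
  by (induction g) (auto simp: phi_pCons pCons_in_P \<alpha>_closed \<tau>_closed)

lemma phi_add: "f \<in> P \<Longrightarrow> g \<in> P \<Longrightarrow> phi m (f + g) = phi m f \<oplus> phi m g"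
proof (induction f g rule: poly_induct2)
  case (pCons a f b g)
  then have c: "f \<in> P" "g \<in> P" "a \<in> mvars V" "b \<in> mvars V" by (auto simp: pCons_in_P)
  note cl = phi_closed[OF c(1), of m] phi_closed[OF c(2), of m] \<alpha>_closed[OF c(3)] \<alpha>_closed[OF c(4)] \<tau>_closed[of m]
  show ?case using cl pCons.IH[OF c(1,2)] by (simp add: phi_pCons \<alpha>_add[OF c(3,4)] r_distr a_ac)
qed simp

lemma phi_smult: "a \<in> mvars V \<Longrightarrow> g \<in> P \<Longrightarrow> phi m (Polynomial.smult a g) = \<alpha> a \<otimes> phi m g"
proof (induction g)
  case 0
  then show ?case by (simp add: \<alpha>_closed)
next
  case (pCons b g)
  then have c: "g \<in> P" "b \<in> mvars V" by (auto simp: pCons_in_P)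
  note cl = phi_closed[OF c(1), of m] \<alpha>_closed[OF c(2)] \<alpha>_closed[OF pCons.prems(1)] \<tau>_closed[of m]
  show ?case using cl pCons.IH[OF pCons.prems(1) c(1)]
    by (simp add: phi_pCons \<alpha>_mult[OF pCons.prems(1) c(2)] r_distr m_lcomm)
qed

lemma phi_mult: "f \<in> P \<Longrightarrow> g \<in> P \<Longrightarrow> phi m (f * g) = phi m f \<otimes> phi m g"
proof (induction f)
  case 0
  then show ?case by (simp add: phi_closed)
next
  case (pCons a f)
  then have c: "f \<in> P" "a \<in> mvars V" by (auto simp: pCons_in_P)
  have fg: "f * g \<in> P" by (rule sub_ringD(4)[OF P_ring c(1) pCons.prems(2)])
  have ag: "Polynomial.smult a g \<in> P" by (rule smult_in_polys[OF A_ring c(2) pCons.prems(2)])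
  have 0: "pCons 0 (f * g) \<in> P" using fg sub_ringD(1)[OF A_ring] by (simp add: pCons_in_P)
  note cl = phi_closed[OF c(1), of m] phi_closed[OF pCons.prems(2), of m] \<alpha>_closed[OF c(2)] \<tau>_closed[of m]
  have "phi m (pCons a f * g) = \<alpha> a \<otimes> phi m g \<oplus> \<tau> m \<otimes> (phi m f \<otimes> phi m g)"
    unfolding mult_pCons_left phi_add[OF ag 0] phi_smult[OF c(2) pCons.prems(2)] phi_pCons[of m 0]
    using pCons.IH[OF c(1) pCons.prems(2)] cl by (simp add: \<alpha>_zero)
  then show ?case using cl by (simp add: phi_pCons l_distr m_assoc)
qed

lemma phi_monom: "phi m (Polynomial.monom 1 n) = \<tau> m [^] n"
proof (induction n)
  case 0
  then show ?case using \<tau>_closed[of m] by (simp add: monom_0 phi_pCons \<alpha>_one)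
next
  case (Suc n)
  have "phi m (Polynomial.monom 1 (Suc n)) = \<tau> m \<otimes> \<tau> m [^] n"
    using Suc \<tau>_closed[of m] by (simp add: monom_Suc phi_pCons \<alpha>_zero)
  also have "\<dots> = \<tau> m [^] Suc n" using \<tau>_closed[of m] by (simp add: m_comm)
  finally show ?case .
qed

lemma phi_psub: "g \<in> P \<Longrightarrow> phi (Suc m) (psub p g) = phi m g"
proof (induction g)
  case (pCons a g)
  then have c: "g \<in> P" "a \<in> mvars V" by (auto simp: pCons_in_P)
  have pg: "psub p g \<in> P" by (rule psub_in_polys[OF A_ring p(2) c(1)])
  have mn: "Polynomial.monom 1 p \<in> P" by (rule monom_in_polys[OF A_ring sub_ringD(2)[OF A_ring]])
  have a: "[:a:] \<in> P" using c const_in_polys[OF A_ring] by blast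
  have "psub p (pCons a g) = [:a:] + Polynomial.monom 1 p * psub p g"
    by (simp add: psub_def pcompose_pCons)
  then have "phi (Suc m) (psub p (pCons a g)) = phi (Suc m) [:a:] \<oplus> \<tau> (Suc m) [^] p \<otimes> phi (Suc m) (psub p g)"
    by (simp add: phi_add[OF a sub_ringD(4)[OF P_ring mn pg]] phi_mult[OF mn pg] phi_monom)
  then show ?case
    using pCons.IH[OF c(1)] \<tau>_Suc[of m] \<tau>_closed[of "Suc m"] \<alpha>_closed[OF c(2)] by (simp add: phi_pCons)
qed simp

lemma phi_raise: "g \<in> P \<Longrightarrow> phi (m + j) (psub (p ^ j) g) = phi m g"
proof (induction j)
  case 0
  have "psub (p ^ 0) g = g" by (rule poly_eqI) (simp add: coeff_psub)
  then show ?case by simp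
next
  case (Suc j)
  have "psub (p ^ Suc j) g = psub p (psub (p ^ j) g)" using p(2) by (simp add: psub_psub)
  then show ?case
    using phi_psub[OF psub_in_polys[OF A_ring _ Suc.prems], of "p ^ j" "m + j"] Suc p(2) by simp
qed

lemma mconst_eq_0_iff: "mconst c = 0 \<longleftrightarrow> c = 0" for c :: 'l
  by (metis mconst_hom(3) mnth_mconst mnth_simps(1))

lemma denom_eq_0_iff: "denom s = 0 \<longleftrightarrow> s = 0"
  by (simp add: poly_eq_iff coeff_map_poly mconst_hom mconst_eq_0_iff)

lemma denom_in_P: "denom s \<in> P"
  by (simp add: polys_def coeff_map_poly mconst_hom mconst_in_mvars)

lemma denom_hom: "denom (r * s) = denom r * denom s" "q > 0 \<Longrightarrow> denom (psub q s) = psub q (denom s)" "denom 1 = 1"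
  by (simp_all add: map_poly_hom map_poly_psub mconst_hom map_poly_1)

lemma phi_diff: "f \<in> P \<Longrightarrow> g \<in> P \<Longrightarrow> phi m (f - g) = phi m f \<ominus> phi m g"
proof -
  assume f: "f \<in> P" and g: "g \<in> P"
  have d: "f - g \<in> P" by (rule sub_ringD(6)[OF P_ring f g])
  have "phi m f = phi m (f - g) \<oplus> phi m g" using phi_add[OF d g, of m] by simp
  then show ?thesis using phi_closed[OF f, of m] phi_closed[OF g, of m] phi_closed[OF d, of m]
    by (simp add: a_minus_def a_assoc r_neg)
qed

end

text \<open>
  The further assumptions say that the map extends to the tower and is surjective. Rather than
  constructing the extension, ideals are pulled back directly to the tower over the power
  series in the algebraic closure of the field of rational functions over them.
\<close>

locale tower_quotient = tower_eval R p V \<alpha> \<tau>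
  for R :: "('r, 'm) ring_scheme" (structure) and p :: nat and V :: "nat set"
    and \<alpha> :: "'l::field mps \<Rightarrow> 'r" and \<tau> :: "nat \<Rightarrow> 'r" +
  fixes t :: "nat \<Rightarrow> 'l mps poly fract alg_closure"
  assumes t0: "t 0 = indet" and t_Suc: "t (Suc m) ^ p = t m"
    and constants_unit: "s \<noteq> 0 \<Longrightarrow> phi m (denom s) \<in> Units R"
    and generated: "y \<in> carrier R \<Longrightarrow> \<exists>m g s. g \<in> P \<and> s \<noteq> 0 \<and> phi m (denom s) \<otimes> y = phi m g"
begin

definition ev :: "nat \<Rightarrow> 'l mps poly \<Rightarrow> 'l mps poly fract alg_closure"
  where "ev m g = poly (map_poly cst g) (t m)"

lemma CHAR_mps: "CHAR('l mps) = CHAR('l)"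
proof (rule CHAR_hom[of mconst])
  fix c :: 'l assume "mconst c = 0"
  then have "mnth (mconst c) {#} = 0" by simp
  then show "c = 0" by (simp add: mnth_mconst)
qed (simp_all add: mconst_hom)

lemma ev_hom: "ev m (f + g) = ev m f + ev m g" "ev m (f * g) = ev m f * ev m g" "ev m 0 = 0" "ev m 1 = 1"
  by (simp_all add: ev_def map_poly_hom cst_hom map_poly_1)

lemma t_pow: "t m ^ (p ^ m) = indet"
  by (induction m) (auto simp: t0 t_Suc power_mult)

lemma ev_eq_0_iff: "ev m g = 0 \<longleftrightarrow> g = 0"
  using root_of_indet_transcendental[of "t m" m g] t_pow[of m] p by (auto simp: ev_def CHAR_mps)

lemma ev_eq_iff: "ev m f = ev m g \<longleftrightarrow> f = g"
proof
  assume "ev m f = ev m g"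
  moreover have "ev m f = ev m (f - g) + ev m g" by (simp flip: ev_hom(1))
  ultimately show "f = g" using ev_eq_0_iff[of m "f - g"] by simp
qed simp

definition C :: "'l mps poly fract alg_closure set"
  where "C = range (\<lambda>c. cst (mconst c))"

lemma polys_C: "s \<in> polys C \<Longrightarrow> \<exists>s'. s = map_poly cst (denom s')"
proof -
  assume "s \<in> polys C"
  moreover have "inj (\<lambda>c::'l. cst (mconst c))"
  proof (rule injI)
    fix x y :: 'l assume "cst (mconst x) = cst (mconst y)"
    moreover have "cst (mconst x) = cst (mconst (x - y)) + cst (mconst y)"
      by (simp flip: cst_hom mconst_hom)
    ultimately show "x = y" by (simp add: cst_hom mconst_eq_0_iff)
  qed
  ultimately obtain s' where "s = map_poly (\<lambda>c. cst (mconst c)) s'"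
    using polys_image[of s "\<lambda>c. cst (mconst c)" UNIV] unfolding C_def by (auto simp: cst_hom mconst_hom)
  then have "s = map_poly cst (denom s')"
    by (intro poly_eqI) (simp add: coeff_map_poly cst_hom mconst_hom)
  then show ?thesis by blast
qed

sublocale series_tower p t C "\<lambda>c. cst (mconst c)"
proof
  have ch: "CHAR('l mps poly fract alg_closure) = p" unfolding CHAR_fractions CHAR_mps p(1) ..
  show "p = CHAR('l mps poly fract alg_closure)" "p > 0" using ch p(2) by simp_all
  show "t (Suc m) ^ p = t m" for m by (rule t_Suc)
  have k: "cst (mconst (c + d)) = cst (mconst c) + cst (mconst d)"
    "cst (mconst (c * d)) = cst (mconst c) * cst (mconst d)" "cst (mconst 0) = 0" "cst (mconst 1) = 1" for c d :: 'l
    by (simp_all add: cst_hom mconst_hom)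
  show "sub_field C"
    unfolding sub_field_def sub_ring_def
  proof (intro conjI ballI)
    show "0 \<in> C" "1 \<in> C" unfolding C_def using k(3,4) by (metis rangeI)+
    fix x assume "x \<in> C"
    then obtain c where c: "x = cst (mconst c)" unfolding C_def by blast
    have "x + cst (mconst (- c)) = 0" unfolding c k(1)[symmetric] using k(3) by simp
    then have "- x = cst (mconst (- c))" by (simp add: add_eq_0_iff)
    then show "- x \<in> C" unfolding C_def by (metis rangeI)
    have "inverse x = cst (mconst (inverse c))"
    proof (cases "c = 0")
      case False
      then have "x * cst (mconst (inverse c)) = 1" unfolding c k(2)[symmetric] using k(4) by simp
      then show ?thesis by (rule inverse_unique)
    qed (simp add: c k(3))
    then show "inverse x \<in> C" unfolding C_def by (metis rangeI)
    fix y assume "y \<in> C"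
    then obtain d where d: "y = cst (mconst d)" unfolding C_def by blast
    show "x + y \<in> C" unfolding c d C_def k(1)[symmetric] by (rule rangeI)
    show "x * y \<in> C" unfolding c d C_def k(2)[symmetric] by (rule rangeI)
  qed
  show "poly s (t m) \<noteq> 0" if sC: "s \<in> polys C" "s \<noteq> 0" for s m
  proof -
    obtain s' where s': "s = map_poly cst (denom s')" using polys_C[OF sC(1)] by blast
    then have "denom s' \<noteq> 0" using sC(2) by auto
    then show ?thesis using ev_eq_0_iff[of m "denom s'"] s' by (simp add: ev_def)
  qed
  show "range (\<lambda>c. cst (mconst c)) = C" by (simp add: C_def)
qed

abbreviation "T \<equiv> tower (cst ` mvars V)"

lemma embeds_cst: "embeds V cst"
  unfolding embeds_def by (simp add: cst_hom)

lemma noeth_T: "noeth T"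
  using noeth_series[OF V embeds_cst] by blast

lemma T_ring: "sub_ring T"
  by (rule sub_ring_tower[OF sub_ring_embeds[OF embeds_cst] constants_embeds[OF embeds_cst]])

lemma inj_cst: "inj_on cst S"
proof (rule inj_onI)
  fix x y :: "'b::idom" assume "cst x = cst y"
  moreover have "cst x = cst (x - y) + cst y" by (simp flip: cst_hom)
  ultimately show "x = y" by (simp add: cst_hom)
qed

lemma T_eq: "T = {ev m g / ev m (denom s) | m g s. g \<in> P \<and> s \<noteq> 0}"
proof (intro equalityI subsetI)
  fix z assume "z \<in> T"
  then obtain m g s where g: "g \<in> polys (cst ` mvars V)" "s \<in> polys C" "s \<noteq> 0" "z = poly g (t m) / poly s (t m)"
    unfolding tower_def by blast
  obtain g' where g': "g' \<in> P" "g = map_poly cst g'"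
    using polys_image[OF g(1) sub_ringD(1)[OF A_ring] inj_cst] by (auto simp: cst_hom)
  obtain s' where s': "s = map_poly cst (denom s')" using polys_C[OF g(2)] by blast
  have "s' \<noteq> 0" using g(3) s' by auto
  then show "z \<in> {ev m g / ev m (denom s) | m g s. g \<in> P \<and> s \<noteq> 0}"
    using g(4) g' s' unfolding ev_def by blast
next
  fix z assume "z \<in> {ev m g / ev m (denom s) | m g s. g \<in> P \<and> s \<noteq> 0}"
  then obtain m g s where g: "g \<in> P" "s \<noteq> 0" "z = ev m g / ev m (denom s)" by blast
  have "map_poly cst (denom s) \<in> polys C"
    by (auto simp: polys_def coeff_map_poly cst_hom mconst_hom C_def)
  moreover have "map_poly cst (denom s) \<noteq> 0"
    using ev_eq_0_iff[of m "denom s"] g(2) by (auto simp: ev_def denom_eq_0_iff)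
  moreover have "map_poly cst g \<in> polys (cst ` mvars V)" by (rule map_poly_in_polys[where f = cst, OF cst_hom(3) g(1)])
  ultimately show "z \<in> T" unfolding g(3) ev_def by (intro towerI)
qed

lemma ev_raise: "ev (m + j) (psub (p ^ j) g) = ev m g"
  using p(2) unfolding ev_def by (simp add: map_poly_psub cst_hom poly_psub t_add)

text \<open>
  The preimage of \<open>J\<close> under the extension of \<open>phi\<close> to the tower.
\<close>

definition contraction :: "'r set \<Rightarrow> 'l mps poly fract alg_closure set"
  where "contraction J = {ev m g / ev m (denom s) | m g s. g \<in> P \<and> s \<noteq> 0 \<and> phi m g \<in> J}"

lemma raise_level:
  assumes "g \<in> P" "s \<noteq> 0" "m \<le> n"
  obtains g' s' where "g' \<in> P" "s' \<noteq> 0" "ev n g' = ev m g" "ev n (denom s') = ev m (denom s)"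
    "phi n g' = phi m g"
proof
  let ?q = "p ^ (n - m)"
  have q: "?q > 0" using p by simp
  have n: "n = m + (n - m)" using assms(3) by simp
  show "psub ?q g \<in> P" by (rule psub_in_polys[OF A_ring q assms(1)])
  show "psub ?q s \<noteq> 0" using psub_eq_0_iff[OF q] assms(2) by blast
  show "ev n (psub ?q g) = ev m g" using ev_raise[of m "n - m" g] n by simp
  show "ev n (denom (psub ?q s)) = ev m (denom s)" using ev_raise[of m "n - m" "denom s"] n q by (simp add: denom_hom)
  show "phi n (psub ?q g) = phi m g" using phi_raise[OF assms(1), of m "n - m"] n by simp
qed

lemma ideal_cancel_unit:
  assumes J: "ideal J R" and u: "u \<in> Units R" and y: "y \<in> carrier R" "u \<otimes> y \<in> J"
  shows "y \<in> J"
proof -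
  have "inv u \<otimes> (u \<otimes> y) \<in> J" using ideal.I_l_closed[OF J y(2)] u by simp
  moreover have "inv u \<otimes> (u \<otimes> y) = (inv u \<otimes> u) \<otimes> y" using u y(1) by (intro m_assoc[symmetric]) auto
  then have "inv u \<otimes> (u \<otimes> y) = y" using u y(1) by simp
  ultimately show ?thesis by simp
qed

text \<open>
  The map is well defined on the tower, because the denominators have units as images and, at
  a common level, equal values in the field come from equal polynomials.
\<close>

lemma mem_contraction:
  assumes J: "ideal J R" and z: "ev m g / ev m (denom s) \<in> contraction J" and g: "g \<in> P" "s \<noteq> 0"
  shows "phi m g \<in> J"
proof -
  obtain n f r where f: "f \<in> P" "r \<noteq> 0" "phi n f \<in> J" "ev m g / ev m (denom s) = ev n f / ev n (denom r)"
    using z unfolding contraction_def by blast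
  let ?N = "max m n"
  obtain g' s' where g': "g' \<in> P" "s' \<noteq> 0" "ev ?N g' = ev m g" "ev ?N (denom s') = ev m (denom s)" "phi ?N g' = phi m g"
    by (rule raise_level[OF g max.cobounded1])
  obtain f' r' where f': "f' \<in> P" "r' \<noteq> 0" "ev ?N f' = ev n f" "ev ?N (denom r') = ev n (denom r)" "phi ?N f' = phi n f"
    by (rule raise_level[OF f(1,2) max.cobounded2])
  have nz: "ev ?N (denom s') \<noteq> 0" "ev ?N (denom r') \<noteq> 0"
    using g'(2) f'(2) by (simp_all add: ev_eq_0_iff denom_eq_0_iff)
  have "ev ?N g' / ev ?N (denom s') = ev ?N f' / ev ?N (denom r')" using f(4) g'(3,4) f'(3,4) by simp
  then have "ev ?N (denom r' * g') = ev ?N (denom s' * f')"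
    using nz by (simp add: ev_hom field_simps)
  then have "denom r' * g' = denom s' * f'" by (simp add: ev_eq_iff)
  then have "phi ?N (denom r') \<otimes> phi ?N g' = phi ?N (denom s') \<otimes> phi ?N f'"
    by (metis phi_mult denom_in_P g'(1) f'(1))
  also have "\<dots> \<in> J" using ideal.I_l_closed[OF J] f(3) f'(5) phi_closed[OF denom_in_P] by simp
  finally have "phi ?N g' \<in> J" by (rule ideal_cancel_unit[OF J constants_unit[OF f'(2)] phi_closed[OF g'(1)]])
  then show ?thesis using g'(5) by simp
qed

lemma sub_mod_contraction:
  assumes J: "ideal J R" shows "sub_mod T (contraction J)"
  unfolding sub_mod_def
proof (intro conjI ballI)
  interpret J: ideal J R by (rule J)
  have "0 = ev 0 0 / ev 0 (denom 1)" by (simp add: ev_hom)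
  then show "0 \<in> contraction J" unfolding contraction_def
    using sub_ringD(1)[OF P_ring] J.zero_closed
    by (intro CollectI exI[of _ 0] exI[of _ 0] exI[of _ 1]) auto
next
  interpret J: ideal J R by (rule J)
  fix x y assume x: "x \<in> contraction J" and y: "y \<in> contraction J"
  obtain m g s where g: "g \<in> P" "s \<noteq> 0" "phi m g \<in> J" "x = ev m g / ev m (denom s)"
    using x unfolding contraction_def by blast
  obtain n f r where f: "f \<in> P" "r \<noteq> 0" "phi n f \<in> J" "y = ev n f / ev n (denom r)"
    using y unfolding contraction_def by blast
  let ?N = "max m n"
  obtain g' s' where g': "g' \<in> P" "s' \<noteq> 0" "ev ?N g' = ev m g" "ev ?N (denom s') = ev m (denom s)" "phi ?N g' = phi m g"
    by (rule raise_level[OF g(1,2) max.cobounded1])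
  obtain f' r' where f': "f' \<in> P" "r' \<noteq> 0" "ev ?N f' = ev n f" "ev ?N (denom r') = ev n (denom r)" "phi ?N f' = phi n f"
    by (rule raise_level[OF f(1,2) max.cobounded2])
  have nz: "ev ?N (denom s') \<noteq> 0" "ev ?N (denom r') \<noteq> 0"
    using g'(2) f'(2) by (simp_all add: ev_eq_0_iff denom_eq_0_iff)
  let ?g = "denom r' * g' + denom s' * f'"
  have in_P: "denom r' * g' \<in> P" "denom s' * f' \<in> P"
    using sub_ringD(4)[OF P_ring denom_in_P] g'(1) f'(1) by blast+
  have "x + y = ev ?N g' / ev ?N (denom s') + ev ?N f' / ev ?N (denom r')" using g(4) f(4) g'(3,4) f'(3,4) by simp
  also have "\<dots> = ev ?N ?g / ev ?N (denom (s' * r'))" using nz by (simp add: ev_hom denom_hom add_frac_eq algebra_simps)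
  finally have e: "x + y = ev ?N ?g / ev ?N (denom (s' * r'))" .
  have "phi ?N ?g = phi ?N (denom r') \<otimes> phi ?N g' \<oplus> phi ?N (denom s') \<otimes> phi ?N f'"
    by (simp add: phi_add[OF in_P] phi_mult[OF denom_in_P g'(1)] phi_mult[OF denom_in_P f'(1)])
  moreover have "\<dots> \<in> J"
    using g(3) f(3) g'(5) f'(5) J.I_l_closed phi_closed[OF denom_in_P] by (intro J.a_closed) simp_all
  ultimately have "phi ?N ?g \<in> J" by simp
  moreover have "?g \<in> P" using sub_ringD(3)[OF P_ring in_P] .
  moreover have "s' * r' \<noteq> 0" using g'(2) f'(2) by simp
  ultimately show "x + y \<in> contraction J" unfolding contraction_def using e by blast
next
  interpret J: ideal J R by (rule J)
  fix x y assume x: "x \<in> T" and y: "y \<in> contraction J"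
  obtain m g s where g: "g \<in> P" "s \<noteq> 0" "x = ev m g / ev m (denom s)"
    using x unfolding T_eq by blast
  obtain n f r where f: "f \<in> P" "r \<noteq> 0" "phi n f \<in> J" "y = ev n f / ev n (denom r)"
    using y unfolding contraction_def by blast
  let ?N = "max m n"
  obtain g' s' where g': "g' \<in> P" "s' \<noteq> 0" "ev ?N g' = ev m g" "ev ?N (denom s') = ev m (denom s)" "phi ?N g' = phi m g"
    by (rule raise_level[OF g(1,2) max.cobounded1])
  obtain f' r' where f': "f' \<in> P" "r' \<noteq> 0" "ev ?N f' = ev n f" "ev ?N (denom r') = ev n (denom r)" "phi ?N f' = phi n f"
    by (rule raise_level[OF f(1,2) max.cobounded2])
  have e: "x * y = ev ?N (g' * f') / ev ?N (denom (s' * r'))"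
    using g(3) f(4) g'(3,4) f'(3,4) by (simp add: ev_hom denom_hom)
  have "phi ?N (g' * f') \<in> J"
    using J.I_l_closed[of "phi ?N f'" "phi ?N g'"] f(3) f'(5) phi_closed[OF g'(1)] by (simp add: phi_mult[OF g'(1) f'(1)])
  moreover have "g' * f' \<in> P" using sub_ringD(4)[OF P_ring g'(1) f'(1)] .
  moreover have "s' * r' \<noteq> 0" using g'(2) f'(2) by simp
  ultimately show "x * y \<in> contraction J" unfolding contraction_def using e by blast
qed

theorem noetherian: "noetherian_ring R"
proof (rule noetherian_ringI)
  fix J assume J: "ideal J R"
  have JR: "J \<subseteq> carrier R" using ideal.Icarr[OF J] by blast
  have "contraction J \<subseteq> T" unfolding contraction_def T_eq by blast
  then obtain G where G: "finite G" "G \<subseteq> contraction J" "contraction J \<subseteq> lin_span T G"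
    using noethD[OF noeth_T sub_mod_contraction[OF J]] fin_genE by metis
  have "\<forall>z\<in>G. \<exists>y. y \<in> J \<and> (\<exists>m g s. g \<in> P \<and> s \<noteq> 0 \<and> y = phi m g \<and> z = ev m g / ev m (denom s))"
    using G(2) unfolding contraction_def by blast
  then obtain \<eta> where \<eta>: "\<And>z. z \<in> G \<Longrightarrow> \<eta> z \<in> J"
    "\<And>z. z \<in> G \<Longrightarrow> \<exists>m g s. g \<in> P \<and> s \<noteq> 0 \<and> \<eta> z = phi m g \<and> z = ev m g / ev m (denom s)"
    by (metis (no_types))
  let ?X = "\<eta> ` G"
  have X: "?X \<subseteq> carrier R" using \<eta>(1) JR by blast
  have I: "ideal (Idl ?X) R" by (rule genideal_ideal[OF X])
  have XI: "?X \<subseteq> Idl ?X" by (rule genideal_self[OF X])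
  \<comment> \<open>The numerators of the generators generate: the ideal spanned by their images has the
    same contraction.\<close>
  have "G \<subseteq> contraction (Idl ?X)"
  proof
    fix z assume z: "z \<in> G"
    then obtain m g s where "g \<in> P" "s \<noteq> 0" "\<eta> z = phi m g" "z = ev m g / ev m (denom s)" using \<eta>(2) by blast
    moreover have "\<eta> z \<in> Idl ?X" using XI z by blast
    ultimately show "z \<in> contraction (Idl ?X)" unfolding contraction_def by auto
  qed
  then have sub: "contraction J \<subseteq> contraction (Idl ?X)"
    using G(3) lin_span_least[OF sub_mod_contraction[OF I]] by blast
  have "J \<subseteq> Idl ?X"
  proof
    fix y assume y: "y \<in> J"
    then obtain m g s where g: "g \<in> P" "s \<noteq> 0" "phi m (denom s) \<otimes> y = phi m g"
      using generated JR by blast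
    have "phi m g \<in> J" unfolding g(3)[symmetric] by (rule ideal.I_l_closed[OF J y phi_closed[OF denom_in_P]])
    then have "ev m g / ev m (denom s) \<in> contraction J" using g unfolding contraction_def by blast
    then have "phi m g \<in> Idl ?X" using mem_contraction[OF I _ g(1,2)] sub by blast
    then show "y \<in> Idl ?X"
      using ideal_cancel_unit[OF I constants_unit[OF g(2)], of y m] y JR g(3) by auto
  qed
  moreover have "Idl ?X \<subseteq> J" by (rule genideal_minimal[OF J]) (use \<eta>(1) in blast)
  ultimately show "\<exists>A\<subseteq>carrier R. finite A \<and> J = Idl A" using G(1) X by blast
qed

end

section \<open>Pure tensors\<close>

text \<open>
  The calculus of pure tensors, for the ring obtained by dividing the free abelian group on
  pairs by the bilinear relations.
\<close>

locale tensor_product =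
  fixes K :: "('k, 'm) ring_scheme" and B :: "('k, 'b) module" and A :: "('k, 'a) module"
  assumes alg_B: "algebra K B" and alg_A: "algebra K A"
begin

definition pure :: "'b \<Rightarrow> 'a \<Rightarrow> ('b \<times> 'a \<Rightarrow>\<^sub>0 int) set"
  where "pure b a = tensor_null K B A +>\<^bsub>tensor_free B A\<^esub> frag_of (b, a)"

abbreviation (input) "R \<equiv> tensor_algebra K B A"
abbreviation (input) "F \<equiv> tensor_free B A"
abbreviation (input) "N \<equiv> tensor_null K B A"
abbreviation (input) "coset x \<equiv> N +>\<^bsub>F\<^esub> x"

lemmas F_cring = tensor_algebra_cring(1)[OF alg_B alg_A]
lemmas N_ideal = tensor_algebra_cring(2)[OF alg_B alg_A]
lemmas R_cring = tensor_algebra_cring(3)[OF alg_B alg_A]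

lemma coset_hom: "(\<lambda>x. coset x) \<in> ring_hom F R"
  unfolding tensor_algebra_def by (rule ideal.rcos_ring_hom[OF N_ideal])

lemma F_simps: "carrier F = {x. Poly_Mapping.keys x \<subseteq> carrier B \<times> carrier A}" "x \<oplus>\<^bsub>F\<^esub> y = x + y" "\<zero>\<^bsub>F\<^esub> = 0"
  "\<one>\<^bsub>F\<^esub> = frag_of (\<one>\<^bsub>B\<^esub>, \<one>\<^bsub>A\<^esub>)"
  by (auto simp: tensor_free_def)

lemma F_of_mult: "frag_of (b, a) \<otimes>\<^bsub>F\<^esub> frag_of (b', a') = frag_of (b \<otimes>\<^bsub>B\<^esub> b', a \<otimes>\<^bsub>A\<^esub> a')"
  by (simp add: tensor_free_def)

lemma frag_of_in_F: "b \<in> carrier B \<Longrightarrow> a \<in> carrier A \<Longrightarrow> frag_of (b, a) \<in> carrier F"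
  by (simp add: F_simps)

lemma pure_closed: "b \<in> carrier B \<Longrightarrow> a \<in> carrier A \<Longrightarrow> pure b a \<in> carrier R"
  unfolding pure_def by (rule ring_hom_closed[OF coset_hom frag_of_in_F])

text \<open>
  Additivity in each factor and the transfer of scalars between the factors are instances of
  this.
\<close>

lemma coset_eq_of_relation:
  assumes "x \<in> carrier F" "y \<in> carrier F" "x - y \<in> tensor_relations K B A"
  shows "coset x = coset y"
proof -
  interpret N: ideal N F by (rule N_ideal)
  interpret R: cring R by (rule R_cring)
  have "x - y \<in> N" unfolding tensor_null_def by (rule generate.incl[OF assms(3)])
  then have "coset (x - y) = \<zero>\<^bsub>R\<^esub>"
    using N.a_rcos_zero[OF N_ideal] by (simp add: tensor_algebra_def FactRing_def)
  moreover have "coset (y + (x - y)) = coset y \<oplus>\<^bsub>R\<^esub> coset (x - y)"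
    using ring_hom_add[OF coset_hom assms(2) N.Icarr[OF \<open>x - y \<in> N\<close>]] by (simp add: F_simps)
  ultimately show ?thesis using ring_hom_closed[OF coset_hom assms(2)] by simp
qed

lemma coset_add: "x \<in> carrier F \<Longrightarrow> y \<in> carrier F \<Longrightarrow> coset (x + y) = coset x \<oplus>\<^bsub>R\<^esub> coset y"
  using ring_hom_add[OF coset_hom] by (simp add: F_simps(2))

lemma pure_add_left:
  assumes "b \<in> carrier B" "b' \<in> carrier B" "a \<in> carrier A"
  shows "pure (b \<oplus>\<^bsub>B\<^esub> b') a = pure b a \<oplus>\<^bsub>R\<^esub> pure b' a"
proof -
  interpret B: cring B by (rule algebra.axioms[OF alg_B])
  interpret F: cring F by (rule F_cring)
  have c: "frag_of (b, a) \<in> carrier F" "frag_of (b', a) \<in> carrier F" "frag_of (b \<oplus>\<^bsub>B\<^esub> b', a) \<in> carrier F"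
    using assms by (auto intro: frag_of_in_F)
  have s: "frag_of (b, a) + frag_of (b', a) \<in> carrier F"
    using F.a_closed[OF c(1,2)] by (simp add: F_simps(2))
  have "frag_of (b \<oplus>\<^bsub>B\<^esub> b', a) - (frag_of (b, a) + frag_of (b', a)) \<in> tensor_relations K B A"
    using assms unfolding tensor_relations_def diff_diff_eq[symmetric] by blast
  from coset_eq_of_relation[OF c(3) s this] show ?thesis
    unfolding pure_def coset_add[OF c(1,2)] .
qed

lemma pure_add_right:
  assumes "b \<in> carrier B" "a \<in> carrier A" "a' \<in> carrier A"
  shows "pure b (a \<oplus>\<^bsub>A\<^esub> a') = pure b a \<oplus>\<^bsub>R\<^esub> pure b a'"
proof -
  interpret A: cring A by (rule algebra.axioms[OF alg_A])
  interpret F: cring F by (rule F_cring)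
  have c: "frag_of (b, a) \<in> carrier F" "frag_of (b, a') \<in> carrier F" "frag_of (b, a \<oplus>\<^bsub>A\<^esub> a') \<in> carrier F"
    using assms by (auto intro: frag_of_in_F)
  have s: "frag_of (b, a) + frag_of (b, a') \<in> carrier F"
    using F.a_closed[OF c(1,2)] by (simp add: F_simps(2))
  have "frag_of (b, a \<oplus>\<^bsub>A\<^esub> a') - (frag_of (b, a) + frag_of (b, a')) \<in> tensor_relations K B A"
    using assms unfolding tensor_relations_def diff_diff_eq[symmetric] by blast
  from coset_eq_of_relation[OF c(3) s this] show ?thesis
    unfolding pure_def coset_add[OF c(1,2)] .
qed

lemma pure_smult:
  assumes "c \<in> carrier K" "b \<in> carrier B" "a \<in> carrier A"
  shows "pure (c \<odot>\<^bsub>B\<^esub> b) a = pure b (c \<odot>\<^bsub>A\<^esub> a)"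
proof -
  interpret B: algebra K B by (rule alg_B)
  interpret A: algebra K A by (rule alg_A)
  have "c \<odot>\<^bsub>B\<^esub> b \<in> carrier B" "c \<odot>\<^bsub>A\<^esub> a \<in> carrier A"
    using assms B.smult_closed A.smult_closed by auto
  moreover have "frag_of (c \<odot>\<^bsub>B\<^esub> b, a) - frag_of (b, c \<odot>\<^bsub>A\<^esub> a) \<in> tensor_relations K B A"
    using assms unfolding tensor_relations_def by blast
  ultimately show ?thesis
    unfolding pure_def using assms by (intro coset_eq_of_relation frag_of_in_F)
qed

lemma pure_mult:
  assumes "b \<in> carrier B" "b' \<in> carrier B" "a \<in> carrier A" "a' \<in> carrier A"
  shows "pure b a \<otimes>\<^bsub>R\<^esub> pure b' a' = pure (b \<otimes>\<^bsub>B\<^esub> b') (a \<otimes>\<^bsub>A\<^esub> a')"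
  unfolding pure_def
  using ring_hom_mult[OF coset_hom frag_of_in_F[OF assms(1,3)] frag_of_in_F[OF assms(2,4)]]
  by (simp add: F_of_mult)

lemma pure_one: "pure \<one>\<^bsub>B\<^esub> \<one>\<^bsub>A\<^esub> = \<one>\<^bsub>R\<^esub>"
  unfolding pure_def using ring_hom_one[OF coset_hom] by (simp add: F_simps(4))

text \<open>
  Elements of a free abelian group are built from generators by differences.
\<close>

lemma tensor_induct [consumes 1, case_names pure zero minus]:
  assumes y: "y \<in> carrier R"
    and pure: "\<And>b a. b \<in> carrier B \<Longrightarrow> a \<in> carrier A \<Longrightarrow> Q (pure b a)"
    and zero: "Q \<zero>\<^bsub>R\<^esub>"
    and minus: "\<And>x y. x \<in> carrier R \<Longrightarrow> y \<in> carrier R \<Longrightarrow> Q x \<Longrightarrow> Q y \<Longrightarrow> Q (x \<ominus>\<^bsub>R\<^esub> y)"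
  shows "Q y"
proof -
  interpret F: cring F by (rule F_cring)
  interpret N: ideal N F by (rule N_ideal)
  interpret R: cring R by (rule R_cring)
  obtain x where x: "x \<in> carrier F" "y = coset x"
    using y by (auto simp: tensor_algebra_def FactRing_def A_RCOSETS_def')
  have "x \<in> carrier F \<and> Q (coset x)"
    using x(1)[unfolded F_simps(1) mem_Collect_eq]
  proof (induction x rule: frag_induction)
    case zero
    have "coset \<zero>\<^bsub>F\<^esub> = \<zero>\<^bsub>R\<^esub>" by (rule ring_hom_zero[OF coset_hom cring.axioms(1)[OF F_cring] cring.axioms(1)[OF R_cring]])
    then show ?case using assms(3) F.zero_closed by (simp add: F_simps(3))
  next
    case (one u)
    then show ?case using pure[of "fst u" "snd u"] frag_of_in_F[of "fst u" "snd u"] by (auto simp: pure_def)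
  next
    case (diff u v)
    have "u \<ominus>\<^bsub>F\<^esub> v = u - v"
    proof -
      have "\<ominus>\<^bsub>F\<^esub> v = - v" by (rule F.minus_equality) (use diff in \<open>auto simp: F_simps\<close>)
      then show ?thesis by (simp add: a_minus_def F_simps(2))
    qed
    moreover have "coset (u \<ominus>\<^bsub>F\<^esub> v) = coset u \<ominus>\<^bsub>R\<^esub> coset v"
    proof -
      interpret h: ring_hom_ring F R "\<lambda>x. coset x"
        by (rule ring_hom_ringI2[OF cring.axioms(1)[OF F_cring] cring.axioms(1)[OF R_cring] coset_hom])
      show ?thesis using diff by (simp add: a_minus_def)
    qed
    ultimately show ?case
      using diff F.minus_closed[of u v] minus[of "coset u" "coset v"] ring_hom_closed[OF coset_hom] by auto
  qed
  then show ?thesis using x(2) by simp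
qed

end

section \<open>The exponents of formal power series\<close>

text \<open>
  Exponents as finitely supported functions correspond to exponents as multisets.
\<close>

definition exps :: "(nat \<Rightarrow>\<^sub>0 nat) \<Rightarrow> nat multiset"
  where "exps \<alpha> = Abs_multiset (Poly_Mapping.lookup \<alpha>)"

lemma count_exps: "count (exps \<alpha>) = Poly_Mapping.lookup \<alpha>"
  unfolding exps_def by (rule count_Abs_multiset) simp

lemma exps_add: "exps (\<alpha> + \<beta>) = exps \<alpha> + exps \<beta>"
  by (rule multiset_eqI) (simp add: count_exps lookup_add)

lemma exps_zero: "exps 0 = {#}"
  by (rule multiset_eqI) (simp add: count_exps)

lemma exps_eq_iff: "exps \<alpha> = exps \<beta> \<longleftrightarrow> \<alpha> = \<beta>"
  by (metis count_exps poly_mapping_eqI)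

lemma set_mset_exps: "set_mset (exps \<alpha>) = Poly_Mapping.keys \<alpha>"
  by (rule Set.set_eqI) (simp only: in_keys_iff count_exps[symmetric] count_eq_zero_iff not_not)

lemma exps_surj: "\<exists>\<alpha>. exps \<alpha> = M"
proof
  have "{i. count M i \<noteq> 0} = set_mset M" by (auto simp: count_eq_zero_iff)
  then have "finite {i. count M i \<noteq> 0}" by simp
  then have "Poly_Mapping.lookup (Abs_poly_mapping (count M)) = count M" by simp
  then show "exps (Abs_poly_mapping (count M)) = M" by (intro multiset_eqI) (simp add: count_exps)
qed

lemma splits_exps: "(\<Sum>u\<in>splits (exps \<alpha>). F (fst u) (snd u)) = (\<Sum>(\<beta>, \<gamma>) | \<beta> + \<gamma> = \<alpha>. F (exps \<beta>) (exps \<gamma>))"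
proof -
  define unexp where "unexp M = (SOME \<alpha>. exps \<alpha> = M)" for M
  have unexp: "exps (unexp M) = M" for M unfolding unexp_def by (rule someI_ex[OF exps_surj])
  have unexp': "unexp (exps \<alpha>) = \<alpha>" for \<alpha> using unexp[of "exps \<alpha>"] by (simp add: exps_eq_iff)
  have unexp_add: "unexp P + unexp Q = \<alpha>" if "P + Q = exps \<alpha>" for P Q
    using that by (simp add: exps_eq_iff[symmetric] exps_add unexp)
  show ?thesis
    by (rule sum.reindex_bij_witness[of _ "\<lambda>(\<beta>, \<gamma>). (exps \<beta>, exps \<gamma>)" "\<lambda>(P, Q). (unexp P, unexp Q)"])
      (auto simp: splits_def unexp unexp' exps_add unexp_add)
qed

definition coeffs_of :: "'a mps \<Rightarrow> (nat \<Rightarrow>\<^sub>0 nat) \<Rightarrow> 'a"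
  where "coeffs_of f \<alpha> = mnth f (exps \<alpha>)"

lemma coeffs_of_hom:
  "coeffs_of (f + g) = coeffs_of f \<oplus>\<^bsub>mfps h n\<^esub> coeffs_of g"
  "coeffs_of (f * g) = coeffs_of f \<otimes>\<^bsub>mfps h n\<^esub> coeffs_of g"
  "coeffs_of 1 = \<one>\<^bsub>mfps h n\<^esub>"
  "coeffs_of (mconst (h c)) = c \<odot>\<^bsub>mfps h n\<^esub> \<one>\<^bsub>mfps h n\<^esub>"
proof -
  have e: "exps \<alpha> = {#} \<longleftrightarrow> \<alpha> = 0" for \<alpha> by (metis exps_eq_iff exps_zero)
  show "coeffs_of (f + g) = coeffs_of f \<oplus>\<^bsub>mfps h n\<^esub> coeffs_of g"
    by (rule ext) (simp add: coeffs_of_def mfps_def)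
  show "coeffs_of (f * g) = coeffs_of f \<otimes>\<^bsub>mfps h n\<^esub> coeffs_of g"
    by (rule ext) (simp add: coeffs_of_def mfps_def mnth_mult splits_exps[of "\<lambda>P Q. mnth f P * mnth g Q"])
  show "coeffs_of 1 = \<one>\<^bsub>mfps h n\<^esub>"
    by (rule ext) (simp add: coeffs_of_def mfps_def e)
  show "coeffs_of (mconst (h c)) = c \<odot>\<^bsub>mfps h n\<^esub> \<one>\<^bsub>mfps h n\<^esub>"
    by (rule ext) (simp add: coeffs_of_def mfps_def e mnth_mconst)
qed

lemma coeffs_of_closed: "f \<in> mvars {..<n} \<Longrightarrow> coeffs_of f \<in> carrier (mfps h n)"
  using mvarsD[of f "{..<n}"] by (fastforce simp: mfps_def coeffs_of_def set_mset_exps[symmetric])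

lemma coeffs_of_surj:
  assumes "a \<in> carrier (mfps h n)"
  shows "\<exists>f\<in>mvars {..<n}. coeffs_of f = a"
proof -
  define unexp where "unexp M = (SOME \<alpha>. exps \<alpha> = M)" for M
  have unexp: "exps (unexp M) = M" for M unfolding unexp_def by (rule someI_ex[OF exps_surj])
  have unexp': "unexp (exps \<alpha>) = \<alpha>" for \<alpha> using unexp[of "exps \<alpha>"] by (simp add: exps_eq_iff)
  define f where "f = Abs_mps (\<lambda>M. a (unexp M))"
  have fn: "mnth f M = a (unexp M)" for M unfolding f_def by (simp add: Abs_mps_inverse)
  have "f \<in> mvars {..<n}"
  proof (rule mvarsI)
    fix M assume "\<not> set_mset M \<subseteq> {..<n}"
    then have "\<not> Poly_Mapping.keys (unexp M) \<subseteq> {..<n}" using set_mset_exps[of "unexp M"] unexp[of M] by simp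
    then show "mnth f M = 0" using assms unfolding fn by (auto simp: mfps_def)
  qed
  moreover have "coeffs_of f = a" by (rule ext) (simp add: coeffs_of_def fn unexp')
  ultimately show ?thesis by blast
qed

section \<open>The perfect closure of the rational function field\<close>

lemma ratfun_const_eq: "ratfun_const = cst" "ratfun_t = indet"
  by (auto simp: ratfun_const_def cst_def ratfun_t_def indet_def)

text \<open>
  The field generated by the constants and the roots \<open>r\<close> with \<open>r\<^sup>q = t\<close> has only one such root
  to adjoin, as the Frobenius map is injective; so it is contained in the field of fractions
  of the polynomials in \<open>s\<close>.
\<close>

lemma ratfun_root_fractions:
  fixes x :: "'k::field poly fract alg_closure"
  assumes p: "p = CHAR('k)" "p > 0" and s: "s ^ (p ^ m) = indet"
    and x: "x \<in> ratfun_root m"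
  shows "x \<in> fracs ((\<lambda>v. poly (map_poly cst v) s) ` UNIV)"
proof -
  let ?A = "(\<lambda>v. poly (map_poly cst v) s) ` (UNIV :: 'k poly set)"
  have A: "sub_ring ?A"
    unfolding sub_ring_def
  proof (intro conjI ballI)
    show "0 \<in> ?A" by (rule image_eqI[of _ _ 0]) auto
    show "1 \<in> ?A" by (rule image_eqI[of _ _ 1]) (auto simp: map_poly_1 cst_hom)
    fix x assume "x \<in> ?A"
    then obtain u where u: "x = poly (map_poly cst u) s" by blast
    have "map_poly cst (- u) + map_poly cst u = 0" by (simp flip: map_poly_hom(1)[OF cst_hom(3,1,2)])
    then have "map_poly cst (- u) = - map_poly cst u" by (rule minus_unique[symmetric, OF trans[OF add.commute]])
    then show "- x \<in> ?A" unfolding u by (intro image_eqI[of _ _ "- u"]) auto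
    fix y assume "y \<in> ?A"
    then obtain v where v: "y = poly (map_poly cst v) s" by blast
    show "x + y \<in> ?A" unfolding u v
      by (rule image_eqI[of _ _ "u + v"]) (simp_all add: map_poly_hom(1)[OF cst_hom(3,1,2)])
    show "x * y \<in> ?A" unfolding u v
      by (rule image_eqI[of _ _ "u * v"]) (simp_all add: map_poly_hom(2)[OF cst_hom(3,1,2)])
  qed
  have F: "sub_field (fracs ?A)" by (rule sub_field_fracs[OF A])
  note R = sub_ringD[OF sub_fieldD(1)[OF F]]
  have "x \<in> generate_field field_ring (range cst \<union> {r. r ^ (p ^ m) = indet})"
    using x unfolding ratfun_root_def ratfun_const_eq p(1) .
  then show ?thesis
  proof (induction x rule: generate_field.induct)
    case one
    then show ?case using R(2) by simp
  next
    case (incl r)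
    show ?case
    proof (cases "r \<in> range cst")
      case True
      then obtain c where "r = cst c" by blast
      then have "r \<in> ?A" by (intro image_eqI[of _ _ "[:c:]"]) (auto simp: map_poly_pCons cst_hom)
      then show ?thesis using subset_fracs[OF A] by blast
    next
      case False
      then have "r ^ (p ^ m) = s ^ (p ^ m)" using incl s by auto
      moreover have p': "p = CHAR('k poly fract alg_closure)" unfolding CHAR_fractions p(1) ..
      ultimately have "r = s" using frob_eq_iff[OF p' p(2) refl, of r m s] by blast
      then have "r \<in> ?A" by (intro image_eqI[of _ _ "[:0, 1:]"]) (auto simp: map_poly_pCons cst_hom)
      then show ?thesis using subset_fracs[OF A] by blast
    qed
  next
    case (a_inv h)
    then show ?case using R(5) by (simp add: field_ring_minus)
  next
    case (m_inv h)
    then show ?case using sub_fieldD(2)[OF F] field_ring_inverse[of h] by simp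
  next
    case (eng_add h1 h2)
    then show ?case using R(3) by simp
  next
    case (eng_mult h1 h2)
    then show ?case using R(4) by simp
  qed
qed

theorem corollary3p8:
  fixes h :: "'k::field \<Rightarrow> 'l::field" and n p :: nat
  assumes "CHAR('k) = p" and "p > 0"
    and "perfect_field TYPE('k)"
    and "algebraic_extension h"
  shows "noetherian_ring (tensor_algebra field_ring ratfun_per (mfps h n))"
proof -
  let ?K = "field_ring :: 'k ring" and ?B = "ratfun_per :: ('k, 'k poly fract alg_closure) module"
    and ?A = "mfps h n" and ?V = "{..<n}"
  have hom: "h \<in> ring_hom field_ring field_ring" using assms(4) unfolding algebraic_extension_def by blast
  note h = field_hom[OF hom]
  have pk: "p = CHAR('k)" "p > 0" using assms by auto
  have pl: "p = CHAR('l)" using CHAR_hom[of h] h pk(1) by simp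
  have algB: "algebra ?K ?B" by (rule ratfun_per_algebra) (use pk in simp)
  have algA: "algebra ?K ?A" by (rule mfps_algebra[OF hom])
  interpret tensor_product ?K ?B ?A by (rule tensor_product.intro[OF algB algA])
  let ?R = "tensor_algebra ?K ?B ?A"
  interpret R: cring ?R by (rule R_cring)
  interpret B: cring ?B by (rule algebra.axioms[OF algB])
  interpret A: cring ?A by (rule algebra.axioms[OF algA])
  \<comment> \<open>Two sequences of roots: one over the power series, for the tower, and one in the given
    field, whose tensors with one are the images of the former.\<close>
  obtain t :: "nat \<Rightarrow> 'l mps poly fract alg_closure" where t: "t 0 = indet" "\<And>m. t (Suc m) ^ p = t m"
    using ex_root_sequence[OF pk(2)] by blast
  obtain \<sigma> :: "nat \<Rightarrow> 'k poly fract alg_closure" where \<sigma>: "\<sigma> 0 = indet" "\<And>m. \<sigma> (Suc m) ^ p = \<sigma> m"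
    using ex_root_sequence[OF pk(2)] by blast
  have \<sigma>_pow: "\<sigma> m ^ (p ^ m) = indet" for m
    by (induction m) (auto simp: \<sigma> power_mult)
  have B_simps: "x \<otimes>\<^bsub>?B\<^esub> y = x * y" "x \<oplus>\<^bsub>?B\<^esub> y = x + y" "\<one>\<^bsub>?B\<^esub> = 1" "\<zero>\<^bsub>?B\<^esub> = 0"
    "c \<odot>\<^bsub>?B\<^esub> x = cst c * x" "carrier ?B = (\<Union>m. ratfun_root m)" for x y c
    by (simp_all add: ratfun_per_def ratfun_const_eq)
  have \<sigma>_root: "\<sigma> m \<in> ratfun_root m" for m
    unfolding ratfun_root_def ratfun_const_eq by (rule generate_field.incl) (use \<sigma>_pow[of m] pk in simp)
  then have \<sigma>B: "\<sigma> m \<in> carrier ?B" for m unfolding B_simps by blast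
  have cB: "cst c \<in> carrier ?B" for c
    unfolding B_simps ratfun_root_def ratfun_const_eq by (auto intro: generate_field.incl)
  define \<beta> where "\<beta> b = pure b \<one>\<^bsub>?A\<^esub>" for b
  define \<alpha> where "\<alpha> f = pure 1 (coeffs_of f)" for f :: "'l mps"
  define \<tau> where "\<tau> m = \<beta> (\<sigma> m)" for m
  have oneB: "1 \<in> carrier ?B" using B.one_closed by (simp add: B_simps)
  have \<beta>_closed: "b \<in> carrier ?B \<Longrightarrow> \<beta> b \<in> carrier ?R" for b
    unfolding \<beta>_def by (intro pure_closed A.one_closed)
  have \<beta>_add: "\<beta> (b + b') = \<beta> b \<oplus>\<^bsub>?R\<^esub> \<beta> b'" if "b \<in> carrier ?B" "b' \<in> carrier ?B" for b b'
    unfolding \<beta>_def using pure_add_left[OF that A.one_closed] by (simp add: B_simps)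
  have \<beta>_mult: "\<beta> (b * b') = \<beta> b \<otimes>\<^bsub>?R\<^esub> \<beta> b'" if "b \<in> carrier ?B" "b' \<in> carrier ?B" for b b'
    unfolding \<beta>_def using pure_mult[OF that A.one_closed A.one_closed] by (simp add: B_simps)
  have \<beta>_one: "\<beta> 1 = \<one>\<^bsub>?R\<^esub>" unfolding \<beta>_def using pure_one by (simp add: B_simps)
  have coA: "coeffs_of f \<in> carrier ?A" if "f \<in> mvars ?V" for f :: "'l mps" by (rule coeffs_of_closed[OF that])
  have \<alpha>_closed: "\<alpha> f \<in> carrier ?R" if "f \<in> mvars ?V" for f
    unfolding \<alpha>_def by (intro pure_closed oneB coA that)
  \<comment> \<open>The tensor product is balanced over the base field, so the two meanings of its constants
    agree.\<close>
  have \<alpha>_const: "\<alpha> (mconst (h c)) = \<beta> (cst c)" for c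
    unfolding \<alpha>_def \<beta>_def coeffs_of_hom(4)[where h = h and n = n and c = c]
    using pure_smult[of c 1 "\<one>\<^bsub>?A\<^esub>"] oneB by (simp add: B_simps)
  have pure_eq: "pure b (coeffs_of f) = \<beta> b \<otimes>\<^bsub>?R\<^esub> \<alpha> f" if "b \<in> carrier ?B" "f \<in> mvars ?V" for b f
    unfolding \<alpha>_def \<beta>_def using pure_mult[OF that(1) oneB A.one_closed coA[OF that(2)]] coA[OF that(2)]
    by (simp add: B_simps)
  interpret E: tower_eval ?R p ?V \<alpha> \<tau>
  proof unfold_locales
    show "p = CHAR('l)" "p > 0" "finite ?V" using pl pk by simp_all
    fix m
    show "\<tau> m \<in> carrier ?R" unfolding \<tau>_def by (intro \<beta>_closed \<sigma>B)
    have \<beta>_pow: "\<beta> (b ^ i) = \<beta> b [^]\<^bsub>?R\<^esub> i \<and> b ^ i \<in> carrier ?B" if "b \<in> carrier ?B" for b and i :: nat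
    proof (induction i)
      case (Suc i)
      then show ?case using \<beta>_mult[of "b ^ i" b] that B.m_closed[of "b ^ i" b] by (simp add: B_simps(1) mult.commute)
    qed (simp add: \<beta>_one oneB)
    show "\<tau> (Suc m) [^]\<^bsub>?R\<^esub> p = \<tau> m"
      using \<beta>_pow[OF \<sigma>B, of "Suc m" p] unfolding \<tau>_def \<sigma>(2) by simp
    show "\<alpha> 1 = \<one>\<^bsub>?R\<^esub>" unfolding \<alpha>_def coeffs_of_hom(3)[where h = h and n = n] using pure_one by (simp add: B_simps)
    fix f :: "'l mps" assume f: "f \<in> mvars ?V"
    show "\<alpha> f \<in> carrier ?R" by (rule \<alpha>_closed[OF f])
    fix g :: "'l mps" assume g: "g \<in> mvars ?V"
    show "\<alpha> (f + g) = \<alpha> f \<oplus>\<^bsub>?R\<^esub> \<alpha> g"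
      unfolding \<alpha>_def coeffs_of_hom(1)[where h = h and n = n] by (rule pure_add_right[OF oneB coA[OF f] coA[OF g]])
    show "\<alpha> (f * g) = \<alpha> f \<otimes>\<^bsub>?R\<^esub> \<alpha> g"
      unfolding \<alpha>_def coeffs_of_hom(2)[where h = h and n = n] pure_mult[OF oneB oneB coA[OF f] coA[OF g]]
      by (simp add: B_simps)
  qed
  let ?\<sigma> = "\<lambda>m v. poly (map_poly cst v) (\<sigma> m)"
  have eval_root: "?\<sigma> m v \<in> carrier ?B \<and> E.phi m (E.denom (map_poly h v)) = \<beta> (?\<sigma> m v)" for m v
  proof (induction v)
    case 0
    have "\<beta> 0 = \<zero>\<^bsub>?R\<^esub>" using \<alpha>_const[of 0] E.\<alpha>_zero by (simp add: h mconst_hom cst_hom)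
    then show ?case using B.zero_closed by (simp add: B_simps)
  next
    case (pCons c v)
    have cl: "\<sigma> m * ?\<sigma> m v \<in> carrier ?B" "?\<sigma> m (pCons c v) \<in> carrier ?B"
      using B.m_closed[OF \<sigma>B] B.a_closed[OF cB B.m_closed[OF \<sigma>B]] pCons.IH
      by (auto simp: B_simps(1,2) map_poly_pCons cst_hom)
    have \<tau>: "\<tau> m \<otimes>\<^bsub>?R\<^esub> \<beta> (?\<sigma> m v) = \<beta> (\<sigma> m * ?\<sigma> m v)"
      unfolding \<tau>_def using \<beta>_mult[OF \<sigma>B] pCons.IH by simp
    have "E.phi m (E.denom (map_poly h (pCons c v)))
        = \<alpha> (mconst (h c)) \<oplus>\<^bsub>?R\<^esub> \<tau> m \<otimes>\<^bsub>?R\<^esub> E.phi m (E.denom (map_poly h v))"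
      by (simp add: map_poly_pCons h mconst_hom E.phi_pCons)
    also have "\<dots> = \<beta> (cst c) \<oplus>\<^bsub>?R\<^esub> \<beta> (\<sigma> m * ?\<sigma> m v)"
      using pCons.IH \<tau> by (simp add: \<alpha>_const)
    also have "\<dots> = \<beta> (?\<sigma> m (pCons c v))"
      using \<beta>_add[OF cB cl(1)] by (simp add: map_poly_pCons cst_hom)
    finally show ?case using cl(2) by simp
  qed
  have \<sigma>_nz: "?\<sigma> m v \<noteq> 0" if "v \<noteq> 0" for m v
    using root_of_indet_transcendental[of "\<sigma> m" m v] \<sigma>_pow[of m] pk that by auto
  \<comment> \<open>Polynomials over the base field are inverted already in the first factor.\<close>
  have root_unit: "\<beta> (?\<sigma> m v) \<in> Units ?R" if "v \<noteq> 0" for m v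
  proof -
    let ?z = "?\<sigma> m v"
    have z: "?z \<in> carrier ?B" "?z \<noteq> 0" using eval_root \<sigma>_nz[OF that] by auto
    then obtain i where i: "?z \<in> ratfun_root i" unfolding B_simps by blast
    have "inv\<^bsub>field_ring\<^esub> ?z \<in> ratfun_root i"
      using i z(2) unfolding ratfun_root_def by (intro generate_field.m_inv) simp_all
    then have inv: "inverse ?z \<in> carrier ?B" using z(2) by (auto simp: field_ring_inverse B_simps)
    have "\<beta> ?z \<otimes>\<^bsub>?R\<^esub> \<beta> (inverse ?z) = \<one>\<^bsub>?R\<^esub>" "\<beta> (inverse ?z) \<otimes>\<^bsub>?R\<^esub> \<beta> ?z = \<one>\<^bsub>?R\<^esub>"
      using z inv by (simp_all add: \<beta>_mult[symmetric] \<beta>_one)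
    then show ?thesis using \<beta>_closed[OF z(1)] \<beta>_closed[OF inv] unfolding Units_def by blast
  qed
  have map_h: "map_poly h v = 0 \<longleftrightarrow> v = 0" for v
    by (simp add: poly_eq_iff coeff_map_poly h)
  have inj: "inj h"
  proof (rule injI)
    fix x y assume "h x = h y"
    moreover have "h x = h (x - y) + h y" by (simp flip: h(2))
    ultimately show "x = y" by (simp add: h(6))
  qed
  \<comment> \<open>A factor of a unit is a unit; this uses that the extension is algebraic.\<close>
  have constants_unit: "E.phi m (E.denom s) \<in> Units ?R" if s: "s \<noteq> 0" for m s
  proof -
    obtain u v where v: "v \<in> polys (range h)" "v \<noteq> 0" "v = s * u"
      using divides_base_poly[OF assms(4) s] by blast
    obtain v' where v': "v = map_poly h v'" using polys_image[OF v(1) UNIV_I inj h(4)] by blast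
    have "E.phi m (E.denom s) \<otimes>\<^bsub>?R\<^esub> E.phi m (E.denom u) = E.phi m (E.denom v)"
      unfolding v(3) E.denom_hom(1) by (rule E.phi_mult[OF E.denom_in_P E.denom_in_P, symmetric])
    also have "\<dots> = \<beta> (?\<sigma> m v')" using eval_root v' by simp
    also have "\<dots> \<in> Units ?R" by (rule root_unit) (use v(2) v' in auto)
    finally show ?thesis
      by (rule R.unit_factor) (intro E.phi_closed E.denom_in_P)+
  qed
  let ?gen = "\<lambda>y. \<exists>m g s. g \<in> E.P \<and> s \<noteq> 0 \<and> E.phi m (E.denom s) \<otimes>\<^bsub>?R\<^esub> y = E.phi m g"
  have generated: "?gen y" if "y \<in> carrier ?R" for y
    using that
  proof (induction rule: tensor_induct)
    case (pure b a)
    obtain f where f: "f \<in> mvars ?V" "coeffs_of f = a" using coeffs_of_surj[OF pure(2)] by blast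
    obtain m where m: "b \<in> ratfun_root m" using pure(1) unfolding B_simps by blast
    obtain v w where vw: "b = ?\<sigma> m v / ?\<sigma> m w" "?\<sigma> m w \<noteq> 0"
      using ratfun_root_fractions[OF pk \<sigma>_pow m] unfolding fracs_def by blast
    let ?g = "Polynomial.smult f (E.denom (map_poly h v))"
    have "E.phi m (E.denom (map_poly h w)) \<otimes>\<^bsub>?R\<^esub> (\<beta> b \<otimes>\<^bsub>?R\<^esub> \<alpha> f) = \<beta> (?\<sigma> m w) \<otimes>\<^bsub>?R\<^esub> \<beta> b \<otimes>\<^bsub>?R\<^esub> \<alpha> f"
      using eval_root[of w m] \<beta>_closed[of "?\<sigma> m w"] \<beta>_closed[OF pure(1)] \<alpha>_closed[OF f(1)] by (simp add: R.m_assoc)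
    also have "\<beta> (?\<sigma> m w) \<otimes>\<^bsub>?R\<^esub> \<beta> b = \<beta> (?\<sigma> m v)"
      using \<beta>_mult[of "?\<sigma> m w" b] eval_root[of w m] pure(1) vw by simp
    also have "\<beta> (?\<sigma> m v) \<otimes>\<^bsub>?R\<^esub> \<alpha> f = E.phi m ?g"
      using eval_root[of v m] \<beta>_closed[of "?\<sigma> m v"] \<alpha>_closed[OF f(1)]
      by (simp add: E.phi_smult[OF f(1) E.denom_in_P] R.m_comm)
    finally have "E.phi m (E.denom (map_poly h w)) \<otimes>\<^bsub>?R\<^esub> pure b a = E.phi m ?g"
      using pure_eq[OF pure(1) f(1)] f(2) by simp
    moreover have "?g \<in> E.P" by (rule smult_in_polys[OF sub_ring_mvars f(1) E.denom_in_P])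
    moreover have "map_poly h w \<noteq> 0" using vw(2) map_h[of w] by auto
    ultimately show ?case by blast
  next
    case zero
    have "E.phi 0 (E.denom 1) \<otimes>\<^bsub>?R\<^esub> \<zero>\<^bsub>?R\<^esub> = E.phi 0 0"
      using E.phi_closed[OF E.denom_in_P, of 0 1] by simp
    then show ?case using sub_ringD(1)[OF E.P_ring] one_neq_zero by blast
  next
    case (minus x y)
    obtain m g s where g: "g \<in> E.P" "s \<noteq> 0" "E.phi m (E.denom s) \<otimes>\<^bsub>?R\<^esub> x = E.phi m g"
      using minus(3) by blast
    obtain n f r where f: "f \<in> E.P" "r \<noteq> 0" "E.phi n (E.denom r) \<otimes>\<^bsub>?R\<^esub> y = E.phi n f"
      using minus(4) by blast
    \<comment> \<open>Both elements are written at a common level, with their denominators.\<close>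
    have raise: "\<exists>g' s'. g' \<in> E.P \<and> s' \<noteq> 0 \<and> E.phi (i + j) (E.denom s') \<otimes>\<^bsub>?R\<^esub> z = E.phi (i + j) g'"
      if z: "g \<in> E.P" "s \<noteq> 0" "E.phi i (E.denom s) \<otimes>\<^bsub>?R\<^esub> z = E.phi i g" for i j g s z
    proof (intro exI conjI)
      have q: "p ^ j > 0" using pk by simp
      show "psub (p ^ j) g \<in> E.P" by (rule psub_in_polys[OF sub_ring_mvars q z(1)])
      show "psub (p ^ j) s \<noteq> 0" using psub_eq_0_iff[OF q] z(2) by blast
      show "E.phi (i + j) (E.denom (psub (p ^ j) s)) \<otimes>\<^bsub>?R\<^esub> z = E.phi (i + j) (psub (p ^ j) g)"
        unfolding E.denom_hom(2)[OF q] E.phi_raise[OF z(1)] E.phi_raise[OF E.denom_in_P] by (rule z(3))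
    qed
    obtain g' s' where g': "g' \<in> E.P" "s' \<noteq> 0" "E.phi (m + n) (E.denom s') \<otimes>\<^bsub>?R\<^esub> x = E.phi (m + n) g'"
      using raise[OF g, of n] by blast
    obtain f' r' where f': "f' \<in> E.P" "r' \<noteq> 0" "E.phi (m + n) (E.denom r') \<otimes>\<^bsub>?R\<^esub> y = E.phi (m + n) f'"
      using raise[OF f, of m] unfolding add.commute[of n m] by blast
    let ?N = "m + n"
    have P: "E.denom r' * g' \<in> E.P" "E.denom s' * f' \<in> E.P"
      using sub_ringD(4)[OF E.P_ring E.denom_in_P] g'(1) f'(1) by blast+
    note cl = E.phi_closed[OF E.denom_in_P, of ?N s'] E.phi_closed[OF E.denom_in_P, of ?N r'] minus(1,2)
    have "E.phi ?N (E.denom (s' * r')) \<otimes>\<^bsub>?R\<^esub> (x \<ominus>\<^bsub>?R\<^esub> y)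
        = E.phi ?N (E.denom r') \<otimes>\<^bsub>?R\<^esub> (E.phi ?N (E.denom s') \<otimes>\<^bsub>?R\<^esub> x)
          \<ominus>\<^bsub>?R\<^esub> E.phi ?N (E.denom s') \<otimes>\<^bsub>?R\<^esub> (E.phi ?N (E.denom r') \<otimes>\<^bsub>?R\<^esub> y)"
      unfolding E.denom_hom(1) E.phi_mult[OF E.denom_in_P E.denom_in_P]
      using cl by (simp add: a_minus_def R.r_distr R.r_minus R.m_assoc R.m_lcomm)
    also have "\<dots> = E.phi ?N (E.denom r' * g' - E.denom s' * f')"
      unfolding E.phi_diff[OF P] E.phi_mult[OF E.denom_in_P g'(1)] E.phi_mult[OF E.denom_in_P f'(1)] g'(3) f'(3) ..
    finally have "E.phi ?N (E.denom (s' * r')) \<otimes>\<^bsub>?R\<^esub> (x \<ominus>\<^bsub>?R\<^esub> y)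
        = E.phi ?N (E.denom r' * g' - E.denom s' * f')" .
    moreover have "E.denom r' * g' - E.denom s' * f' \<in> E.P" by (rule sub_ringD(6)[OF E.P_ring P])
    moreover have "s' * r' \<noteq> 0" using g'(2) f'(2) by simp
    ultimately show ?case by blast
  qed
  interpret tower_quotient ?R p ?V \<alpha> \<tau> t
    by unfold_locales (fact t constants_unit generated)+
  show ?thesis by (rule noetherian)
qed

end
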